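(* Let $k$ be an algebraically closed field of characteristic $p>0$ and let $f(X)\in Xk[X]$ be a polynomial of degree $m:=\deg f$ prime to $p$. Assume that $f$ is reduced. Let $g(f)=\frac{(m-1)(p-1)}{2}$ be the genus of the curve $C_f: W^p-W=f(X)$. If $\frac{|G_{\infty,1}(f)|}{g(f)}>\frac{p}{p-1}$ (respectively $>\frac23$ for $p=2$), then $f(X)=XR(X)$, where $R(X)$ is an additive polynomial. Moreover, if $\deg f=1+p^n$, then $\frac{|G_{\infty,1}(f)|}{g(f)}=2p^n\frac{p}{p-1}$.
   Context: $f\in Xk[X]$ is reduced if it is a $k$-linear combination of monomials $X^i$ with $i\ge1$ prime to $p$. A polynomial $R\in k[X]$ is additive if it is of the form $\sum_ia_iX^{p^i}$. $C_f$ is the smooth projective curve with function field $k(X,W)$, $W^p-W=f(X)$; $\infty$ is its unique point above $X=\infty$; $G_{\infty,1}(f)$ is the wild inertia group at $\infty$ in $\mathrm{Aut}_kC_f$, i.e. the unique Sylow $p$-subgroup of the stabilizer of $\infty$.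
   Formalization: The first conclusion is corrected to f(X) = X R(X) + cX, with c the coefficient of X in f: a reduced f may have a linear term, and f = X^2 + X (p odd) satisfies all hypotheses but is not of the form X R(X) with R additive. *)

theory Defs
  imports "HOL-Algebra.Algebra" "HOL-Algebra.Algebraic_Closure_Type"
begin

definition reduced_poly :: "'k::field poly \<Rightarrow> bool" where
  "reduced_poly f \<longleftrightarrow> (\<forall>i. coeff f i \<noteq> 0 \<longrightarrow> i \<ge> 1 \<and> coprime i CHAR('k))"

definition additive_poly :: "'k::field poly \<Rightarrow> bool" where
  "additive_poly R \<longleftrightarrow> (\<exists>a n. R = (\<Sum>i\<le>n. monom (a i) (CHAR('k) ^ i)))"

text \<open>The function field \<open>k(X,W)\<close>, \<open>W\<^sup>p - W = f(X)\<close>, is realised inside an algebraic closure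
  of the rational function field \<open>k(X)\<close>. The choice of the root \<open>W\<close> is immaterial: the other
  roots are \<open>W + i\<close> with \<open>i\<close> in the prime field.\<close>

type_synonym 'k closure_kX = "'k poly fract alg_closure"

definition emb :: "'k::field poly \<Rightarrow> 'k closure_kX" where
  "emb q = to_ac (to_fract q)"

definition root_W :: "'k::field poly \<Rightarrow> 'k closure_kX" where
  "root_W f = (SOME W. W ^ CHAR('k) - W = emb f)"

lemma root_W_eq:
  fixes f :: "'k::field poly"
  assumes "CHAR('k) > 0"
  shows "root_W f ^ CHAR('k) - root_W f = emb f"
proof -
  have p: "CHAR('k) > 1"
    using prime_CHAR_semidom[OF assms] prime_gt_1_nat by blast
  define q where "q = monom 1 (CHAR('k)) - monom 1 1 - [:emb f:]"
  have "coeff q (CHAR('k)) = 1"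
    using p by (simp add: q_def coeff_pCons split: nat.split)
  hence "degree q > 0"
    using p le_degree[of q "CHAR('k)"] by simp
  then obtain W where "poly q W = 0"
    using alg_closed_imp_poly_has_root by blast
  hence "W ^ CHAR('k) - W = emb f"
    by (simp add: q_def poly_monom)
  thus ?thesis
    unfolding root_W_def by (rule someI)
qed

definition function_field :: "'k::field poly \<Rightarrow> 'k closure_kX ring" where
  "function_field f = ring_of_type_algebra
     \<lparr>carrier := generate_field ring_of_type_algebra
        (range (\<lambda>c. emb [:c:]) \<union> {emb [:0, 1:], root_W f})\<rparr>"

text \<open>The points of the smooth projective curve \<open>C\<^sub>f\<close> are the valuation rings \<open>\<O>\<close> of its function
  field with \<open>k \<subseteq> \<O>\<close>.\<close>

definition curve_points :: "'k::field poly \<Rightarrow> 'k closure_kX set set" where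
  "curve_points f = {\<O>. subring \<O> (function_field f) \<and> range (\<lambda>c. emb [:c:]) \<subseteq> \<O> \<and>
     \<O> \<noteq> carrier (function_field f) \<and>
     (\<forall>z\<in>carrier (function_field f). z \<in> \<O> \<or> inverse z \<in> \<O>)}"

text \<open>A point lies above \<open>X = \<infinity>\<close> iff \<open>X\<close> has a pole there, that is \<open>X \<notin> \<O>\<close>.\<close>

definition point_infty :: "'k::field poly \<Rightarrow> 'k closure_kX set" where
  "point_infty f = (THE \<O>. \<O> \<in> curve_points f \<and> emb [:0, 1:] \<notin> \<O>)"

text \<open>\<open>k\<close>-automorphisms of \<open>C\<^sub>f\<close> correspond to automorphisms of the function field that fix \<open>k\<close>
  pointwise.\<close>

definition Aut_curve :: "'k::field poly \<Rightarrow> ('k closure_kX \<Rightarrow> 'k closure_kX) monoid" where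
  "Aut_curve f = BijGroup (carrier (function_field f))
     \<lparr>carrier := {\<sigma> \<in> ring_hom (function_field f) (function_field f)
                        \<inter> Bij (carrier (function_field f)). \<forall>c. \<sigma> (emb [:c:]) = emb [:c:]}\<rparr>"

definition stabilizer_infty :: "'k::field poly \<Rightarrow> ('k closure_kX \<Rightarrow> 'k closure_kX) monoid" where
  "stabilizer_infty f = Aut_curve f
     \<lparr>carrier := stabilizer (Aut_curve f) (\<lambda>\<sigma> \<O>. \<sigma> ` \<O>) (point_infty f)\<rparr>"

text \<open>The wild inertia group at \<open>\<infinity>\<close>, as the unique Sylow \<open>p\<close>-subgroup of the stabilizer
  of \<open>\<infinity>\<close>.\<close>

definition wild_inertia_infty :: "'k::field poly \<Rightarrow> ('k closure_kX \<Rightarrow> 'k closure_kX) set" where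
  "wild_inertia_infty f = (THE H. subgroup H (stabilizer_infty f) \<and>
     card H = CHAR('k) ^ multiplicity CHAR('k) (Coset.order (stabilizer_infty f)))"

definition genus_f :: "'k::field poly \<Rightarrow> real" where
  "genus_f f = (real (degree f) - 1) * (real CHAR('k) - 1) / 2"

end

theory Submission
  imports Defs
begin

text \<open>
  At a place of the function field where \<open>x\<close> has a pole, \<open>w\<^sup>p\<close> and \<open>x\<^sup>m\<close>, \<open>m = deg f\<close>, differ by a
  unit, so the valuation of \<open>\<Sum> a\<^sub>j(x) w\<^sup>j\<close> is read off from pairwise distinct term valuations; this
  gives the unique point at infinity. An automorphism fixing it preserves the integral closure
  \<open>k[x, w]\<close> of \<open>k[x]\<close> and all pole orders, hence has the form \<open>x \<mapsto> a x + b\<close>, \<open>w \<mapsto> c w + P(x)\<close> with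
  \<open>c\<^sup>p = c = a\<^sup>m\<close> and \<open>f(a X + b) = c f + P\<^sup>p - P\<close>. The elements with \<open>a = 1\<close> form the unique Sylow
  \<open>p\<close>-subgroup, of order \<open>p |V|\<close>, where \<open>V\<close> is the group of all \<open>y\<close> such that \<open>f(X + y) - f(X)\<close> is
  of the form \<open>P\<^sup>p - P\<close>.

  If \<open>f\<close> has a monomial \<open>X\<^sup>M\<close>, \<open>M = 1 + l p\<^sup>a\<close> with \<open>l \<ge> 2\<close> prime to \<open>p\<close>, then for the largest such
  \<open>M\<close> a single coefficient of \<open>f(X + y) - f(X)\<close> is a nonzero polynomial of degree \<open>p\<^sup>a\<close> in \<open>y\<close> that
  vanishes on \<open>V\<close>; for \<open>p = 2\<close> it has a double zero at \<open>0\<close>, which gains a further factor \<open>2\<close>. So \<open>V\<close>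
  is too small. Otherwise \<open>f = X R + c X\<close>, and \<open>V\<close> is the zero set of a separable polynomial of
  degree \<open>p\<^bsup>2n\<^esup>\<close>.
\<close>

section \<open>Valuation rings\<close>

text \<open>Points are bare valuation rings, without a value group. Orders at infinity are therefore
  measured by powers of \<open>x\<close> alone: since \<open>x\<close> has a pole of order
  \<open>p\<close>, the \<open>p\<close>-th power of a function with pole order \<open>d\<close>
  must agree with \<open>x ^ d\<close> up to a unit. Every statement about valuations takes the form
  that some quotient of this kind is a unit or lies in the ring.

  Points have to be produced as well as compared. Chevalley's extension theorem supplies one at
  infinity and one above every finite value of \<open>X\<close>; the latter are what identifies
  \<open>k[x, w]\<close> with the functions having no pole outside infinity, and this is the reason
  why the stabilizer of infinity preserves \<open>k[x, w]\<close>.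

  The linear term \<open>c X\<close> survives in the conclusion because the group cannot see it: a
  translation changes \<open>c X\<close> by a constant, and over an algebraically closed field every
  constant has the form \<open>P^p - P\<close>.\<close>

definition is_subring :: "'a::field set \<Rightarrow> bool" where
  "is_subring S \<longleftrightarrow> 1 \<in> S \<and> (\<forall>a\<in>S. \<forall>b\<in>S. a - b \<in> S \<and> a * b \<in> S)"

lemma is_subring_closed:
  assumes "is_subring S"
  shows "0 \<in> S" "1 \<in> S" "a \<in> S \<Longrightarrow> - a \<in> S" "a \<in> S \<Longrightarrow> b \<in> S \<Longrightarrow> a + b \<in> S"
    "a \<in> S \<Longrightarrow> b \<in> S \<Longrightarrow> a - b \<in> S" "a \<in> S \<Longrightarrow> b \<in> S \<Longrightarrow> a * b \<in> S"
    "a \<in> S \<Longrightarrow> a ^ n \<in> S"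
proof -
  show 1: "1 \<in> S" and d: "a \<in> S \<Longrightarrow> b \<in> S \<Longrightarrow> a - b \<in> S"
    and m: "a \<in> S \<Longrightarrow> b \<in> S \<Longrightarrow> a * b \<in> S" for a b
    using assms by (auto simp: is_subring_def)
  show 0: "0 \<in> S" using d[OF 1 1] by simp
  show u: "a \<in> S \<Longrightarrow> - a \<in> S" for a using d[OF 0, of a] by simp
  show "a \<in> S \<Longrightarrow> b \<in> S \<Longrightarrow> a + b \<in> S" using d[of a "- b"] u[of b] by simp
  show "a \<in> S \<Longrightarrow> a ^ n \<in> S" by (induction n) (auto intro: 1 m)
qed

lemma is_subring_sum: "is_subring S \<Longrightarrow> (\<And>i. i \<in> I \<Longrightarrow> g i \<in> S) \<Longrightarrow> sum g I \<in> S"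
  by (induction I rule: infinite_finite_induct) (auto intro: is_subring_closed)

lemma is_subring_adjoin:
  assumes "is_subring S"
  shows "is_subring {poly q z |q. \<forall>i. coeff q i \<in> S}"
  unfolding is_subring_def
proof (intro conjI ballI)
  note c = is_subring_closed[OF assms]
  show "1 \<in> {poly q z |q. \<forall>i. coeff q i \<in> S}"
    by (intro CollectI exI[of _ 1]) (auto simp: coeff_1 c)
  fix a b assume "a \<in> {poly q z |q. \<forall>i. coeff q i \<in> S}" "b \<in> {poly q z |q. \<forall>i. coeff q i \<in> S}"
  then obtain q r where qr: "a = poly q z" "b = poly r z" "\<forall>i. coeff q i \<in> S" "\<forall>i. coeff r i \<in> S"
    by blast
  show "a - b \<in> {poly q z |q. \<forall>i. coeff q i \<in> S}"
    by (intro CollectI exI[of _ "q - r"]) (use qr c in auto)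
  show "a * b \<in> {poly q z |q. \<forall>i. coeff q i \<in> S}"
    by (intro CollectI exI[of _ "q * r"])
      (use qr c in \<open>auto simp: coeff_mult intro!: is_subring_sum[OF assms]\<close>)
qed

lemma poly_eq_sum:
  fixes z :: "'a::comm_semiring_1"
  assumes "degree q \<le> n"
  shows "poly q z = (\<Sum>i\<le>n. coeff q i * z ^ i)"
  unfolding poly_altdef using assms by (intro sum.mono_neutral_left) (auto simp: coeff_eq_0)

text \<open>Substituting the relation for \<open>inverse z\<close> into the leading term of the relation for \<open>z\<close>
  lowers the degree.\<close>

lemma relation_descent:
  fixes z :: "'a::field"
  assumes S: "is_subring S" and "t \<in> S" "z \<noteq> 0"
    and q: "\<forall>i. coeff q i \<in> (*) t ` S" "degree q \<le> Suc n" "poly q z = 1"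
    and r: "\<forall>i. coeff r i \<in> (*) t ` S" "degree r \<le> Suc n" "poly r (inverse z) = 1"
  obtains s where "\<forall>i. coeff s i \<in> (*) t ` S" "degree s \<le> n" "poly s z = 1"
proof -
  note c = is_subring_closed[OF S]
  let ?I = "(*) t ` S"
  have Iadd: "a + b \<in> ?I" if ab: "a \<in> ?I" "b \<in> ?I" for a b
  proof -
    obtain a' b' where "a = t * a'" "b = t * b'" "a' \<in> S" "b' \<in> S" using ab by auto
    thus ?thesis by (intro image_eqI[of _ _ "a' + b'"]) (auto simp: distrib_left intro: c)
  qed
  have Imult: "a * b \<in> ?I" if ab: "a \<in> S" "b \<in> ?I" for a b
  proof -
    obtain b' where "b = t * b'" "b' \<in> S" using ab by auto
    thus ?thesis using ab by (intro image_eqI[of _ _ "a * b'"]) (auto simp: mult_ac intro: c)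
  qed
  have IS: "a \<in> S" if "a \<in> ?I" for a using that c(6) \<open>t \<in> S\<close> by auto
  have I0: "0 \<in> ?I" using c(1) by force
  have Isum: "sum g A \<in> ?I" if "\<And>i. i \<in> A \<Longrightarrow> g i \<in> ?I" for g and A :: "nat set"
    using that by (induction A rule: infinite_finite_induct) (simp_all add: I0 Iadd)
  define N where "N = Suc n"
  define a where "a = coeff q"
  define b where "b = coeff r"
  have q1: "1 = (\<Sum>i\<le>N. a i * z ^ i)"
    using q poly_eq_sum[of q N z] by (simp add: a_def N_def)
  have r1: "1 = (\<Sum>i\<le>N. b i * inverse z ^ i)"
    using r poly_eq_sum[of r N "inverse z"] by (simp add: b_def N_def)
  have q2: "1 = (\<Sum>i\<le>n. a i * z ^ i) + a N * z ^ N"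
    using q1 by (simp add: N_def)
  have r2: "1 - b 0 = (\<Sum>i\<le>n. b (Suc i) * inverse z ^ Suc i)"
  proof -
    have "{..N} = insert 0 (Suc ` {..n})" unfolding N_def by (metis atMost_Suc_eq_insert_0)
    hence "(\<Sum>i\<le>N. b i * inverse z ^ i) = b 0 + (\<Sum>i\<le>n. b (Suc i) * inverse z ^ Suc i)"
      by (simp add: sum.reindex del: power_Suc)
    thus ?thesis using r1 by (simp add: diff_eq_eq add.commute del: power_Suc)
  qed
  have r3: "(1 - b 0) * z ^ N = (\<Sum>i\<le>n. b (Suc i) * z ^ (n - i))"
  proof -
    have "inverse z ^ Suc i * z ^ N = z ^ (n - i)" if "i \<le> n" for i
    proof -
      have "z ^ N = z ^ Suc i * z ^ (n - i)" using that by (simp add: N_def flip: power_add power_Suc)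
      thus ?thesis using \<open>z \<noteq> 0\<close> by (simp add: field_simps)
    qed
    thus ?thesis unfolding r2 sum_distrib_right by (intro sum.cong) (auto simp: mult.assoc simp del: power_Suc)
  qed
  \<comment> \<open>The relation for \<open>z\<close> is multiplied by \<open>1 - b 0\<close>, which
    need not be a unit; \<open>r3\<close> then replaces \<open>(1 - b 0) * z ^ N\<close> by lower
    powers, and the summand \<open>b 0\<close> restores the value 1.\<close>
  define s where "s = [:b 0:] + (\<Sum>i\<le>n. monom ((1 - b 0) * a i) i)
    + (\<Sum>i\<le>n. monom (a N * b (Suc i)) (n - i))"
  have ab: "a i \<in> ?I" "b i \<in> ?I" for i using q r by (auto simp: a_def b_def)
  have "poly s z = b 0 + (1 - b 0) * (\<Sum>i\<le>n. a i * z ^ i) + a N * (\<Sum>i\<le>n. b (Suc i) * z ^ (n - i))"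
    by (simp add: s_def poly_sum poly_monom sum_distrib_left mult.assoc)
  also have "\<dots> = b 0 + (1 - b 0) * ((\<Sum>i\<le>n. a i * z ^ i) + a N * z ^ N)"
    unfolding r3[symmetric] by (simp add: algebra_simps)
  also have "\<dots> = 1" unfolding q2[symmetric] by simp
  finally have s1: "poly s z = 1" .
  have s2: "degree s \<le> n"
    unfolding s_def
    by (intro degree_add_le degree_sum_le) (auto intro: order.trans[OF degree_monom_le])
  have s3: "coeff s i \<in> ?I" for i
    unfolding s_def coeff_add coeff_sum
    by (intro Iadd Isum; (simp add: coeff_pCons coeff_monom split: nat.splits)?)
      (intro conjI impI; (intro Imult c ab IS I0)?)+
  show thesis using that s1 s2 s3 by blast
qed

text \<open>Chevalley's extension theorem. A subring \<open>S\<close> containing \<open>R\<close>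
  and maximal among those without \<open>inverse t\<close> is a valuation ring: if \<open>z\<close>
  and \<open>inverse z\<close> were both missing, adjoining either would produce
  \<open>inverse t\<close>, and the two resulting relations could be played against each other until
  their degree is 0.\<close>

theorem valuation_ring_exists:
  fixes t :: "'a::field"
  assumes R: "is_subring R" "t \<in> R" "t \<noteq> 0" "inverse t \<notin> R"
  obtains S where "is_subring S" "R \<subseteq> S" "inverse t \<notin> S" "\<forall>z. z \<in> S \<or> inverse z \<in> S"
proof -
  define C where "C = {S. is_subring S \<and> R \<subseteq> S \<and> inverse t \<notin> S}"
  have "\<exists>M\<in>C. \<forall>B\<in>C. M \<subseteq> B \<longrightarrow> B = M"
  proof (rule subset_Zorn_nonempty)
    show "C \<noteq> {}" using R by (auto simp: C_def)
    fix D assume D: "D \<noteq> {}" "subset.chain C D"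
    hence DC: "B \<in> D \<Longrightarrow> B \<in> C" and ch: "B \<in> D \<Longrightarrow> Y \<in> D \<Longrightarrow> B \<subseteq> Y \<or> Y \<subseteq> B" for B Y
      by (auto simp: subset_chain_def)
    have "is_subring (\<Union>D)"
      unfolding is_subring_def
    proof (intro conjI ballI)
      show "1 \<in> \<Union>D" using D DC by (auto simp: C_def is_subring_def)
      fix a b assume "a \<in> \<Union>D" "b \<in> \<Union>D"
      then obtain B Y where "B \<in> D" "Y \<in> D" "a \<in> B" "b \<in> Y" by blast
      then obtain Z where "Z \<in> D" "a \<in> Z" "b \<in> Z" using ch[of B Y] by blast
      thus "a - b \<in> \<Union>D" "a * b \<in> \<Union>D"
        using DC[of Z] by (auto simp: C_def intro: is_subring_closed)
    qed
    thus "\<Union>D \<in> C" using D DC by (auto simp: C_def)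
  qed
  then obtain S where SC: "S \<in> C" and max: "\<And>B. B \<in> C \<Longrightarrow> S \<subseteq> B \<Longrightarrow> B = S" by blast
  have S: "is_subring S" "R \<subseteq> S" "inverse t \<notin> S" using SC by (auto simp: C_def)
  note c = is_subring_closed[OF S(1)]
  have tS: "t \<in> S" using R S by auto
  \<comment> \<open>By maximality \<open>inverse t\<close> lies in \<open>S[z]\<close>;
    multiplication by \<open>t\<close> writes 1 as a polynomial in \<open>z\<close> with
    coefficients in the ideal generated by \<open>t\<close>.\<close>
  have rel: "\<exists>q. (\<forall>i. coeff q i \<in> (*) t ` S) \<and> poly q z = 1" if "z \<notin> S" for z
  proof -
    let ?B = "{poly q z |q. \<forall>i. coeff q i \<in> S}"
    have "S \<subseteq> ?B"
    proof
      fix a assume "a \<in> S"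
      thus "a \<in> ?B" by (intro CollectI exI[of _ "[:a:]"]) (auto simp: c coeff_pCons split: nat.splits)
    qed
    moreover have "z \<in> ?B"
      by (intro CollectI exI[of _ "[:0, 1:]"]) (auto simp: c coeff_pCons split: nat.splits)
    ultimately have "?B \<notin> C" using max[of ?B] that by blast
    hence "inverse t \<in> ?B" using is_subring_adjoin[OF S(1), of z] \<open>S \<subseteq> ?B\<close> S by (auto simp: C_def)
    then obtain q where "inverse t = poly q z" "\<forall>i. coeff q i \<in> S" by blast
    thus ?thesis using R(3) by (intro exI[of _ "smult t q"]) (auto simp flip: \<open>inverse t = poly q z\<close>)
  qed
  \<comment> \<open>The relation with the larger degree bound is always the one shortened. In degree
    0 the number 1 would be a multiple of \<open>t\<close> in \<open>S\<close>, so
    \<open>inverse t\<close> would lie in \<open>S\<close>.\<close>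
  have no: False if q: "\<forall>i. coeff q i \<in> (*) t ` S" "degree q \<le> n" "poly q z = 1"
    and r: "\<forall>i. coeff r i \<in> (*) t ` S" "degree r \<le> n'" "poly r (inverse z) = 1" and z: "z \<noteq> 0"
    for q r n n' z
    using that
  proof (induction "n + n'" arbitrary: n n' z q r rule: less_induct)
    case less
    have triv: False if s: "\<forall>i. coeff s i \<in> (*) t ` S" "degree s \<le> 0" "poly s y = 1" for s y
    proof -
      obtain d where d: "s = [:d:]" using s(2) degree0_coeffs[of s] by auto
      with s have "1 \<in> (*) t ` S" by (metis coeff_pCons_0 poly_const_conv)
      then obtain e where "e \<in> S" "t * e = 1" by auto
      thus False using S(3) R(3) by (metis inverse_unique)
    qed
    show False
    proof (cases "n' \<le> n")
      case True
      have "n \<noteq> 0" using triv[of q z] less.prems(1-3) by (cases n) auto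
      then obtain n0 where n0: "n = Suc n0" by (cases n) auto
      obtain s where s: "\<forall>i. coeff s i \<in> (*) t ` S" "degree s \<le> n0" "poly s z = 1"
        using relation_descent[OF S(1) tS, of z q n0 r] less.prems n0 True by auto
      show False using less.hyps[of n0 n' s z r] s less.prems n0 by auto
    next
      case False
      have "n' \<noteq> 0" using triv[of r "inverse z"] less.prems(4-6) by (cases n') auto
      then obtain n0 where n0: "n' = Suc n0" by (cases n') auto
      obtain s where s: "\<forall>i. coeff s i \<in> (*) t ` S" "degree s \<le> n0" "poly s (inverse z) = 1"
        using relation_descent[OF S(1) tS, of "inverse z" r n0 q] less.prems n0 False by auto
      show False using less.hyps[of n n0 q z s] s less.prems n0 by auto
    qed
  qed
  have "z \<in> S \<or> inverse z \<in> S" for z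
  proof (cases "z = 0")
    case False
    show ?thesis
    proof (rule ccontr)
      assume "\<not> (z \<in> S \<or> inverse z \<in> S)"
      then obtain q r where "\<forall>i. coeff q i \<in> (*) t ` S" "poly q z = 1"
        "\<forall>i. coeff r i \<in> (*) t ` S" "poly r (inverse z) = 1"
        using rel[of z] rel[of "inverse z"] by blast
      thus False using no[of q "degree q" z r "degree r"] False by simp
    qed
  qed (use c in auto)
  thus thesis using that S by blast
qed

section \<open>Units and maximal ideal of a valuation ring\<close>

locale valuation_ring =
  fixes K R :: "'a::field set"
  assumes K: "is_subring K" "a \<in> K \<Longrightarrow> inverse a \<in> K"
    and R: "is_subring R" "R \<subseteq> K" "a \<in> K \<Longrightarrow> a \<in> R \<or> inverse a \<in> R"
begin

definition units :: "'a set" where "units = {a \<in> R. a \<noteq> 0 \<and> inverse a \<in> R}"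

definition maxideal :: "'a set" where "maxideal = R - units"

lemmas K_closed = is_subring_closed[OF K(1)] K(2)
lemmas R_closed = is_subring_closed[OF R(1)]

lemma K_divide: "a \<in> K \<Longrightarrow> b \<in> K \<Longrightarrow> a / b \<in> K"
  by (simp add: divide_inverse K_closed)

lemma units_closed:
  shows "1 \<in> units" "a \<in> units \<Longrightarrow> b \<in> units \<Longrightarrow> a * b \<in> units"
    "a \<in> units \<Longrightarrow> inverse a \<in> units" "a \<in> units \<Longrightarrow> a ^ n \<in> units"
    "a \<in> units \<Longrightarrow> b \<in> units \<Longrightarrow> a / b \<in> units" "a \<in> units \<Longrightarrow> - a \<in> units"
    "a \<in> units \<Longrightarrow> a \<noteq> 0" "a \<in> units \<Longrightarrow> a \<in> R" "a \<in> units \<Longrightarrow> a \<in> K"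
  using R(2) by (auto simp: units_def R_closed divide_inverse simp flip: power_inverse)

lemma maxideal_closed:
  shows "a \<in> maxideal \<Longrightarrow> b \<in> R \<Longrightarrow> a * b \<in> maxideal" "0 \<in> maxideal"
    "a \<in> maxideal \<Longrightarrow> b \<in> maxideal \<Longrightarrow> a + b \<in> maxideal"
    "a \<in> maxideal \<Longrightarrow> a \<in> R" "a \<in> maxideal \<Longrightarrow> a \<notin> units"
proof -
  show m: "a * b \<in> maxideal" if "a \<in> maxideal" "b \<in> R" for a b
  proof -
    have "inverse a \<in> R" if "inverse (a * b) \<in> R" "a * b \<noteq> 0"
    proof -
      have "inverse a = b * inverse (a * b)" using that by (simp add: field_simps)
      thus ?thesis using that R_closed \<open>b \<in> R\<close> by metis
    qed
    thus ?thesis using that by (auto simp: maxideal_def units_def R_closed)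
  qed
  show "0 \<in> maxideal" by (simp add: maxideal_def units_def R_closed)
  show "a \<in> maxideal \<Longrightarrow> a \<in> R" "a \<in> maxideal \<Longrightarrow> a \<notin> units" for a by (auto simp: maxideal_def)
  show "a + b \<in> maxideal" if ab: "a \<in> maxideal" "b \<in> maxideal" for a b
  proof (cases "a = 0 \<or> b = 0")
    case False
    have K: "a \<in> K" "b \<in> K" using ab R by (auto simp: maxideal_def)
    hence "b / a \<in> R \<or> a / b \<in> R" using R(3)[of "b / a"] K_divide by auto
    thus ?thesis
    proof
      assume "b / a \<in> R"
      hence "a * (1 + b / a) \<in> maxideal" using ab by (intro m R_closed)
      thus ?thesis using False by (simp add: field_simps)
    next
      assume "a / b \<in> R"
      hence "b * (1 + a / b) \<in> maxideal" using ab by (intro m R_closed)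
      thus ?thesis using False by (simp add: field_simps)
    qed
  qed (use ab in auto)
qed

lemma maxideal_sum: "(\<And>i. i \<in> I \<Longrightarrow> g i \<in> maxideal) \<Longrightarrow> sum g I \<in> maxideal"
  by (induction I rule: infinite_finite_induct) (auto intro: maxideal_closed)

lemma unit_add_maxideal: "a \<in> units \<Longrightarrow> b \<in> maxideal \<Longrightarrow> a + b \<in> units"
proof (rule ccontr)
  assume a: "a \<in> units" and b: "b \<in> maxideal" and "a + b \<notin> units"
  hence "a + b \<in> maxideal"
    by (auto simp: maxideal_def R_closed units_closed)
  moreover have "- b \<in> maxideal" using maxideal_closed(1)[OF b, of "-1"] R_closed by simp
  ultimately have "a \<in> maxideal" using maxideal_closed(3)[of "a + b" "- b"] by simp
  thus False using a by (simp add: maxideal_def)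
qed

lemma not_in_R: "a \<in> K \<Longrightarrow> a \<notin> R \<Longrightarrow> inverse a \<in> maxideal"
  using R(3)[of a] by (auto simp: maxideal_def units_def)

lemma maxideal_power: "a \<in> maxideal \<Longrightarrow> n > 0 \<Longrightarrow> a ^ n \<in> maxideal"
proof -
  assume "a \<in> maxideal" "n > 0"
  moreover from this have "a * a ^ (n - 1) \<in> maxideal"
    by (intro maxideal_closed(1) R_closed maxideal_closed(4))
  ultimately show ?thesis by (simp add: power_eq_if)
qed

lemma power_in_units: "a \<in> K \<Longrightarrow> n > 0 \<Longrightarrow> a ^ n \<in> units \<Longrightarrow> a \<in> units"
proof -
  assume a: "a \<in> K" "n > 0" "a ^ n \<in> units"
  note m = maxideal_power[OF _ \<open>n > 0\<close>]
  have "a \<notin> maxideal" using m[of a] a by (auto simp: maxideal_def)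
  moreover have "a \<in> R"
  proof (rule ccontr)
    assume "a \<notin> R"
    hence "inverse a ^ n \<in> maxideal" using m not_in_R a by blast
    moreover have "inverse a ^ n \<in> units" using a by (simp add: power_inverse units_closed)
    ultimately show False by (simp add: maxideal_def)
  qed
  ultimately show "a \<in> units" by (simp add: maxideal_def)
qed

text \<open>A valuation ring is integrally closed. This allows membership to be tested on
  \<open>p\<close>-th powers, whose orders are those of powers of \<open>x\<close>.\<close>

lemma power_in_R_iff: "a \<in> K \<Longrightarrow> n > 0 \<Longrightarrow> a ^ n \<in> R \<longleftrightarrow> a \<in> R"
proof
  assume a: "a \<in> K" "n > 0" "a ^ n \<in> R"
  show "a \<in> R"
  proof (rule ccontr)
    assume n: "a \<notin> R"
    hence "a \<noteq> 0" using R_closed(1) by auto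
    from n have "inverse a \<in> R" using R(3) a by blast
    hence "inverse a ^ n \<in> R" by (rule R_closed)
    hence "a ^ n \<in> units" using a \<open>a \<noteq> 0\<close> by (simp add: units_def power_inverse)
    hence "a \<in> units" using power_in_units a by simp
    thus False using n units_closed(8) by simp
  qed
qed (rule R_closed)

lemma power_in_maxideal: "a \<in> K \<Longrightarrow> n > 0 \<Longrightarrow> a ^ n \<in> maxideal \<Longrightarrow> a \<in> maxideal"
  using power_in_R_iff units_closed(4) by (auto simp: maxideal_def)

text \<open>The strict ultrametric law: a sum has the valuation of its unique dominant term, where
  having the same valuation means that the quotient is a unit.\<close>

lemma dominant_sum:
  assumes "finite I" "i0 \<in> I" "c i0 \<noteq> 0" "\<And>i. i \<in> I - {i0} \<Longrightarrow> c i / c i0 \<in> maxideal"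
  shows "sum c I / c i0 \<in> units"
proof -
  have "sum c I / c i0 = 1 + (\<Sum>i\<in>I-{i0}. c i / c i0)"
    using assms by (simp add: sum.remove add_divide_distrib sum_divide_distrib)
  moreover have "(\<Sum>i\<in>I-{i0}. c i / c i0) \<in> maxideal"
    using assms by (intro maxideal_sum) auto
  ultimately show ?thesis using unit_add_maxideal[OF units_closed(1)] by simp
qed

end

section \<open>The function field of the Artin--Schreier curve\<close>

lemma cring_restrict:
  assumes "is_subring K"
  shows "cring (ring_of_type_algebra\<lparr>carrier := K\<rparr>)"
  using is_subring_closed[OF assms]
  by unfold_locales
    (auto simp: ring_of_type_algebra_def Units_def algebra_simps intro: bexI[of _ "- _"])

lemma a_inv_restrict:
  assumes "is_subring K" "a \<in> K"
  shows "\<ominus>\<^bsub>ring_of_type_algebra\<lparr>carrier := K\<rparr>\<^esub> a = - a"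
proof -
  interpret cring "ring_of_type_algebra\<lparr>carrier := K\<rparr>" by (rule cring_restrict) fact
  show ?thesis
    by (rule minus_equality)
      (use assms in \<open>auto simp: ring_of_type_algebra_def is_subring_closed\<close>)
qed

lemma subring_restrict_iff:
  assumes "is_subring K"
  shows "subring R (ring_of_type_algebra\<lparr>carrier := K\<rparr>) \<longleftrightarrow> is_subring R \<and> R \<subseteq> K"
proof -
  interpret cring "ring_of_type_algebra\<lparr>carrier := K\<rparr>" by (rule cring_restrict) fact
  show ?thesis
  proof (intro iffI conjI)
    assume "subring R (ring_of_type_algebra\<lparr>carrier := K\<rparr>)"
    note R = subringE[OF this]
    show "R \<subseteq> K" using R(1) by (simp add: ring_of_type_algebra_def)
    show "is_subring R"
      unfolding is_subring_def
    proof (intro conjI ballI)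
      show "1 \<in> R" using R(3) by (simp add: ring_of_type_algebra_def)
      fix a b assume ab: "a \<in> R" "b \<in> R"
      show "a * b \<in> R" using R(6)[OF ab] by (simp add: ring_of_type_algebra_def)
      have "- b \<in> R" using R(5)[OF ab(2)] a_inv_restrict[OF assms, of b] \<open>R \<subseteq> K\<close> ab by auto
      hence "a + - b \<in> R" using R(7)[OF ab(1), of "- b"] by (simp add: ring_of_type_algebra_def)
      thus "a - b \<in> R" by simp
    qed
  next
    assume R: "is_subring R \<and> R \<subseteq> K"
    note c = is_subring_closed[OF conjunct1[OF R]]
    show "subring R (ring_of_type_algebra\<lparr>carrier := K\<rparr>)"
    proof (rule subringI)
      fix h assume h: "h \<in> R"
      hence "h \<in> K" using R by blast
      thus "\<ominus>\<^bsub>ring_of_type_algebra\<lparr>carrier := K\<rparr>\<^esub> h \<in> R"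
        using a_inv_restrict[OF assms] c(3)[OF h] by simp
    qed (use R c in \<open>auto simp: ring_of_type_algebra_def\<close>)
  qed
qed

lemma m_inv_ring_of_type:
  fixes a :: "'a::field"
  assumes "a \<noteq> 0"
  shows "inv\<^bsub>ring_of_type_algebra\<^esub> a = inverse a"
proof -
  interpret R: cring "ring_of_type_algebra :: 'a ring" by (rule cring_from_type_algebra)
  show ?thesis
    by (rule R.inv_unique'[symmetric]) (use assms in \<open>auto simp: ring_of_type_algebra_def\<close>)
qed

lemma a_inv_ring_of_type: "\<ominus>\<^bsub>ring_of_type_algebra\<^esub> (a::'a::field) = - a"
proof -
  interpret R: cring "ring_of_type_algebra :: 'a ring" by (rule cring_from_type_algebra)
  show ?thesis by (rule R.minus_equality) (auto simp: ring_of_type_algebra_def)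
qed

text \<open>Needed for coefficients in \<open>k[x]\<close>, which is not a field: the scaling factor
  in pseudo-division is a power of the leading coefficient, here 1.\<close>

lemma monic_division:
  fixes g q :: "'a::idom poly"
  assumes "lead_coeff g = 1"
  obtains h r where "q = g * h + r" "r = 0 \<or> degree r < degree g"
proof -
  have "g \<noteq> 0" using assms by auto
  obtain h r where hr: "pseudo_divmod q g = (h, r)" by force
  show thesis
    using pseudo_divmod[OF \<open>g \<noteq> 0\<close> hr] assms that[of h r] by simp
qed

lemma emb_simps [simp]:
  "emb 0 = 0" "emb 1 = 1" "emb (a + b) = emb a + emb b" "emb (a * b) = emb a * emb b"
  "emb (a - b) = emb a - emb b" "emb (- a) = - emb a" "emb (a ^ n) = emb a ^ n"
  "emb a = emb b \<longleftrightarrow> a = b" "emb a = 0 \<longleftrightarrow> a = 0"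
proof -
  show "emb (a ^ n) = emb a ^ n"
    by (induction n) (simp_all add: emb_def)
qed (simp_all add: emb_def to_fract_eq_0_iff)

lemma emb_sum: "emb (sum g I) = (\<Sum>i\<in>I. emb (g i))"
  by (induction I rule: infinite_finite_induct) auto

lemma pcompose_power: "pcompose (A ^ n) B = pcompose A B ^ n" for A B :: "'a::comm_ring_1 poly"
  by (induction n) (simp_all add: pcompose_1 pcompose_mult)

lemma pcompose_monom: "pcompose (monom c n) q = smult c (q ^ n)" for c :: "'a::comm_ring_1"
  by (induction n) (simp_all add: monom_Suc pcompose_pCons monom_0)

lemma pcompose_shift_shift: "pcompose (pcompose A [:z, 1:]) [:y, 1:] = pcompose A [:y + z, 1:]"
  for A :: "'a::comm_ring_1 poly"
  by (simp add: pcompose_pCons add.commute flip: pcompose_assoc)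

section \<open>The coordinate ring \<open>k[x, w]\<close> and its fractions\<close>

locale artin_schreier =
  fixes f :: "'k::alg_closed_field poly" and p :: nat
  assumes p_eq: "p = CHAR('k)" and p_pos: "p > 0"
    and coprime_deg: "coprime (degree f) p" and deg_ge_2: "degree f \<ge> 2"
begin

abbreviation x :: "'k closure_kX" where "x \<equiv> emb [:0, 1:]"
abbreviation w :: "'k closure_kX" where "w \<equiv> root_W f"
abbreviation K :: "'k closure_kX set" where "K \<equiv> carrier (function_field f)"

lemma p_prime: "Factorial_Ring.prime p"
  using p_eq p_pos prime_CHAR_semidom by blast

lemma p_gt_1: "p > 1"
  using p_prime prime_gt_1_nat by blast

lemma w_eq: "w ^ p = w + emb f"
  using root_W_eq[of f] p_pos p_eq by (simp add: algebra_simps)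

text \<open>Elements of \<open>k[x, w]\<close> are handled through polynomials in \<open>W\<close>
  over \<open>k[x]\<close>. The kernel of this evaluation is generated by \<open>AS_poly\<close>,
  but that is known only once a place at infinity is available (\<open>ev_eq_0_iff\<close>).\<close>

definition ev :: "'k poly poly \<Rightarrow> 'k closure_kX" where
  "ev Q = poly (map_poly emb Q) w"

lemma ev_pCons: "ev (pCons a Q) = emb a + w * ev Q"
  by (simp add: ev_def map_poly_pCons)

lemma ev_0 [simp]: "ev 0 = 0"
  by (simp add: ev_def)

lemma ev_const [simp]: "ev [:a:] = emb a"
  by (simp add: ev_pCons)

lemma ev_1 [simp]: "ev 1 = 1"
  using ev_const[of 1] by (simp flip: one_pCons)

lemma ev_W [simp]: "ev [:0, 1:] = w"
  by (simp add: ev_pCons)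

lemma ev_add [simp]: "ev (P + Q) = ev P + ev Q"
  by (induction P Q rule: poly_induct2) (auto simp: ev_pCons algebra_simps)

lemma ev_smult [simp]: "ev (smult a Q) = emb a * ev Q"
  by (induction Q) (auto simp: ev_pCons algebra_simps)

lemma ev_mult [simp]: "ev (P * Q) = ev P * ev Q"
  by (induction P) (auto simp: ev_pCons algebra_simps)

lemma ev_uminus [simp]: "ev (- Q) = - ev Q"
  using ev_smult[of "-1" Q] by simp

lemma ev_diff [simp]: "ev (P - Q) = ev P - ev Q"
  using ev_add[of P "- Q"] by simp

lemma ev_power [simp]: "ev (Q ^ n) = ev Q ^ n"
  by (induction n) auto

lemma ev_prod: "ev (prod g I) = (\<Prod>i\<in>I. ev (g i))"
  by (induction I rule: infinite_finite_induct) auto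

lemma ev_altdef: "ev Q = (\<Sum>j | coeff Q j \<noteq> 0. emb (coeff Q j) * w ^ j)"
proof -
  have "degree (map_poly emb Q) \<le> degree Q"
    by (rule map_poly_degree_leq)
  hence "ev Q = (\<Sum>j\<le>degree Q. emb (coeff Q j) * w ^ j)"
    unfolding ev_def by (simp add: poly_eq_sum coeff_map_poly)
  also have "\<dots> = (\<Sum>j | coeff Q j \<noteq> 0. emb (coeff Q j) * w ^ j)"
    by (rule sum.mono_neutral_right) (auto intro: le_degree)
  finally show ?thesis .
qed

lemma emb_altdef: "emb a = (\<Sum>i\<le>degree a. emb [:coeff a i:] * x ^ i)"
proof -
  have m: "monom c i = [:c:] * [:0, 1:] ^ i" for c :: 'k and i
    by (simp add: monom_altdef)
  have "emb a = emb (\<Sum>i\<le>degree a. monom (coeff a i) i)"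
    by (simp only: poly_as_sum_of_monoms)
  thus ?thesis by (simp only: m emb_sum emb_simps)
qed

definition AS_poly :: "'k poly poly" where
  "AS_poly = monom 1 p - monom 1 1 - [:f:]"

lemma ev_AS_poly [simp]: "ev AS_poly = 0"
  by (simp add: AS_poly_def monom_altdef w_eq)

lemma degree_AS_poly: "degree AS_poly = p" and lead_coeff_AS_poly: "lead_coeff AS_poly = 1"
proof -
  have "degree (monom (1::'k poly) p - monom 1 1) = p"
    using p_gt_1 by (subst diff_conv_add_uminus, subst degree_add_eq_left) (auto simp: degree_monom_eq)
  thus d: "degree AS_poly = p"
    unfolding AS_poly_def using p_gt_1
    by (subst diff_conv_add_uminus, subst degree_add_eq_left) auto
  show "lead_coeff AS_poly = 1"
    unfolding d using p_gt_1 by (simp add: AS_poly_def coeff_pCons split: nat.splits)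
qed

lemma ev_reduced:
  obtains Q' where "ev Q' = ev Q" "degree Q' < p" "AS_poly dvd Q - Q'"
proof -
  obtain h r where "Q = AS_poly * h + r" "r = 0 \<or> degree r < degree AS_poly"
    using monic_division[OF lead_coeff_AS_poly] by blast
  thus thesis using that[of r] p_pos by (auto simp: degree_AS_poly)
qed

lemma K_eq: "K = {ev P / ev Q |P Q. ev Q \<noteq> 0}"
proof (intro equalityI subsetI)
  fix z assume "z \<in> K"
  hence "z \<in> generate_field ring_of_type_algebra
        (range (\<lambda>c. emb [:c:]) \<union> {emb [:0, 1:], root_W f})"
    by (simp add: function_field_def)
  thus "z \<in> {ev P / ev Q |P Q. ev Q \<noteq> 0}"
  proof induction
    case one
    show ?case by (intro CollectI exI[of _ 1]) (simp add: ring_of_type_algebra_def)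
  next
    case (incl h)
    then consider c where "h = emb [:c:]" | "h = x" | "h = w" by blast
    thus ?case
    proof cases
      case 1
      thus ?thesis by (intro CollectI exI[of _ "[:[:c:]:]"] exI[of _ 1]) simp
    next
      case 2
      thus ?thesis by (intro CollectI exI[of _ "[:[:0, 1:]:]"] exI[of _ 1]) simp
    next
      case 3
      thus ?thesis by (intro CollectI exI[of _ "[:0, 1:]"] exI[of _ 1]) simp
    qed
  next
    case (a_inv h)
    then obtain P Q where PQ: "h = ev P / ev Q" "ev Q \<noteq> 0" by blast
    show ?case
      by (intro CollectI exI[of _ "- P"] exI[of _ Q]) (use PQ in \<open>simp add: a_inv_ring_of_type\<close>)
  next
    case (m_inv h)
    then obtain P Q where PQ: "h = ev P / ev Q" "ev Q \<noteq> 0" by blast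
    moreover have "h \<noteq> 0" using m_inv by (simp add: ring_of_type_algebra_def)
    ultimately show ?case
      by (intro CollectI exI[of _ Q] exI[of _ P]) (auto simp: m_inv_ring_of_type)
  next
    case (eng_add h1 h2)
    then obtain P Q P' Q' where PQ: "h1 = ev P / ev Q" "ev Q \<noteq> 0" "h2 = ev P' / ev Q'" "ev Q' \<noteq> 0"
      by blast
    show ?case
      by (intro CollectI exI[of _ "P * Q' + P' * Q"] exI[of _ "Q * Q'"])
        (use PQ in \<open>simp add: ring_of_type_algebra_def add_frac_eq\<close>)
  next
    case (eng_mult h1 h2)
    then obtain P Q P' Q' where PQ: "h1 = ev P / ev Q" "ev Q \<noteq> 0" "h2 = ev P' / ev Q'" "ev Q' \<noteq> 0"
      by blast
    show ?case
      by (intro CollectI exI[of _ "P * P'"] exI[of _ "Q * Q'"])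
        (use PQ in \<open>simp add: ring_of_type_algebra_def\<close>)
  qed
next
  let ?G = "generate_field ring_of_type_algebra (range (\<lambda>c. emb [:c:]) \<union> {emb [:0, 1:], root_W f})"
  have G: "a + b \<in> ?G" "a * b \<in> ?G" "emb [:c:] \<in> ?G" "x \<in> ?G" "w \<in> ?G"
    if "a \<in> ?G" "b \<in> ?G" for a b c
    using generate_field.eng_add[OF that] generate_field.eng_mult[OF that]
    by (auto simp: ring_of_type_algebra_def intro: generate_field.incl)
  have inG: "emb [:c:] \<in> ?G" "x \<in> ?G" "w \<in> ?G" for c
    by (auto intro: generate_field.incl)
  have Gi: "inverse a \<in> ?G" if "a \<in> ?G" "a \<noteq> 0" for a
    using generate_field.m_inv[OF that(1)] that by (simp add: m_inv_ring_of_type[symmetric]) (simp add: ring_of_type_algebra_def)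
  have embG: "emb a \<in> ?G" for a
  proof (induction a)
    case 0
    show ?case using inG(1)[of 0] by simp
  next
    case (pCons c a)
    have "emb (pCons c a) = emb ([:c:] + [:0, 1:] * a)" by simp
    also have "\<dots> = emb [:c:] + x * emb a" by (simp only: emb_simps)
    finally show ?case using pCons inG by (metis G(1,2))
  qed
  have evG: "ev Q \<in> ?G" for Q
  proof (induction Q)
    case 0
    show ?case using inG(1)[of 0] by simp
  next
    case (pCons a Q)
    have "w * ev Q \<in> ?G" using G(2)[OF inG(3) pCons.IH] .
    from G(1)[OF embG[of a] this] show ?case by (simp add: ev_pCons)
  qed
  fix z assume "z \<in> {ev P / ev Q |P Q. ev Q \<noteq> 0}"
  then obtain P Q where "z = ev P / ev Q" "ev Q \<noteq> 0" by blast
  thus "z \<in> K" using evG Gi G(2) by (simp add: function_field_def divide_inverse)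
qed

lemma K_E:
  assumes "z \<in> K"
  obtains P Q where "z = ev P / ev Q" "ev Q \<noteq> 0"
  using assms unfolding K_eq by blast

lemma K_I: "ev Q \<noteq> 0 \<Longrightarrow> ev P / ev Q \<in> K"
  unfolding K_eq by blast

lemma ev_in_K [simp]: "ev Q \<in> K"
  using K_I[of 1 Q] by simp

lemma emb_in_K [simp]: "emb a \<in> K" and w_in_K [simp]: "w \<in> K"
  using ev_in_K[of "[:a:]"] ev_in_K[of "[:0, 1:]"] by (simp_all only: ev_const ev_W)

lemma K_subring: "is_subring K"
  unfolding is_subring_def
proof (intro conjI ballI)
  show "1 \<in> K" using ev_in_K[of 1] by simp
  fix a b assume "a \<in> K" "b \<in> K"
  then obtain P Q P' Q' where PQ: "a = ev P / ev Q" "ev Q \<noteq> 0" "b = ev P' / ev Q'" "ev Q' \<noteq> 0"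
    by (metis K_E)
  have "a - b = ev (P * Q' - P' * Q) / ev (Q * Q')" using PQ by (simp add: diff_frac_eq)
  thus "a - b \<in> K" using PQ K_I[of "Q * Q'" "P * Q' - P' * Q"] by (simp only: ev_mult) simp
  have "a * b = ev (P * P') / ev (Q * Q')" using PQ by simp
  thus "a * b \<in> K" using PQ K_I[of "Q * Q'" "P * P'"] by (simp only: ev_mult) simp
qed

lemma K_inverse: "a \<in> K \<Longrightarrow> inverse a \<in> K"
proof -
  assume "a \<in> K"
  then obtain P Q where PQ: "a = ev P / ev Q" "ev Q \<noteq> 0" by (metis K_E)
  show "inverse a \<in> K"
  proof (cases "ev P = 0")
    case True
    thus ?thesis using PQ is_subring_closed(1)[OF K_subring] by simp
  qed (use PQ K_I[of P Q] in simp)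
qed

lemma curve_points_iff:
  "R \<in> curve_points f \<longleftrightarrow> is_subring R \<and> R \<subseteq> K \<and> R \<noteq> K \<and> (\<forall>c. emb [:c:] \<in> R) \<and>
     (\<forall>z\<in>K. z \<in> R \<or> inverse z \<in> R)"
proof -
  have "function_field f = ring_of_type_algebra\<lparr>carrier := K\<rparr>"
    by (simp add: function_field_def)
  hence "subring R (function_field f) \<longleftrightarrow> is_subring R \<and> R \<subseteq> K"
    using subring_restrict_iff[OF K_subring, of R] by simp
  thus ?thesis by (auto simp: curve_points_def)
qed

lemma curve_point_valuation_ring: "R \<in> curve_points f \<Longrightarrow> valuation_ring K R"
  by unfold_locales (auto simp: curve_points_iff intro: K_subring K_inverse)

section \<open>The point at infinity\<close>

text \<open>Minus the valuation at infinity of \<open>ev Q\<close>, for \<open>Q\<close> of degree less than \<open>p\<close>: the function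
  \<open>x\<close> has a pole of order \<open>p\<close> and \<open>w\<close> one of order \<open>degree f\<close>, so that the terms of \<open>ev Q\<close> have
  pairwise distinct pole orders.\<close>

definition pole_order :: "'k poly poly \<Rightarrow> nat" where
  "pole_order Q = Max ((\<lambda>j. p * degree (coeff Q j) + degree f * j) ` {j. coeff Q j \<noteq> 0})"

lemma finite_coeffs: "finite {j. coeff Q j \<noteq> 0}"
  using MOST_coeff_eq_0[of Q] by (simp add: eventually_cofinite)

lemma pole_order_ge: "coeff Q j \<noteq> 0 \<Longrightarrow> p * degree (coeff Q j) + degree f * j \<le> pole_order Q"
  unfolding pole_order_def using finite_coeffs[of Q] by (intro Max_ge) auto

lemma pole_order_attained:
  assumes "Q \<noteq> 0"
  obtains j where "coeff Q j \<noteq> 0" "pole_order Q = p * degree (coeff Q j) + degree f * j"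
proof -
  have "pole_order Q \<in> (\<lambda>j. p * degree (coeff Q j) + degree f * j) ` {j. coeff Q j \<noteq> 0}"
    unfolding pole_order_def using finite_coeffs[of Q] assms
    by (intro Max_in) (auto intro!: exI[of _ "degree Q"])
  thus thesis using that by auto
qed

text \<open>Modulo \<open>p\<close> only the multiples of \<open>degree f\<close> remain, and
  \<open>degree f\<close> is invertible there.\<close>

lemma weights_distinct:
  assumes "p * a + degree f * i = p * b + degree f * j" "i < p" "j < p"
  shows "i = j"
proof -
  have *: "i = j" if "p * a + degree f * i = p * b + degree f * j" "i < p" "j < p" "i \<le> j" for a b i j
  proof -
    have "degree f * (j - i) + p * b = p * a"
      using that by (simp add: diff_mult_distrib2)
    hence "p dvd degree f * (j - i)"
      by (metis dvd_add_left_iff dvd_triv_left)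
    hence "p dvd j - i" using coprime_deg by (simp add: coprime_commute coprime_dvd_mult_right_iff)
    thus "i = j" using that dvd_imp_le[of p "j - i"] by (cases "i = j") auto
  qed
  show ?thesis using *[of a i b j] *[of b j a i] assms by (cases "i \<le> j") auto
qed

end

locale curve_point = artin_schreier +
  fixes R assumes R_point: "R \<in> curve_points f"
begin

sublocale valuation_ring K R
  using R_point by (rule curve_point_valuation_ring)

lemma const_in_units: "c \<noteq> 0 \<Longrightarrow> emb [:c:] \<in> units"
proof -
  assume c: "c \<noteq> 0"
  have "emb [:c:] * emb [:inverse c:] = emb ([:c:] * [:inverse c:])" by (simp only: emb_simps)
  also have "[:c:] * [:inverse c:] = 1" using c by (simp flip: one_pCons)
  finally have "inverse (emb [:c:]) = emb [:inverse c:]" by (intro inverse_unique) simp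
  thus ?thesis using R_point c by (simp add: units_def curve_points_iff)
qed

lemma emb_in_R: "x \<in> R \<Longrightarrow> emb a \<in> R"
  unfolding emb_altdef[of a] using R_point R_closed(7)[of x]
  by (intro is_subring_sum[OF R(1)] R_closed(6)) (auto simp: curve_points_iff)

text \<open>\<open>w\<close> is integral over \<open>k[x]\<close>: dividing
  \<open>w^p = w + f(x)\<close> by \<open>w^(p-1)\<close> expresses \<open>w\<close> through
  \<open>inverse w\<close> and \<open>f(x)\<close>, which both lie in \<open>R\<close> if
  \<open>w\<close> does not.\<close>

lemma w_in_R: "x \<in> R \<Longrightarrow> w \<in> R"
proof (rule ccontr)
  assume x: "x \<in> R" and w: "w \<notin> R"
  have w0: "w \<noteq> 0" and iw: "inverse w \<in> R" using R(3)[of w] w R_closed(1) by auto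
  have "w ^ p * inverse w ^ (p - 1) = w"
    using w0 p_pos by (cases p) (simp_all add: field_simps)
  moreover have "w * inverse w ^ (p - 1) = inverse w ^ (p - 2)"
  proof -
    obtain n where "p = Suc (Suc n)" using p_gt_1 less_imp_Suc_add[of 1 p] by auto
    thus ?thesis using w0 by (simp add: field_simps)
  qed
  ultimately have "w = inverse w ^ (p - 2) + emb f * inverse w ^ (p - 1)"
    by (simp add: w_eq distrib_right)
  moreover have "inverse w ^ (p - 2) + emb f * inverse w ^ (p - 1) \<in> R"
    by (rule R_closed(4)[OF R_closed(7)[OF iw] R_closed(6)[OF emb_in_R[OF x] R_closed(7)[OF iw]]])
  ultimately show False using w by simp
qed

lemma ev_in_R: "x \<in> R \<Longrightarrow> ev Q \<in> R"
  unfolding ev_altdef[of Q] using emb_in_R R_closed(7)[OF w_in_R]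
  by (intro is_subring_sum[OF R(1)] R_closed(6)) auto

end

locale infinite_place = curve_point +
  assumes x_notin_R: "x \<notin> R"
begin

lemma x_in_K: "x \<in> K" by simp

lemma inverse_x: "inverse x \<in> maxideal"
  by (rule not_in_R) (auto simp: x_notin_R)

lemma x_neq_0: "x \<noteq> 0"
  using R_closed(1) x_notin_R by auto

lemma x_power_quot: "m < n \<Longrightarrow> x ^ m / x ^ n \<in> maxideal"
proof -
  assume "m < n"
  hence "x ^ m / x ^ n = inverse x ^ (n - m)"
    using x_neq_0 by (simp add: power_diff power_inverse field_simps)
  thus ?thesis using maxideal_power[OF inverse_x] \<open>m < n\<close> by simp
qed

lemma x_power_quot_iff: "x ^ m / x ^ n \<in> R \<longleftrightarrow> m \<le> n"
proof -
  have "x ^ m / x ^ n \<notin> R" if "n < m"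
  proof
    assume "x ^ m / x ^ n \<in> R"
    with x_power_quot[OF that] have "(x ^ n / x ^ m) * (x ^ m / x ^ n) \<in> maxideal"
      by (rule maxideal_closed)
    thus False using x_neq_0 units_closed(1) maxideal_closed(5) by simp
  qed
  moreover have "x ^ m / x ^ n \<in> R" if "m \<le> n"
    using that x_power_quot[of m n] maxideal_closed(4) R_closed(2) x_neq_0 by (cases "m = n") auto
  ultimately show ?thesis by force
qed

lemma emb_unit: "a \<noteq> 0 \<Longrightarrow> emb a / x ^ degree a \<in> units"
proof -
  assume a: "a \<noteq> 0"
  let ?n = "degree a" and ?c = "\<lambda>i. emb [:coeff a i:] * x ^ i"
  have u: "emb [:lead_coeff a:] \<in> units" using a by (intro const_in_units) auto
  have "sum ?c {..?n} / ?c ?n \<in> units"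
  proof (rule dominant_sum)
    show "?c ?n \<noteq> 0" using a x_neq_0 by auto
    fix i assume i: "i \<in> {..?n} - {?n}"
    have "emb [:coeff a i:] / emb [:lead_coeff a:] \<in> R"
      using R_point u by (auto simp: divide_inverse units_def curve_points_iff intro!: R_closed)
    hence "(x ^ i / x ^ ?n) * (emb [:coeff a i:] / emb [:lead_coeff a:]) \<in> maxideal"
      using i by (intro maxideal_closed(1) x_power_quot) auto
    thus "?c i / ?c ?n \<in> maxideal" by (simp add: field_simps)
  qed auto
  from units_closed(2)[OF u this]
  have "emb [:lead_coeff a:] * (sum ?c {..?n} / ?c ?n) \<in> units" .
  thus ?thesis unfolding emb_altdef[of a, symmetric] using a by (simp add: field_simps)
qed

text \<open>Since \<open>w^p - w = f(x)\<close> has a pole, so does \<open>w\<close>. Hence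
  \<open>1 - w^(1-p)\<close> is a unit, and multiplying \<open>w^p\<close> by it gives exactly
  \<open>f(x)\<close>.\<close>

lemma w_unit: "w ^ p / x ^ degree f \<in> units"
proof -
  have f0: "f \<noteq> 0" using deg_ge_2 by auto
  have "w \<notin> R"
  proof
    assume "w \<in> R"
    hence "w ^ p - w \<in> R" by (intro R_closed)
    hence "emb f \<in> R" by (simp add: w_eq)
    hence "emb f * inverse (emb f / x ^ degree f) \<in> R"
      using units_closed(8)[OF units_closed(3)[OF emb_unit[OF f0]]] by (rule R_closed(6))
    hence "x ^ degree f \<in> R" using f0 by simp
    thus False using power_in_R_iff[OF x_in_K] deg_ge_2 x_notin_R by auto
  qed
  hence w0: "w \<noteq> 0" and iw: "inverse w \<in> maxideal" using R_closed(1) not_in_R[of w] by auto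
  have "- (inverse w ^ (p - 1)) \<in> maxideal"
    using maxideal_closed(1)[OF maxideal_power[OF iw], of "p - 1" "-1"] p_gt_1 R_closed by simp
  define v where "v = 1 + - (inverse w ^ (p - 1))"
  have u: "v \<in> units"
    unfolding v_def by (rule unit_add_maxideal[OF units_closed(1)]) fact
  have "w ^ p * inverse w ^ (p - 1) = w"
    using w0 p_pos by (cases p) (simp_all add: field_simps)
  hence "w ^ p * v = emb f"
    by (simp add: v_def algebra_simps w_eq)
  hence "w ^ p / x ^ degree f = (emb f / x ^ degree f) / v"
    using units_closed(7)[OF u] by (simp add: field_simps)
  thus ?thesis using units_closed(5)[OF emb_unit[OF f0] u] by simp
qed

lemma term_unit:
  assumes "a \<noteq> 0"
  shows "(emb a * w ^ j) ^ p / x ^ (p * degree a + degree f * j) \<in> units"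
proof -
  have "(emb a * w ^ j) ^ p / x ^ (p * degree a + degree f * j)
      = (emb a / x ^ degree a) ^ p * (w ^ p / x ^ degree f) ^ j"
    by (simp add: power_mult_distrib power_divide power_add mult.commute flip: power_mult)
  thus ?thesis using emb_unit[OF assms] w_unit by (simp add: units_closed)
qed

text \<open>For \<open>degree Q < p\<close> the weights of the terms differ pairwise, so a single
  term dominates and determines the order of the sum. The dominance is checked on
  \<open>p\<close>-th powers, where each term compares with a power of \<open>x\<close>.\<close>

lemma ev_unit:
  assumes "Q \<noteq> 0" "degree Q < p"
  shows "ev Q ^ p / x ^ pole_order Q \<in> units"
proof -
  let ?I = "{j. coeff Q j \<noteq> 0}" and ?c = "\<lambda>j. emb (coeff Q j) * w ^ j"
  let ?wt = "\<lambda>j. p * degree (coeff Q j) + degree f * j"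
  obtain j0 where j0: "coeff Q j0 \<noteq> 0" "pole_order Q = ?wt j0"
    using pole_order_attained assms by blast
  have u: "?c j ^ p / x ^ ?wt j \<in> units" if "coeff Q j \<noteq> 0" for j
    using term_unit[OF that] .
  have c0: "?c j \<noteq> 0" if "coeff Q j \<noteq> 0" for j
    using units_closed(7)[OF u[OF that]] p_pos by auto
  have cK: "?c j \<in> K" for j by (simp add: K_closed)
  have "sum ?c ?I / ?c j0 \<in> units"
  proof (rule dominant_sum)
    show "?c j0 \<noteq> 0" using c0 j0 by blast
    fix j assume j: "j \<in> ?I - {j0}"
    have "j < p" "j0 < p" using j j0 assms le_degree[of Q j] le_degree[of Q j0] by auto
    hence "?wt j \<noteq> ?wt j0" using weights_distinct[of _ j _ j0] j by auto
    hence "?wt j < ?wt j0" using pole_order_ge[of Q j] j j0 by auto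
    hence "x ^ ?wt j / x ^ ?wt j0 \<in> maxideal" by (rule x_power_quot)
    moreover have "(?c j ^ p / x ^ ?wt j) / (?c j0 ^ p / x ^ ?wt j0) \<in> R"
      using j by (intro units_closed(8) units_closed(5) u j0(1)) auto
    ultimately have "x ^ ?wt j / x ^ ?wt j0 * ((?c j ^ p / x ^ ?wt j) / (?c j0 ^ p / x ^ ?wt j0)) \<in> maxideal"
      by (rule maxideal_closed(1))
    hence "(?c j / ?c j0) ^ p \<in> maxideal"
      using x_neq_0 by (simp add: power_divide)
    thus "?c j / ?c j0 \<in> maxideal"
      by (rule power_in_maxideal[OF K_divide[OF cK cK] p_pos])
  qed (use j0 finite_coeffs in auto)
  hence "(ev Q / ?c j0) ^ p * (?c j0 ^ p / x ^ ?wt j0) \<in> units"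
    unfolding ev_altdef[of Q, symmetric]
    by (rule units_closed(2)[OF units_closed(4) u[OF j0(1)]])
  moreover have "(ev Q / ?c j0) ^ p * (?c j0 ^ p / x ^ ?wt j0) = ev Q ^ p / x ^ ?wt j0"
    unfolding power_divide using c0[OF j0(1)] by (simp del: mult_eq_0_iff)
  ultimately show ?thesis unfolding j0(2) by simp
qed

lemma ev_neq_0: "Q \<noteq> 0 \<Longrightarrow> degree Q < p \<Longrightarrow> ev Q \<noteq> 0"
  using ev_unit[of Q] p_pos units_closed(7)[of 0] by (auto simp: zero_power)

text \<open>The criterion on the right does not mention \<open>R\<close>; this makes the place at
  infinity unique.\<close>

lemma quot_in_R_iff:
  assumes "P \<noteq> 0" "degree P < p" "Q \<noteq> 0" "degree Q < p"
  shows "ev P / ev Q \<in> R \<longleftrightarrow> pole_order P \<le> pole_order Q"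
proof -
  define u where "u = (ev P ^ p / x ^ pole_order P) / (ev Q ^ p / x ^ pole_order Q)"
  define y where "y = x ^ pole_order P / x ^ pole_order Q"
  have u: "u \<in> units" unfolding u_def using assms by (intro units_closed(5) ev_unit)
  have eq: "(ev P / ev Q) ^ p = u * y"
    using x_neq_0 by (simp add: u_def y_def power_divide)
  have "ev P / ev Q \<in> R \<longleftrightarrow> u * y \<in> R"
    unfolding eq[symmetric] by (rule power_in_R_iff[symmetric]) (auto simp: p_pos intro: K_divide)
  also have "\<dots> \<longleftrightarrow> y \<in> R"
  proof
    assume "u * y \<in> R"
    hence "inverse u * (u * y) \<in> R"
      using units_closed(8)[OF units_closed(3)[OF u]] by (rule R_closed(6)[rotated])
    thus "y \<in> R" using units_closed(7)[OF u] by (simp flip: mult.assoc)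
  qed (rule R_closed(6)[OF units_closed(8)[OF u]])
  also have "\<dots> \<longleftrightarrow> pole_order P \<le> pole_order Q" unfolding y_def by (rule x_power_quot_iff)
  finally show ?thesis .
qed

end

context artin_schreier
begin

lemma infinite_placeI: "R \<in> curve_points f \<Longrightarrow> x \<notin> R \<Longrightarrow> infinite_place f p R"
  by unfold_locales

lemma infinite_place_exists: "\<exists>R\<in>curve_points f. x \<notin> R"
proof -
  \<comment> \<open>This is \<open>k[1/x]\<close>. The extension theorem is applied with
    \<open>inverse x\<close> in the role of \<open>t\<close>, so that \<open>x\<close> stays outside
    the valuation ring.\<close>
  let ?R = "{emb q / x ^ n |q n. degree q \<le> n}"
  have x0: "x \<noteq> 0" by simp
  have sub: "is_subring ?R"
    unfolding is_subring_def
  proof (intro conjI ballI)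
    show "1 \<in> ?R" by (intro CollectI exI[of _ 1] exI[of _ 0]) simp
    fix a b assume "a \<in> ?R" "b \<in> ?R"
    then obtain q n r m where qr: "a = emb q / x ^ n" "degree q \<le> n" "b = emb r / x ^ m" "degree r \<le> m"
      by blast
    have "degree (q * r) \<le> n + m" using degree_mult_le[of q r] qr by simp
    thus "a * b \<in> ?R"
      by (intro CollectI exI[of _ "q * r"] exI[of _ "n + m"]) (use qr in \<open>simp add: power_add\<close>)
    have "degree (q * [:0, 1:] ^ m - r * [:0, 1:] ^ n) \<le> n + m"
      using qr degree_mult_le[of q "[:0, 1:] ^ m"] degree_mult_le[of r "[:0, 1:] ^ n"]
      by (intro degree_diff_le) (simp_all add: degree_linear_power)
    moreover have "a - b = emb (q * [:0, 1:] ^ m - r * [:0, 1:] ^ n) / x ^ (n + m)"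
      using qr x0 by (simp only: emb_simps) (simp add: diff_frac_eq power_add)
    ultimately show "a - b \<in> ?R" by blast
  qed
  have mem: "inverse x \<in> ?R"
    by (intro CollectI exI[of _ 1] exI[of _ 1]) (simp add: divide_inverse)
  have notin: "inverse (inverse x) \<notin> ?R"
  proof
    assume "inverse (inverse x) \<in> ?R"
    then obtain q n where q: "x = emb q / x ^ n" "degree q \<le> n" by auto
    hence "emb q = emb ([:0, 1:] ^ Suc n)" using x0 by (simp only: emb_simps) (simp add: field_simps)
    hence "q = [:0, 1:] ^ Suc n" by (rule iffD1[OF emb_simps(8)])
    thus False using q by (simp add: degree_linear_power del: power_Suc)
  qed
  have "inverse x \<noteq> 0" using x0 by simp
  from valuation_ring_exists[OF sub mem this notin]
  obtain S where S: "is_subring S" "?R \<subseteq> S" "inverse (inverse x) \<notin> S"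
    "\<forall>z. z \<in> S \<or> inverse z \<in> S" by blast
  have "is_subring (S \<inter> K)"
    using S(1) K_subring by (auto simp: is_subring_def)
  moreover have "emb [:c:] \<in> S" for c
    using S(2) by (rule subsetD) (intro CollectI exI[of _ "[:c:]"] exI[of _ 0], simp)
  ultimately have "S \<inter> K \<in> curve_points f" using S(3,4) K_inverse by (auto simp: curve_points_iff)
  thus ?thesis using S(3) by auto
qed

lemma infinite_place_unique:
  assumes "R \<in> curve_points f" "x \<notin> R" "R' \<in> curve_points f" "x \<notin> R'"
  shows "R = R'"
proof -
  interpret R: infinite_place f p R by (rule infinite_placeI) fact+
  interpret R': infinite_place f p R' by (rule infinite_placeI) fact+
  have "z \<in> R \<longleftrightarrow> z \<in> R'" if z: "z \<in> K" for z
  proof (cases "z = 0")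
    case False
    obtain P Q where PQ: "z = ev P / ev Q" "ev Q \<noteq> 0" using K_E[OF z] .
    obtain P' Q' where "ev P' = ev P" "degree P' < p" "ev Q' = ev Q" "degree Q' < p"
      by (metis ev_reduced)
    note PQ' = this
    have ne: "P' \<noteq> 0" "Q' \<noteq> 0" using PQ PQ' False by auto
    show ?thesis
      using R.quot_in_R_iff[OF ne(1) PQ'(2) ne(2) PQ'(4)]
        R'.quot_in_R_iff[OF ne(1) PQ'(2) ne(2) PQ'(4)] PQ PQ'(1,3) by simp
  qed (simp add: R.R_closed R'.R_closed)
  thus ?thesis using R.R(2) R'.R(2) by blast
qed

lemma point_infty: "point_infty f \<in> curve_points f" "x \<notin> point_infty f"
proof -
  have "\<exists>!R. R \<in> curve_points f \<and> x \<notin> R"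
    using infinite_place_exists infinite_place_unique by blast
  from theI'[OF this] show "point_infty f \<in> curve_points f" "x \<notin> point_infty f"
    by (auto simp: point_infty_def)
qed

sublocale infty: infinite_place f p "point_infty f"
  using point_infty by unfold_locales

lemma point_infty_eqI: "R \<in> curve_points f \<Longrightarrow> x \<notin> R \<Longrightarrow> R = point_infty f"
  using infinite_place_unique point_infty by blast

text \<open>No irreducibility argument is made for \<open>W^p - W - f\<close>: a nonzero remainder
  of degree below \<open>p\<close> has a definite pole order at infinity, hence does not
  vanish.\<close>

lemma ev_eq_0_iff: "ev Q = 0 \<longleftrightarrow> AS_poly dvd Q"
proof
  assume Q: "ev Q = 0"
  obtain Q' where "ev Q' = ev Q" "degree Q' < p" "AS_poly dvd Q - Q'"
    by (rule ev_reduced)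
  moreover from this have "Q' = 0" using infty.ev_neq_0 Q by metis
  ultimately show "AS_poly dvd Q" by simp
qed (auto elim!: dvdE)

lemma ev_inj:
  assumes "ev P = ev Q" "degree P < p" "degree Q < p"
  shows "P = Q"
  using infty.ev_neq_0[of "P - Q"] assms degree_diff_less[of P p Q] by auto

section \<open>Automorphisms induced by translations\<close>

text \<open>The substitution \<open>X\<close> to \<open>X + y\<close>, \<open>W\<close> to
  \<open>W + P\<close>, on polynomials in \<open>W\<close> over \<open>k[X]\<close>, before the
  Artin-Schreier relation is divided out.\<close>

definition subst :: "'k \<Rightarrow> 'k poly \<Rightarrow> 'k poly poly \<Rightarrow> 'k poly poly" where
  "subst y P Q = pcompose (map_poly (\<lambda>a. pcompose a [:y, 1:]) Q) [:P, 1:]"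

lemma subst_0 [simp]: "subst y P 0 = 0"
  by (simp add: subst_def)

lemma subst_pCons: "subst y P (pCons a Q) = [:pcompose a [:y, 1:]:] + [:P, 1:] * subst y P Q"
  by (simp add: subst_def map_poly_pCons pcompose_pCons)

lemma subst_const: "subst y P [:a:] = [:pcompose a [:y, 1:]:]"
  by (simp add: subst_pCons)

lemma subst_1 [simp]: "subst y P 1 = 1"
  using subst_const[of y P 1] by (simp add: pcompose_1 flip: one_pCons)

lemma subst_W: "subst y P [:0, 1:] = [:P, 1:]"
  by (simp add: subst_pCons pcompose_1 flip: one_pCons)

lemma subst_add [simp]: "subst y P (A + B) = subst y P A + subst y P B"
  by (induction A B rule: poly_induct2) (simp_all add: subst_pCons pcompose_add algebra_simps)

lemma subst_smult: "subst y P (smult a B) = [:pcompose a [:y, 1:]:] * subst y P B"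
  by (induction B) (simp_all add: subst_pCons pcompose_mult smult_add_right algebra_simps)

lemma subst_mult [simp]: "subst y P (A * B) = subst y P A * subst y P B"
  by (induction A) (simp_all add: subst_pCons subst_smult algebra_simps)

lemma subst_diff [simp]: "subst y P (A - B) = subst y P A - subst y P B"
  using subst_add[of y P "A - B" B] by simp

lemma subst_power [simp]: "subst y P (A ^ n) = subst y P A ^ n"
  by (induction n) auto

lemma subst_subst: "subst y P (subst z R A) = subst (y + z) (P + pcompose R [:y, 1:]) A"
proof (induction A)
  case (pCons a A)
  show ?case using pCons.IH pcompose_shift_shift[of a z y]
    by (simp add: subst_pCons pcompose_1 flip: one_pCons) (simp add: one_pCons subst_smult smult_add_left algebra_simps)
qed simp

lemma subst_id [simp]: "subst 0 0 A = A"
  by (simp add: subst_def)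

text \<open>Exactly what makes the substitution fix \<open>W^p - W - f\<close>, so that it descends
  to the function field.\<close>

definition admissible :: "'k \<Rightarrow> 'k poly \<Rightarrow> bool" where
  "admissible y P \<longleftrightarrow> P ^ p - P = pcompose f [:y, 1:] - f"

lemma prime_char_poly: "Factorial_Ring.prime CHAR('k poly)"
  and prime_char_poly_poly: "Factorial_Ring.prime CHAR('k poly poly)"
  using p_prime p_eq by simp_all

lemma of_nat_power_p: "(of_nat i :: 'k poly) ^ p = of_nat i"
proof (induction i)
  case (Suc i)
  have "(1 + of_nat i :: 'k poly) ^ p = 1 ^ p + of_nat i ^ p"
    by (rule freshmans_dream[OF prime_char_poly]) (simp add: p_eq)
  thus ?case using Suc.IH by simp
qed (simp add: p_pos zero_power)

lemma AS_poly_altdef: "AS_poly = [:0, 1:] ^ p - [:0, 1:] - [:f:]"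
  by (simp add: AS_poly_def monom_altdef)

lemma subst_AS_poly:
  assumes "admissible y P"
  shows "subst y P AS_poly = AS_poly"
proof -
  have "[:P, 1:] ^ p = ([:P:] + [:0, 1:]) ^ p" by simp
  also have "\<dots> = [:P ^ p:] + [:0, 1:] ^ p"
    by (subst freshmans_dream[OF prime_char_poly_poly]) (simp_all add: p_eq poly_const_pow)
  finally have "subst y P AS_poly = [:0, 1:] ^ p - [:0, 1:] + [:P ^ p - P - pcompose f [:y, 1:]:]"
    by (simp add: AS_poly_altdef subst_W subst_const)
  also have "P ^ p - P - pcompose f [:y, 1:] = - f" using assms by (simp add: admissible_def)
  finally show ?thesis by (simp add: AS_poly_altdef)
qed

lemma admissible_compose:
  assumes "admissible y P" "admissible z R"
  shows "admissible (y + z) (P + pcompose R [:y, 1:])"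
proof -
  have "pcompose (R ^ p - R) [:y, 1:] = pcompose (pcompose f [:z, 1:] - f) [:y, 1:]"
    using assms(2) by (simp add: admissible_def)
  hence "pcompose R [:y, 1:] ^ p - pcompose R [:y, 1:] = pcompose f [:y + z, 1:] - pcompose f [:y, 1:]"
    by (simp add: pcompose_diff pcompose_power pcompose_shift_shift)
  moreover have "(P + pcompose R [:y, 1:]) ^ p = P ^ p + pcompose R [:y, 1:] ^ p"
    by (rule freshmans_dream[OF prime_char_poly]) (simp add: p_eq)
  moreover have "P ^ p - P = pcompose f [:y, 1:] - f" using assms(1) by (simp add: admissible_def)
  ultimately have "(P + pcompose R [:y, 1:]) ^ p - (P + pcompose R [:y, 1:])
      = (pcompose f [:y, 1:] - f) + (pcompose f [:y + z, 1:] - pcompose f [:y, 1:])"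
    by (simp only: add_diff_add)
  thus ?thesis by (simp add: admissible_def)
qed

lemma minus_power_p: "(- a) ^ p = - (a ^ p)" if "CHAR('b) = p" for a :: "'b::comm_ring_1"
proof -
  have "(a + - a) ^ p = a ^ p + (- a) ^ p"
    by (rule freshmans_dream) (use that p_prime in auto)
  thus ?thesis using p_pos by (simp add: zero_power add_eq_0_iff)
qed

lemma admissible_inverse:
  assumes "admissible y P"
  shows "admissible (- y) (- pcompose P [:- y, 1:])"
proof -
  have "pcompose (P ^ p - P) [:- y, 1:] = pcompose (pcompose f [:y, 1:] - f) [:- y, 1:]"
    using assms by (simp add: admissible_def)
  hence "pcompose P [:- y, 1:] ^ p - pcompose P [:- y, 1:] = f - pcompose f [:- y, 1:]"
    by (simp add: pcompose_diff pcompose_power pcompose_shift_shift)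
  moreover have "(- pcompose P [:- y, 1:]) ^ p = - (pcompose P [:- y, 1:] ^ p)"
    by (rule minus_power_p) (simp add: p_eq)
  ultimately show ?thesis by (simp add: admissible_def algebra_simps)
qed

lemma subst_inverse:
  "subst (- y) (- pcompose P [:- y, 1:]) (subst y P A) = A"
  "subst y P (subst (- y) (- pcompose P [:- y, 1:]) A) = A"
  by (simp_all add: subst_subst pcompose_uminus pcompose_shift_shift)

text \<open>An admissible substitution maps multiples of \<open>AS_poly\<close> to such multiples;
  the converse holds because the inverse substitution is admissible too.\<close>

lemma ev_subst_eq_0_iff:
  assumes "admissible y P"
  shows "ev (subst y P Q) = 0 \<longleftrightarrow> ev Q = 0"
proof -
  have *: "AS_poly dvd subst z R A" if d: "admissible z R" "AS_poly dvd A" for z R A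
  proof -
    obtain B where "A = AS_poly * B" using d(2) ..
    thus ?thesis using subst_AS_poly[OF d(1)] by simp
  qed
  show ?thesis
    unfolding ev_eq_0_iff
    using *[OF assms, of Q] *[OF admissible_inverse[OF assms], of "subst y P Q"]
    by (auto simp: subst_inverse)
qed

lemma ev_subst_cong:
  assumes "admissible y P" "ev A = ev B"
  shows "ev (subst y P A) = ev (subst y P B)"
  using ev_subst_eq_0_iff[OF assms(1), of "A - B"] assms(2) by simp

text \<open>The choice ranges over all ways to write \<open>z\<close> as a fraction;
  \<open>subst_aut_eq\<close> shows by cross-multiplication that the value does not depend on it.
  The restriction to \<open>K\<close> provides the extensionality required in
  \<open>BijGroup\<close>.\<close>

definition subst_aut :: "'k \<Rightarrow> 'k poly \<Rightarrow> 'k closure_kX \<Rightarrow> 'k closure_kX" where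
  "subst_aut y P = (\<lambda>z\<in>K. SOME u. \<exists>A B. ev B \<noteq> 0 \<and> z = ev A / ev B \<and>
     u = ev (subst y P A) / ev (subst y P B))"

lemma subst_aut_eq:
  assumes "admissible y P" "ev B \<noteq> 0"
  shows "subst_aut y P (ev A / ev B) = ev (subst y P A) / ev (subst y P B)"
proof -
  have "(SOME u. \<exists>A' B'. ev B' \<noteq> 0 \<and> ev A / ev B = ev A' / ev B' \<and>
     u = ev (subst y P A') / ev (subst y P B')) = ev (subst y P A) / ev (subst y P B)"
  proof (rule some_equality)
    fix u assume "\<exists>A' B'. ev B' \<noteq> 0 \<and> ev A / ev B = ev A' / ev B' \<and>
      u = ev (subst y P A') / ev (subst y P B')"
    then obtain A' B' where *: "ev B' \<noteq> 0" "ev A / ev B = ev A' / ev B'"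
      "u = ev (subst y P A') / ev (subst y P B')" by blast
    have "ev (A * B') = ev (A' * B)" using * assms(2) by (simp add: frac_eq_eq)
    from ev_subst_cong[OF assms(1) this] show "u = ev (subst y P A) / ev (subst y P B)"
      using * assms ev_subst_eq_0_iff[OF assms(1)] by (simp add: frac_eq_eq)
  qed (use assms in blast)
  thus ?thesis using assms K_I by (simp add: subst_aut_def)
qed

lemma subst_aut_ev: "admissible y P \<Longrightarrow> subst_aut y P (ev A) = ev (subst y P A)"
  using subst_aut_eq[of y P 1 A] by simp

lemma Aut_curve_iff:
  "\<sigma> \<in> carrier (Aut_curve f) \<longleftrightarrow> \<sigma> \<in> extensional K \<and> bij_betw \<sigma> K K \<and>
     (\<forall>a\<in>K. \<forall>b\<in>K. \<sigma> (a + b) = \<sigma> a + \<sigma> b \<and> \<sigma> (a * b) = \<sigma> a * \<sigma> b) \<and>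
     (\<forall>c. \<sigma> (emb [:c:]) = emb [:c:])"
proof -
  have ops: "a \<otimes>\<^bsub>function_field f\<^esub> b = a * b" "a \<oplus>\<^bsub>function_field f\<^esub> b = a + b"
    "\<one>\<^bsub>function_field f\<^esub> = 1" for a b
    by (simp_all add: function_field_def ring_of_type_algebra_def)
  have "\<sigma> 1 = 1" if "\<forall>c. \<sigma> (emb [:c:]) = emb [:c:]"
    using that[rule_format, of 1] by (simp flip: one_pCons)
  thus ?thesis
    by (auto simp: Aut_curve_def BijGroup_def ring_hom_def Bij_def ops dest: bij_betw_apply)
qed

lemma subst_aut_in_Aut:
  assumes "admissible y P"
  shows "subst_aut y P \<in> carrier (Aut_curve f)"
proof -
  note nz = ev_subst_eq_0_iff[OF assms]
  have inv: "subst_aut y P (subst_aut z R a) = a" "subst_aut z R a \<in> K"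
    if ad: "admissible y P" "admissible z R" and id: "\<And>A. subst y P (subst z R A) = A"
      and a: "a \<in> K" for y z P R a
  proof -
    obtain A B where AB: "a = ev A / ev B" "ev B \<noteq> 0" by (rule K_E[OF a])
    note n = ev_subst_eq_0_iff[OF ad(2)]
    show "subst_aut y P (subst_aut z R a) = a" "subst_aut z R a \<in> K"
      using AB n by (auto simp: subst_aut_eq ad id intro: K_I)
  qed
  let ?z = "- y" and ?R = "- pcompose P [:- y, 1:]"
  note ad = admissible_inverse[OF assms]
  have bij: "bij_betw (subst_aut y P) K K"
    by (rule bij_betwI[of _ _ _ "subst_aut ?z ?R"])
      (auto intro: inv[OF ad assms subst_inverse(1)] inv[OF assms ad subst_inverse(2)])
  have "subst_aut y P (a + b) = subst_aut y P a + subst_aut y P b \<and>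
      subst_aut y P (a * b) = subst_aut y P a * subst_aut y P b" if ab: "a \<in> K" "b \<in> K" for a b
  proof -
    obtain A B where AB: "a = ev A / ev B" "ev B \<noteq> 0" by (rule K_E[OF ab(1)])
    obtain C D where CD: "b = ev C / ev D" "ev D \<noteq> 0" by (rule K_E[OF ab(2)])
    have 1: "a + b = ev (A * D + C * B) / ev (B * D)" "a * b = ev (A * C) / ev (B * D)"
      "ev (B * D) \<noteq> 0"
      using AB CD by (simp_all add: add_frac_eq)
    have 2: "ev (subst y P B) \<noteq> 0" "ev (subst y P D) \<noteq> 0" using AB CD nz by auto
    show ?thesis
      unfolding 1(1,2) subst_aut_eq[OF assms 1(3)]
      unfolding AB CD subst_aut_eq[OF assms AB(2)] subst_aut_eq[OF assms CD(2)]
      using 2 by (simp add: add_frac_eq)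
  qed
  moreover have "subst_aut y P (emb [:c:]) = emb [:c:]" for c
    using subst_aut_ev[OF assms, of "[:[:c:]:]"] by (simp add: subst_const)
  moreover have "subst_aut y P \<in> extensional K" by (simp add: subst_aut_def)
  ultimately show ?thesis using bij by (simp add: Aut_curve_iff)
qed

lemma Aut_curve_props:
  assumes "\<sigma> \<in> carrier (Aut_curve f)"
  shows "a \<in> K \<Longrightarrow> \<sigma> a \<in> K" "a \<in> K \<Longrightarrow> b \<in> K \<Longrightarrow> \<sigma> (a + b) = \<sigma> a + \<sigma> b"
    "a \<in> K \<Longrightarrow> b \<in> K \<Longrightarrow> \<sigma> (a * b) = \<sigma> a * \<sigma> b" "\<sigma> (emb [:c:]) = emb [:c:]" "\<sigma> 0 = 0" "\<sigma> 1 = 1"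
    "a \<in> K \<Longrightarrow> b \<in> K \<Longrightarrow> \<sigma> (a - b) = \<sigma> a - \<sigma> b" "a \<in> K \<Longrightarrow> \<sigma> (a ^ n) = \<sigma> a ^ n"
    "a \<in> K \<Longrightarrow> \<sigma> (inverse a) = inverse (\<sigma> a)" "a \<in> K \<Longrightarrow> b \<in> K \<Longrightarrow> \<sigma> a = \<sigma> b \<Longrightarrow> a = b"
    "\<sigma> ` K = K" "a \<in> K \<Longrightarrow> b \<in> K \<Longrightarrow> \<sigma> (a / b) = \<sigma> a / \<sigma> b"
proof -
  note c = is_subring_closed[OF K_subring] K_inverse
  note A = assms[unfolded Aut_curve_iff]
  show cl: "\<sigma> a \<in> K" if "a \<in> K" for a using A that bij_betw_apply by metis
  show add: "a \<in> K \<Longrightarrow> b \<in> K \<Longrightarrow> \<sigma> (a + b) = \<sigma> a + \<sigma> b"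
    and mult: "a \<in> K \<Longrightarrow> b \<in> K \<Longrightarrow> \<sigma> (a * b) = \<sigma> a * \<sigma> b"
    and const: "\<sigma> (emb [:c:]) = emb [:c:]" for a b c using A by auto
  show 0: "\<sigma> 0 = 0" and 1: "\<sigma> 1 = 1" using const[of 0] const[of 1] by (simp_all flip: one_pCons)
  show "\<sigma> (a - b) = \<sigma> a - \<sigma> b" if "a \<in> K" "b \<in> K" for a b
    using add[of "a - b" b] that c by simp
  show "\<sigma> (a ^ n) = \<sigma> a ^ n" if "a \<in> K" for a
    using that by (induction n) (simp_all add: 1 mult c)
  show inj: "a = b" if "a \<in> K" "b \<in> K" "\<sigma> a = \<sigma> b" for a b
    using A that by (auto simp: bij_betw_def inj_on_def)
  show inv: "\<sigma> (inverse a) = inverse (\<sigma> a)" if "a \<in> K" for a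
  proof (cases "a = 0")
    case False
    hence "\<sigma> a * \<sigma> (inverse a) = 1" using mult[of a "inverse a"] that c 1 by simp
    thus ?thesis by (simp add: inverse_unique)
  qed (simp add: 0)
  show "\<sigma> ` K = K" using A by (auto simp: bij_betw_def)
  show "\<sigma> (a / b) = \<sigma> a / \<sigma> b" if "a \<in> K" "b \<in> K" for a b
    using that c by (simp add: divide_inverse mult inv)
qed

lemma preimage_curve_point:
  assumes "\<sigma> \<in> carrier (Aut_curve f)" "R \<in> curve_points f"
  shows "{z \<in> K. \<sigma> z \<in> R} \<in> curve_points f"
proof -
  note c = is_subring_closed[OF K_subring] K_inverse
  note s = Aut_curve_props[OF assms(1)]
  note R = assms(2)[unfolded curve_points_iff]
  have "is_subring {z \<in> K. \<sigma> z \<in> R}"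
    unfolding is_subring_def
    using is_subring_closed(2,5,6)[OF conjunct1[OF R]] c(2,5,6) s(3,6,7) by simp
  moreover have "{z \<in> K. \<sigma> z \<in> R} \<noteq> K"
  proof
    assume "{z \<in> K. \<sigma> z \<in> R} = K"
    hence "\<sigma> ` K \<subseteq> R" by auto
    hence "K \<subseteq> R" by (simp only: s(11))
    thus False using R by blast
  qed
  moreover have "z \<in> {z \<in> K. \<sigma> z \<in> R} \<or> inverse z \<in> {z \<in> K. \<sigma> z \<in> R}" if "z \<in> K" for z
    using R that s(1,9) c(8) by simp
  ultimately show ?thesis using R by (auto simp: curve_points_iff s(4))
qed

end

section \<open>Coefficients of shifted polynomials\<close>

lemma coeff_shift_power:
  "coeff ([:y, 1:] ^ i) j = of_nat (i choose j) * (y::'a::comm_ring_1) ^ (i - j)"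
proof (cases "j \<le> i")
  case False
  have "degree ([:y, 1:] ^ i) \<le> i"
    using degree_power_le[of "[:y, 1:]" i] by simp
  thus ?thesis using False by (simp add: coeff_eq_0 binomial_eq_0)
qed (simp add: coeff_linear_poly_power)

lemma coeff_pcompose_shift:
  fixes Q :: "'a::comm_ring_1 poly"
  assumes "degree Q \<le> n"
  shows "coeff (pcompose Q [:y, 1:]) j = (\<Sum>i\<in>{j..n}. of_nat (i choose j) * y ^ (i - j) * coeff Q i)"
proof -
  have "pcompose Q [:y, 1:] = pcompose (\<Sum>i\<le>n. monom (coeff Q i) i) [:y, 1:]"
    using poly_as_sum_of_monoms'[OF assms] by simp
  also have "\<dots> = (\<Sum>i\<le>n. smult (coeff Q i) ([:y, 1:] ^ i))"
    by (simp add: pcompose_sum pcompose_monom)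
  finally have "coeff (pcompose Q [:y, 1:]) j
      = (\<Sum>i\<le>n. coeff Q i * (of_nat (i choose j) * y ^ (i - j)))"
    by (simp add: coeff_sum coeff_shift_power)
  also have "\<dots> = (\<Sum>i\<in>{j..n}. coeff Q i * (of_nat (i choose j) * y ^ (i - j)))"
    by (rule sum.mono_neutral_right) (auto simp: binomial_eq_0)
  finally show ?thesis by (simp add: mult_ac)
qed

text \<open>The difference operator lowers the degree and multiplies the top coefficient by the old
  degree. Below degree \<open>p\<close> this factor is invertible in characteristic
  \<open>p\<close>, so the top coefficient can be recovered.\<close>

lemma coeff_difference:
  fixes Q :: "'a::comm_ring_1 poly"
  assumes "degree Q \<le> Suc n"
  shows "coeff (pcompose Q [:1, 1:] - Q) n = of_nat (Suc n) * coeff Q (Suc n)"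
    and "degree (pcompose Q [:1, 1:] - Q) \<le> n"
proof -
  have "{n..Suc n} = {n, Suc n}" by auto
  thus "coeff (pcompose Q [:1, 1:] - Q) n = of_nat (Suc n) * coeff Q (Suc n)"
    by (simp add: coeff_pcompose_shift[OF assms] distrib_right add.commute)
  show "degree (pcompose Q [:1, 1:] - Q) \<le> n"
  proof (rule degree_le, intro allI impI)
    fix i assume "n < i"
    show "coeff (pcompose Q [:1, 1:] - Q) i = 0"
    proof (cases "i = Suc n")
      case False
      thus ?thesis using \<open>n < i\<close> assms
        by (simp add: coeff_pcompose_shift[OF assms] coeff_eq_0)
    qed (simp add: coeff_pcompose_shift[OF assms])
  qed
qed

context artin_schreier
begin

section \<open>Functions regular outside infinity\<close>

text \<open>Described by places rather than by generators, so that automorphisms can transport it;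
  \<open>regular_ev\<close> shows that nothing beyond \<open>k[x, w]\<close> is obtained.\<close>

definition regular :: "'k closure_kX set" where
  "regular = {z \<in> K. \<forall>R\<in>curve_points f. x \<in> R \<longrightarrow> z \<in> R}"

lemma ev_regular: "ev Q \<in> regular"
proof -
  have "ev Q \<in> R" if "R \<in> curve_points f" "x \<in> R" for R
  proof -
    interpret curve_point f p R using that(1) by unfold_locales
    show ?thesis using that(2) by (rule ev_in_R)
  qed
  thus ?thesis by (simp add: regular_def)
qed

lemma regular_subring: "is_subring regular"
proof -
  have "is_subring R" if "R \<in> curve_points f" for R using that by (simp add: curve_points_iff)
  thus ?thesis using K_subring by (simp add: is_subring_def regular_def)
qed

lemma Aut_regular:
  assumes "\<sigma> \<in> carrier (Aut_curve f)" "\<sigma> x = x" "z \<in> regular"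
  shows "\<sigma> z \<in> regular"
proof -
  have "\<sigma> z \<in> R" if "R \<in> curve_points f" "x \<in> R" for R
    using preimage_curve_point[OF assms(1) that(1)] assms(2,3) that(2) by (auto simp: regular_def)
  thus ?thesis using assms Aut_curve_props(1) by (simp add: regular_def)
qed

text \<open>A place above \<open>X = \<alpha>\<close>: the extension theorem is applied to
  \<open>k[x]\<close>, in which \<open>x - \<alpha>\<close> has no inverse.\<close>

lemma finite_curve_point_exists:
  obtains R where "R \<in> curve_points f" "x \<in> R" "inverse (emb [:- \<alpha>, 1:]) \<notin> R"
proof -
  have "is_subring (range emb)"
    unfolding is_subring_def by (auto simp flip: emb_simps intro: rangeI)
  moreover have "inverse (emb [:- \<alpha>, 1:]) \<notin> range emb"
  proof
    assume "inverse (emb [:- \<alpha>, 1:]) \<in> range emb"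
    then obtain q where q: "inverse (emb [:- \<alpha>, 1:]) = emb q" by blast
    hence "emb ([:- \<alpha>, 1:] * q) = emb 1" by (simp only: emb_simps flip: q) simp
    hence "[:- \<alpha>, 1:] * q = 1" by (rule iffD1[OF emb_simps(8)])
    hence "degree ([:- \<alpha>, 1:] * q) = 0" by simp
    moreover have "q \<noteq> 0" using \<open>[:- \<alpha>, 1:] * q = 1\<close> by auto
    ultimately show False by (simp add: degree_mult_eq del: mult_pCons_left)
  qed
  ultimately obtain S where S: "is_subring S" "range emb \<subseteq> S" "inverse (emb [:- \<alpha>, 1:]) \<notin> S"
    "\<forall>z. z \<in> S \<or> inverse z \<in> S"
    using valuation_ring_exists[of "range emb" "emb [:- \<alpha>, 1:]"] by auto
  have "is_subring (S \<inter> K)"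
    using S(1) K_subring by (auto simp: is_subring_def)
  moreover have "inverse (emb [:- \<alpha>, 1:]) \<in> K" by (simp add: K_inverse)
  ultimately have "S \<inter> K \<in> curve_points f"
    using S(2,3,4) K_inverse by (auto simp: curve_points_iff)
  thus thesis using S(2,3) that[of "S \<inter> K"] by auto
qed

text \<open>Denominators are removed root by root. At a place above a root \<open>\<alpha>\<close>
  of \<open>n\<close> the function \<open>n\<close> lies in the maximal ideal, hence so does
  \<open>a\<close>; as \<open>a\<close> differs from the constant \<open>poly a \<alpha>\<close> by
  an element of the maximal ideal, this constant is 0 and \<open>X - \<alpha>\<close>
  cancels.\<close>

lemma regular_quot_dvd:
  assumes "emb a / emb n \<in> regular" "n \<noteq> 0"
  shows "n dvd a"
  using assms
proof (induction "degree n" arbitrary: n a)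
  case 0
  hence "n dvd 1" by (simp add: is_unit_iff_degree)
  thus ?case by (rule dvd_trans) (rule one_dvd)
next
  case (Suc d)
  then obtain \<alpha> where \<alpha>: "poly n \<alpha> = 0" using alg_closed_imp_poly_has_root[of n] by auto
  then obtain n' where n': "n = [:- \<alpha>, 1:] * n'" by (auto simp: poly_eq_0_iff_dvd elim: dvdE)
  obtain R where pt: "R \<in> curve_points f" "x \<in> R" "inverse (emb [:- \<alpha>, 1:]) \<notin> R"
    by (rule finite_curve_point_exists)
  interpret curve_point f p R using pt(1) by unfold_locales
  have t: "emb [:- \<alpha>, 1:] \<in> maxideal"
    using pt(3) emb_in_R[OF pt(2)] by (auto simp: maxideal_def units_def)
  have in_max: "emb b \<in> maxideal" if root: "poly b \<alpha> = 0" for b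
  proof -
    obtain c where "b = [:- \<alpha>, 1:] * c" using root by (auto simp: poly_eq_0_iff_dvd elim: dvdE)
    hence "emb b = emb [:- \<alpha>, 1:] * emb c" by (simp only: emb_simps)
    thus ?thesis using maxideal_closed(1)[OF t emb_in_R[OF pt(2)]] by simp
  qed
  have "emb a / emb n \<in> R" using Suc.prems(1) pt(1,2) by (simp add: regular_def)
  hence "emb n * (emb a / emb n) \<in> maxideal" by (rule maxideal_closed(1)[OF in_max[OF \<alpha>]])
  hence a: "emb a \<in> maxideal" using Suc.prems(2) by simp
  have "poly a \<alpha> = 0"
  proof (rule ccontr)
    assume "poly a \<alpha> \<noteq> 0"
    hence u: "emb [:poly a \<alpha>:] \<in> units" by (rule const_in_units)
    have "emb (a - [:poly a \<alpha>:]) \<in> maxideal" by (rule in_max) simp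
    hence "emb [:poly a \<alpha>:] + emb (a - [:poly a \<alpha>:]) \<in> units" by (rule unit_add_maxideal[OF u])
    hence "emb a \<in> units" by (simp flip: emb_simps(3))
    thus False using a maxideal_closed(5) by blast
  qed
  then obtain a' where a': "a = [:- \<alpha>, 1:] * a'" by (auto simp: poly_eq_0_iff_dvd elim: dvdE)
  have n0: "n' \<noteq> 0" using Suc.prems(2) n' by auto
  have "emb a / emb n = emb a' / emb n'"
    unfolding a' n' emb_simps(4) by simp
  moreover have "d = degree n'"
    using Suc.hyps(2) n0 unfolding n' by (simp add: degree_mult_eq del: mult_pCons_left)
  ultimately have "n' dvd a'" using Suc.hyps(1)[of n' a'] Suc.prems n0 by simp
  thus "n dvd a" unfolding a' n' by (rule mult_dvd_mono[OF dvd_refl])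
qed

lemma subst_shift_W: "subst 0 P Q = pcompose Q [:P, 1:]"
  by (simp add: subst_def)

lemma admissible_0_1: "admissible 0 1"
  by (simp add: admissible_def)

lemma of_nat_neq_0: "0 < n \<Longrightarrow> n < p \<Longrightarrow> (of_nat n :: 'k) \<noteq> 0"
  using p_eq by (auto simp: of_nat_eq_0_iff_char_dvd dest: dvd_imp_le)

text \<open>The norm of a nonzero function is invariant under \<open>W \<mapsto> W + 1\<close>, hence a polynomial in \<open>x\<close>.\<close>

lemma norm_exists:
  assumes "ev B \<noteq> 0"
  obtains B' n where "n \<noteq> 0" "ev (B * B') = emb n"
proof -
  define g where "g i = pcompose B [:of_nat i, 1:]" for i
  define N where "N = (\<Prod>i<p. g i)"
  have cp: "of_nat p = (0 :: 'k poly)" using p_eq by (metis of_nat_CHAR semiring_char_poly)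
  have adm: "admissible 0 (of_nat i)" for i
    by (simp add: admissible_def of_nat_power_p)
  have shift: "pcompose (g i) [:1, 1:] = g (Suc i)" for i
    by (simp add: g_def pcompose_pCons add.commute flip: pcompose_assoc)
  have g0: "g 0 = B" by (simp add: g_def)
  have gp: "g p = B" by (simp add: g_def cp)
  have B0: "B \<noteq> 0" using assms by auto
  \<comment> \<open>The shift moves each factor to the next index, and the indices are cyclic
    because \<open>g p = g 0\<close> in characteristic \<open>p\<close>.\<close>
  have "pcompose N [:1, 1:] * g 0 = (\<Prod>i<Suc p. g i)"
    by (simp add: N_def pcompose_prod shift prod.lessThan_Suc_shift mult.commute del: prod.lessThan_Suc)
  hence N1: "pcompose N [:1, 1:] = N" using B0 by (simp add: g0 gp N_def)
  obtain N' where N': "ev N' = ev N" "degree N' < p" "AS_poly dvd N - N'" by (rule ev_reduced)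
  have "ev (subst 0 1 N') = ev (subst 0 1 N)" by (rule ev_subst_cong[OF admissible_0_1 N'(1)])
  hence "ev (pcompose N' [:1, 1:]) = ev N'" by (simp add: subst_shift_W N1 N'(1))
  moreover have "degree (pcompose N' [:1, 1:]) < p"
    using degree_pcompose_le[of N' "[:1, 1:]"] N'(2) by simp
  ultimately have inv: "pcompose N' [:1, 1:] = N'" using N'(2) by (intro ev_inj)
  \<comment> \<open>A shift-invariant polynomial in \<open>W\<close> of degree between 1 and
    \<open>p - 1\<close> is impossible, since its difference has a nonzero top coefficient.\<close>
  have "degree N' = 0"
  proof (rule ccontr)
    assume "degree N' \<noteq> 0"
    then obtain J where J: "degree N' = Suc J" by (cases "degree N'") auto
    have "of_nat (Suc J) * lead_coeff N' = 0"
      using coeff_difference(1)[of N' J] J by (simp add: inv)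
    moreover have "(of_nat (Suc J) :: 'k) \<noteq> 0" using J N'(2) by (intro of_nat_neq_0) auto
    hence "(of_nat (Suc J) :: 'k poly) \<noteq> 0" by (simp only: of_nat_poly pCons_eq_0_iff) simp
    ultimately have "lead_coeff N' = 0" by (simp only: mult_eq_0_iff) simp
    hence "N' = 0" by (simp only: leading_coeff_0_iff)
    thus False using J by simp
  qed
  then obtain n where n: "N' = [:n:]" by (auto elim: degree_eq_zeroE)
  have "ev (g i) \<noteq> 0" for i
    using ev_subst_eq_0_iff[OF adm, of i B] assms by (simp add: subst_shift_W g_def)
  hence "ev N \<noteq> 0" by (simp add: N_def ev_prod)
  hence "n \<noteq> 0" using N'(1) n by auto
  moreover have "ev (B * (\<Prod>i\<in>{..<p} - {0}. g i)) = emb n"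
    using N'(1) n p_pos by (simp add: N_def prod.remove[of "{..<p}" 0] g0)
  ultimately show thesis using that by blast
qed

text \<open>The affine curve is smooth because \<open>W \<mapsto> W + 1\<close> moves \<open>w\<close> by a unit: differences of a regular
  function under this automorphism isolate its leading coefficient.\<close>

lemma regular_ev:
  assumes "z \<in> regular"
  shows "z \<in> range ev"
proof -
  let ?\<tau> = "subst_aut 0 1"
  have \<tau>: "?\<tau> \<in> carrier (Aut_curve f)" by (rule subst_aut_in_Aut[OF admissible_0_1])
  note \<tau>p = Aut_curve_props[OF \<tau>]
  have \<tau>emb: "?\<tau> (emb a) = emb a" for a
    using subst_aut_ev[OF admissible_0_1, of "[:a:]"] by (simp add: subst_shift_W)
  have regK: "z \<in> K" if "z \<in> regular" for z using that by (simp add: regular_def)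
  \<comment> \<open>Replacing \<open>z\<close> by \<open>?\<tau> z - z\<close> keeps it regular,
    keeps the denominator \<open>n\<close>, and turns the top coefficient into an invertible
    multiple of itself one degree lower. After \<open>J\<close> such steps a fraction in
    \<open>k(x)\<close> is left, covered by \<open>regular_quot_dvd\<close>.\<close>
  have lead: "n dvd coeff Q J"
    if "z \<in> regular" "n \<noteq> 0" "emb n * z = ev Q" "degree Q \<le> J" "J < p" for z n Q J
    using that
  proof (induction J arbitrary: z Q)
    case 0
    then obtain a where a: "Q = [:a:]" by (auto elim: degree_eq_zeroE)
    hence "z = emb a / emb n" using 0 by (simp add: field_simps)
    thus ?case using 0 a regular_quot_dvd by simp
  next
    case (Suc J)
    let ?D = "pcompose Q [:1, 1:] - Q"
    have "emb n * (?\<tau> z - z) = ?\<tau> (emb n * z) - emb n * z"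
      using \<tau>p(3)[of "emb n" z] regK[OF Suc.prems(1)] by (simp add: \<tau>emb algebra_simps)
    also have "\<dots> = ev ?D"
      unfolding Suc.prems(3) using subst_aut_ev[OF admissible_0_1, of Q] by (simp add: subst_shift_W)
    finally have "emb n * (?\<tau> z - z) = ev ?D" .
    moreover have "?\<tau> z - z \<in> regular"
      using Aut_regular[OF \<tau> \<tau>emb Suc.prems(1)] Suc.prems(1) by (intro is_subring_closed regular_subring)
    ultimately have "n dvd coeff ?D J"
      using Suc.IH[of "?\<tau> z - z" ?D] Suc.prems coeff_difference(2)[of Q J] by simp
    hence "n dvd of_nat (Suc J) * coeff Q (Suc J)"
      using coeff_difference(1)[of Q J] Suc.prems(4) by simp
    moreover have "(of_nat (Suc J) :: 'k) \<noteq> 0" using Suc.prems by (intro of_nat_neq_0) auto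
    ultimately show ?case by (metis of_nat_mult_conv_smult dvd_smult_cancel)
  qed
  \<comment> \<open>The top coefficient is divisible by \<open>n\<close>, so a multiple of
    \<open>w^J\<close> from \<open>k[x, w]\<close> can be subtracted; the remainder is again regular
    and has smaller degree.\<close>
  have main: "z \<in> range ev"
    if "z \<in> regular" "n \<noteq> 0" "emb n * z = ev Q" "degree Q < J" "J \<le> p" for z n Q J
    using that
  proof (induction J arbitrary: z Q)
    case (Suc J)
    have "n dvd coeff Q J" using lead[of z n Q J] Suc.prems by simp
    then obtain c where c: "coeff Q J = n * c" ..
    let ?z = "z - ev (monom c J)" and ?Q = "Q - monom (coeff Q J) J"
    have z: "?z \<in> regular"
      using Suc.prems(1) ev_regular by (intro is_subring_closed regular_subring)
    have "monom (coeff Q J) J = [:n:] * monom c J" by (simp add: c smult_monom)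
    hence eq: "emb n * ?z = ev ?Q"
      using Suc.prems(3) by (simp add: right_diff_distrib del: mult_pCons_left)
    show ?case
    proof (cases "?Q = 0")
      case True
      hence "?z = 0" using eq Suc.prems(2) by simp
      thus ?thesis by simp
    next
      case False
      have "degree ?Q < J"
      proof -
        have "degree ?Q \<le> J" using Suc.prems(4) by (intro degree_diff_le degree_monom_le) auto
        moreover have "degree ?Q \<noteq> J"
        proof
          assume "degree ?Q = J"
          hence "coeff ?Q J \<noteq> 0" using False by (metis leading_coeff_0_iff)
          thus False by simp
        qed
        ultimately show ?thesis by simp
      qed
      then obtain Q' where "?z = ev Q'" using Suc.IH[OF z Suc.prems(2) eq] Suc.prems(5) by auto
      hence "z = ev (Q' + monom c J)" by (simp add: diff_eq_eq)
      thus ?thesis by blast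
    qed
  qed simp
  obtain A B where AB: "z = ev A / ev B" "ev B \<noteq> 0" using K_E[OF regK[OF assms]] by blast
  obtain B' n where n: "n \<noteq> 0" "ev (B * B') = emb n" by (rule norm_exists[OF AB(2)])
  obtain Q where Q: "ev Q = ev (A * B')" "degree Q < p" "AS_poly dvd A * B' - Q" by (rule ev_reduced)
  have "emb n * z = ev Q" using AB n(2) Q(1) by (simp flip: n(2))
  thus ?thesis using main[OF assms n(1) _ Q(2)] by simp
qed

text \<open>An automorphism permutes the places. As it fixes infinity, every other place pulls back
  to one where \<open>x\<close> is finite, so functions regular there stay regular.\<close>

lemma stabilizer_ev:
  assumes "\<sigma> \<in> carrier (Aut_curve f)" "\<sigma> ` point_infty f = point_infty f"
  obtains Q' where "\<sigma> (ev Q) = ev Q'" "degree Q' < p"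
proof -
  have "\<sigma> (ev Q) \<in> R" if R: "R \<in> curve_points f" "x \<in> R" for R
  proof -
    let ?R = "{z \<in> K. \<sigma> z \<in> R}"
    have R': "?R \<in> curve_points f" by (rule preimage_curve_point[OF assms(1) R(1)])
    have "x \<in> ?R"
    proof (rule ccontr)
      assume "x \<notin> ?R"
      hence "?R = point_infty f" using R' by (rule point_infty_eqI[rotated])
      moreover have "\<sigma> ` ?R = R"
        using Aut_curve_props(11)[OF assms(1)] R(1) by (auto simp: curve_points_iff)
      ultimately have "R = point_infty f" using assms(2) by simp
      thus False using R(2) point_infty(2) by simp
    qed
    moreover have "\<forall>R\<in>curve_points f. x \<in> R \<longrightarrow> ev Q \<in> R"
      using ev_regular[of Q] by (simp add: regular_def)
    ultimately have "ev Q \<in> ?R" by (rule bspec[OF _ R', THEN mp, rotated])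
    thus ?thesis by simp
  qed
  hence "\<sigma> (ev Q) \<in> regular" using Aut_curve_props(1)[OF assms(1)] by (simp add: regular_def)
  then obtain A where A: "\<sigma> (ev Q) = ev A" using regular_ev by blast
  obtain Q' where "ev Q' = ev A" "degree Q' < p" "AS_poly dvd A - Q'" by (rule ev_reduced)
  thus thesis using that[of Q'] A by simp
qed

section \<open>The stabilizer of infinity\<close>

abbreviation Stab :: "('k closure_kX \<Rightarrow> 'k closure_kX) set" where
  "Stab \<equiv> carrier (stabilizer_infty f)"

lemma Stab_iff: "\<sigma> \<in> Stab \<longleftrightarrow> \<sigma> \<in> carrier (Aut_curve f) \<and> \<sigma> ` point_infty f = point_infty f"
  by (simp add: stabilizer_infty_def stabilizer_def)

lemma Stab_Aut: "\<sigma> \<in> Stab \<Longrightarrow> \<sigma> \<in> carrier (Aut_curve f)"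
  by (simp add: Stab_iff)

lemma Stab_Bij: "\<sigma> \<in> Stab \<Longrightarrow> \<sigma> \<in> Bij K"
  by (simp add: Stab_iff Aut_curve_def)

lemma stabilizer_infty_altdef: "stabilizer_infty f = BijGroup K\<lparr>carrier := Stab\<rparr>"
  by (simp add: stabilizer_infty_def Aut_curve_def)

lemma mult_stabilizer: "\<sigma> \<in> Stab \<Longrightarrow> \<tau> \<in> Stab \<Longrightarrow> \<sigma> \<otimes>\<^bsub>stabilizer_infty f\<^esub> \<tau> = compose K \<sigma> \<tau>"
  by (subst stabilizer_infty_altdef) (simp add: BijGroup_def Stab_Bij)

lemma one_stabilizer: "\<one>\<^bsub>stabilizer_infty f\<^esub> = (\<lambda>z\<in>K. z)"
  by (subst stabilizer_infty_altdef) (simp add: BijGroup_def)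

lemma point_infty_subset_K: "point_infty f \<subseteq> K"
  using point_infty(1) by (simp add: curve_points_iff)

lemma compose_in_Stab:
  assumes "\<sigma> \<in> Stab" "\<tau> \<in> Stab"
  shows "compose K \<sigma> \<tau> \<in> Stab"
proof -
  note s = Aut_curve_props[OF Stab_Aut[OF assms(1)]]
  note t = Aut_curve_props[OF Stab_Aut[OF assms(2)]]
  note c = is_subring_closed[OF K_subring]
  have "compose K \<sigma> \<tau> ` point_infty f = \<sigma> ` (\<tau> ` point_infty f)"
    using point_infty_subset_K by (force simp: compose_def image_iff)
  also have "\<dots> = point_infty f" using assms by (simp add: Stab_iff)
  finally show ?thesis
    using compose_Bij[OF Stab_Bij[OF assms(1)] Stab_Bij[OF assms(2)]]
    unfolding Stab_iff Aut_curve_iff by (auto simp: Bij_def compose_eq s t c)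
qed

lemma inverse_in_Stab:
  assumes "\<sigma> \<in> Stab"
  shows "(\<lambda>z\<in>K. inv_into K \<sigma> z) \<in> Stab"
proof -
  note s = Aut_curve_props[OF Stab_Aut[OF assms]]
  note c = is_subring_closed[OF K_subring]
  let ?t = "inv_into K \<sigma>"
  have inj: "inj_on \<sigma> K" using s(10) by (auto simp: inj_on_def)
  have tK: "?t z \<in> K" "\<sigma> (?t z) = z" if "z \<in> K" for z
    using that s(11) by (auto intro: inv_into_into f_inv_into_f)
  have ts: "?t (\<sigma> z) = z" if "z \<in> K" for z using that inj by simp
  have eqI: "?t z = u" if "u \<in> K" "\<sigma> u = z" for z u using ts that by auto
  have "(\<lambda>z\<in>K. ?t z) \<in> Bij K" by (rule restrict_inv_into_Bij[OF Stab_Bij[OF assms]])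
  moreover have "?t (a + b) = ?t a + ?t b" "?t (a * b) = ?t a * ?t b" if "a \<in> K" "b \<in> K" for a b
    using that by (auto intro!: eqI simp: s c tK)
  moreover have "?t (emb [:k:]) = emb [:k:]" for k by (rule eqI) (simp_all add: s)
  moreover have "(\<lambda>z\<in>K. ?t z) ` point_infty f = point_infty f"
  proof -
    have P: "\<sigma> ` point_infty f = point_infty f" using assms by (simp add: Stab_iff)
    have "(\<lambda>z\<in>K. ?t z) ` point_infty f = ?t ` point_infty f"
      using point_infty_subset_K by (intro image_cong) auto
    also have "\<dots> = ?t ` (\<sigma> ` point_infty f)" by (simp only: P)
    also have "\<dots> = point_infty f"
      using point_infty_subset_K by (rule inv_into_image_cancel[OF inj])
    finally show ?thesis .
  qed
  ultimately show ?thesis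
    unfolding Stab_iff Aut_curve_iff by (auto simp: Bij_def c)
qed

lemma one_in_Stab: "(\<lambda>z\<in>K. z) \<in> Stab"
proof -
  have "(\<lambda>z\<in>K. z) ` point_infty f = point_infty f"
    using point_infty_subset_K by (force simp: image_iff)
  thus ?thesis
    using id_Bij[of K] is_subring_closed[OF K_subring] by (auto simp: Stab_iff Aut_curve_iff Bij_def)
qed

lemma group_stabilizer: "group (stabilizer_infty f)"
proof -
  have "subgroup Stab (BijGroup K)"
  proof
    show "Stab \<subseteq> carrier (BijGroup K)" by (auto simp: BijGroup_def Stab_Bij)
    show "\<one>\<^bsub>BijGroup K\<^esub> \<in> Stab" using one_in_Stab by (simp add: BijGroup_def)
    show "\<sigma> \<otimes>\<^bsub>BijGroup K\<^esub> \<tau> \<in> Stab" if "\<sigma> \<in> Stab" "\<tau> \<in> Stab" for \<sigma> \<tau>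
      using that compose_in_Stab by (simp add: BijGroup_def Stab_Bij)
    show "inv\<^bsub>BijGroup K\<^esub> \<sigma> \<in> Stab" if "\<sigma> \<in> Stab" for \<sigma>
      using that inverse_in_Stab by (simp add: inv_BijGroup Stab_Bij)
  qed
  thus ?thesis
    using subgroup.subgroup_is_group[OF _ group_BijGroup] stabilizer_infty_altdef by metis
qed

section \<open>Action of the stabilizer on \<open>x\<close> and \<open>w\<close>\<close>

lemma pole_order_monom: "a \<noteq> 0 \<Longrightarrow> pole_order (monom a j) = p * degree a + degree f * j"
proof -
  assume "a \<noteq> 0"
  hence "{i. coeff (monom a j) i \<noteq> 0} = {j}" by auto
  thus ?thesis by (simp add: pole_order_def)
qed

lemma pole_order_X: "pole_order [:[:0, 1:]:] = p"
  using pole_order_monom[of "[:0, 1:]" 0] by (simp add: monom_0)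

lemma pole_order_W: "pole_order [:0, 1:] = degree f"
  using pole_order_monom[of 1 1] by (simp add: monom_altdef)

lemma Stab_unit:
  assumes "\<sigma> \<in> Stab" "u \<in> infty.units"
  shows "\<sigma> u \<in> infty.units"
proof -
  have P: "\<sigma> ` point_infty f = point_infty f" using assms by (simp add: Stab_iff)
  note s = Aut_curve_props[OF Stab_Aut[OF assms(1)]]
  have uK: "u \<in> K" using assms(2) by (rule infty.units_closed)
  have u: "u \<in> point_infty f" "inverse u \<in> point_infty f" "u \<noteq> 0"
    using assms(2) by (auto simp: infty.units_def)
  have "\<sigma> u \<in> \<sigma> ` point_infty f" "\<sigma> (inverse u) \<in> \<sigma> ` point_infty f" using u by blast+
  moreover have "\<sigma> u \<noteq> 0" using s(10)[OF uK infty.K_closed(1)] u(3) s(5) by auto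
  ultimately show ?thesis using P s(9)[OF uK] by (simp add: infty.units_def)
qed

text \<open>The image of the unit \<open>ev Q ^ p / x ^ d\<close> is again a unit. Replacing
  \<open>ev Q'\<close> and \<open>ev X'\<close> by their orders turns its \<open>p\<close>-th power
  into a quotient of two powers of \<open>x\<close>, and such a quotient is a unit only for equal
  exponents.\<close>

lemma Stab_pole_order:
  assumes \<sigma>: "\<sigma> \<in> Stab" and Q: "Q \<noteq> 0" "degree Q < p" "\<sigma> (ev Q) = ev Q'" "degree Q' < p"
    and X: "\<sigma> x = ev X'" "degree X' < p"
  shows "p * pole_order Q' = pole_order X' * pole_order Q"
proof -
  note s = Aut_curve_props[OF Stab_Aut[OF \<sigma>]]
  note u = infty.units_closed
  let ?d = "pole_order Q" and ?d' = "pole_order Q'" and ?e = "pole_order X'"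
  have nz: "\<sigma> a \<noteq> 0" if "a \<in> K" "a \<noteq> 0" for a
    using s(10)[OF that(1) infty.K_closed(1)] that(2) s(5) by auto
  have "ev Q \<noteq> 0" using Q infty.ev_neq_0 by blast
  hence Q'0: "ev Q' \<noteq> 0" "Q' \<noteq> 0" using nz[of "ev Q"] Q(3) by auto
  have X'0: "ev X' \<noteq> 0" "X' \<noteq> 0" using nz[of x] X(1) by auto
  define A where "A = ev Q' ^ p / x ^ ?d'"
  define B where "B = ev X' ^ p / x ^ ?e"
  define C where "C = ev Q' ^ p / ev X' ^ ?d"
  have A: "A \<in> infty.units" unfolding A_def using Q'0 Q by (intro infty.ev_unit)
  have B: "B \<in> infty.units" unfolding B_def using X'0 X by (intro infty.ev_unit)
  have "\<sigma> (ev Q ^ p / x ^ ?d) \<in> infty.units"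
    by (rule Stab_unit[OF \<sigma> infty.ev_unit[OF Q(1,2)]])
  hence C: "C \<in> infty.units"
    by (simp add: C_def s(12) s(8) infty.K_closed(7) Q(3) X(1))
  have "C ^ p * B ^ ?d / A ^ p \<in> infty.units"
    by (intro u(5) u(2) u(4) A B C)
  also have "C ^ p * B ^ ?d / A ^ p = x ^ (p * ?d') / x ^ (?e * ?d)"
    using Q'0 X'0 infty.x_neq_0
    by (simp add: A_def B_def C_def power_divide field_simps flip: power_mult)
  finally have e: "x ^ (p * ?d') / x ^ (?e * ?d) \<in> infty.units" .
  have "p * ?d' \<le> ?e * ?d" using u(8)[OF e] by (simp only: infty.x_power_quot_iff)
  moreover have "?e * ?d \<le> p * ?d'"
    using u(8)[OF u(3)[OF e]] by (simp only: inverse_divide infty.x_power_quot_iff)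
  ultimately show ?thesis by simp
qed

text \<open>Because \<open>p\<close> and \<open>degree f\<close> are coprime, the pole orders of
  \<open>x\<close> and \<open>w\<close> are multiplied by a common integer factor \<open>e\<close>.
  The inverse automorphism has a factor \<open>e'\<close> as well, and
  \<open>e * e' = 1\<close>.\<close>

lemma Stab_pole_order_generators:
  assumes \<sigma>: "\<sigma> \<in> Stab"
  obtains X' W' where "\<sigma> x = ev X'" "degree X' < p" "pole_order X' = p"
    "\<sigma> w = ev W'" "degree W' < p" "pole_order W' = degree f"
proof -
  have p0: "degree [:[:0, 1::'k:]:] < p" "degree [:0, 1::'k poly:] < p" using p_gt_1 by simp_all
  have ex: "\<exists>X' W' e. \<tau> x = ev X' \<and> degree X' < p \<and> pole_order X' = p * e \<and>
      \<tau> w = ev W' \<and> degree W' < p \<and> pole_order W' = degree f * e" if \<tau>: "\<tau> \<in> Stab" for \<tau>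
  proof -
    obtain X' where X': "\<tau> (ev [:[:0, 1:]:]) = ev X'" "degree X' < p"
      using stabilizer_ev \<tau> unfolding Stab_iff by metis
    obtain W' where W': "\<tau> (ev [:0, 1:]) = ev W'" "degree W' < p"
      using stabilizer_ev \<tau> unfolding Stab_iff by metis
    have eq: "p * pole_order W' = pole_order X' * degree f"
      using Stab_pole_order[OF \<tau> _ p0(2) W'] X' by (simp add: pole_order_W)
    hence "p dvd pole_order X' * degree f" by (metis dvd_triv_left)
    hence "p dvd pole_order X'"
      using coprime_deg by (simp add: coprime_commute coprime_dvd_mult_left_iff)
    then obtain e where e: "pole_order X' = p * e" ..
    hence "pole_order W' = degree f * e" using eq p_pos by simp
    thus ?thesis using X' W' e by auto
  qed
  obtain X' W' e where e: "\<sigma> x = ev X'" "degree X' < p" "pole_order X' = p * e"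
    "\<sigma> w = ev W'" "degree W' < p" "pole_order W' = degree f * e" using ex[OF \<sigma>] by blast
  let ?t = "\<lambda>z\<in>K. inv_into K \<sigma> z"
  obtain X'' W'' e' where e': "?t x = ev X''" "degree X'' < p" "pole_order X'' = p * e'"
    using ex[OF inverse_in_Stab[OF \<sigma>]] by blast
  note s = Aut_curve_props[OF Stab_Aut[OF \<sigma>]]
  have sx: "\<sigma> (ev X'') = ev [:[:0, 1:]:]"
    using s(11) by (simp flip: e'(1)) (simp add: f_inv_into_f)
  have "X'' \<noteq> 0" using sx s(5) by auto
  from Stab_pole_order[OF \<sigma> this e'(2) sx p0(1) e(1,2)]
  have "p * p = (p * e) * (p * e')" unfolding pole_order_X e(3) e'(3) .
  hence "e * e' = 1" using p_pos by simp
  hence "e = 1" by simp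
  thus thesis using that e by simp
qed

lemma Stab_emb:
  assumes "\<sigma> \<in> Stab" "\<sigma> x = ev X'"
  shows "\<sigma> (emb a) = ev (pcompose (map_poly (\<lambda>c. [:c:]) a) X')"
proof (induction a)
  case 0
  show ?case using Aut_curve_props(5)[OF Stab_Aut[OF assms(1)]] by simp
next
  case (pCons c a)
  note s = Aut_curve_props[OF Stab_Aut[OF assms(1)]]
  have "emb (pCons c a) = emb ([:c:] + [:0, 1:] * a)" by simp
  also have "\<dots> = emb [:c:] + x * emb a" by (simp only: emb_simps)
  finally have "\<sigma> (emb (pCons c a)) = emb [:c:] + \<sigma> x * \<sigma> (emb a)"
    using s(2)[of "emb [:c:]" "x * emb a"] s(3)[of x "emb a"] s(4) infty.K_closed(6)[of x "emb a"] by simp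
  thus ?case by (simp add: pCons.IH assms(2) map_poly_pCons pcompose_pCons)
qed

lemma emb_of_nat: "emb (of_nat n :: 'k poly) = of_nat n"
  by (induction n) simp_all

text \<open>The pole orders of the images leave little room: the image of \<open>w\<close> is linear
  in \<open>w\<close> with constant leading coefficient. For \<open>x\<close> they suffice only up
  to the possibility \<open>degree f < p\<close>, which is settled by the relation
  \<open>w^p - w = f(x)\<close>.\<close>

lemma Stab_form:
  assumes \<sigma>: "\<sigma> \<in> Stab"
  obtains a b c P where "a \<noteq> 0" "\<sigma> x = emb [:b, a:]" "\<sigma> w = ev [:P, [:c:]:]"
    "c ^ p = c" "a ^ degree f = c" "P ^ p - P = pcompose f [:b, a:] - smult c f"
proof -
  obtain X' W' where X: "\<sigma> x = ev X'" "degree X' < p" "pole_order X' = p"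
    and W: "\<sigma> w = ev W'" "degree W' < p" "pole_order W' = degree f"
    by (rule Stab_pole_order_generators[OF \<sigma>])
  note s = Aut_curve_props[OF Stab_Aut[OF \<sigma>]]
  let ?m = "degree f"
  have nd: "\<not> p dvd ?m" and nd': "\<not> ?m dvd p"
    using coprime_common_divisor[OF coprime_deg, of p] coprime_common_divisor[OF coprime_deg, of ?m]
      p_gt_1 deg_ge_2 by auto
  have W'0: "W' \<noteq> 0" using W(3) deg_ge_2 s(5) s(10)[of w 0] W(1) infty.K_closed(1) infty.w_unit infty.units_closed(7)
    p_pos by (metis div_by_0 divide_eq_0_iff ev_0 w_in_K zero_power)
  have X'0: "X' \<noteq> 0" using s(5) s(10)[of x 0] X(1) infty.K_closed(1) by auto
  have Wj: "p * degree (coeff W' j) + ?m * j \<le> ?m" if "coeff W' j \<noteq> 0" for j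
    using pole_order_ge[OF that] W(3) by simp
  have Xj: "p * degree (coeff X' j) + ?m * j \<le> p" if "coeff X' j \<noteq> 0" for j
    using pole_order_ge[OF that] X(3) by simp
  have W2: "coeff W' j = 0" if "j \<ge> 2" for j
  proof (rule ccontr)
    assume "coeff W' j \<noteq> 0"
    from Wj[OF this] have "?m * j \<le> ?m" by linarith
    thus False using that deg_ge_2 by simp
  qed
  obtain P c' where W': "W' = [:P, c':]"
  proof -
    have "W' = [:coeff W' 0, coeff W' 1:]"
      by (rule poly_eqI) (auto simp: coeff_pCons W2 split: nat.splits)
    thus thesis using that by blast
  qed
  have c'0: "c' \<noteq> 0"
  proof
    assume "c' = 0"
    hence "W' = monom P 0" "P \<noteq> 0" using W' W'0 by (simp_all add: monom_0)
    hence "pole_order W' = p * degree P" using pole_order_monom[of P 0] by simp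
    thus False using W(3) nd by auto
  qed
  have "degree c' = 0" using Wj[of 1] c'0 p_pos by (simp add: W')
  then obtain c where c: "c' = [:c:]" by (auto elim: degree_eq_zeroE)
  \<comment> \<open>Equality is excluded since \<open>p\<close> does not divide
    \<open>degree f\<close>. Thus \<open>P^p\<close> does not reach the leading term of
    \<open>f\<close>, and comparing these terms at the end yields
    \<open>a ^ degree f = c\<close>.\<close>
  have degP: "p * degree P < ?m"
  proof (cases "P = 0")
    case False
    hence "p * degree P \<le> ?m" using Wj[of 0] by (simp add: W')
    moreover have "p * degree P \<noteq> ?m" using nd dvd_triv_left[of p "degree P"] by metis
    ultimately show ?thesis by simp
  qed (use deg_ge_2 in simp)
  have wp: "\<sigma> (emb f) = ev [:P ^ p - P + smult (c ^ p) f, [:c ^ p - c:]:]"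
  proof -
    have "\<sigma> (emb f) = \<sigma> (w ^ p - w)" by (simp add: w_eq)
    also have "\<dots> = ev W' ^ p - ev W'" using W(1) s(7)[of "w ^ p" w] s(8)[of w p] infty.K_closed(7)[of w p] by simp
    also have "ev W' ^ p = (emb P + emb [:c:] * w) ^ p" by (simp add: W' c ev_pCons mult.commute)
    also have "\<dots> = emb P ^ p + (emb [:c:] * w) ^ p"
    proof (rule freshmans_dream)
      have "CHAR('k closure_kX) = p"
      proof (rule CHAR_eqI)
        show "of_nat p = (0 :: 'k closure_kX)"
          using emb_of_nat[of p] p_eq by (metis emb_simps(1) of_nat_CHAR semiring_char_poly)
        show "p dvd n" if "of_nat n = (0 :: 'k closure_kX)" for n
          using that emb_of_nat[of n] p_eq
          by (metis emb_simps(9) of_nat_eq_0_iff_char_dvd semiring_char_poly)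
      qed
      thus "p = CHAR('k closure_kX)" "Factorial_Ring.prime CHAR('k closure_kX)" using p_prime by simp_all
    qed
    also have "\<dots> = emb (P ^ p) + emb ([:c:] ^ p) * (w + emb f)"
      by (simp add: power_mult_distrib w_eq)
    also have "[:c:] ^ p = [:c ^ p:]" by (simp add: poly_const_pow)
    also have "emb (P ^ p) + emb [:c ^ p:] * (w + emb f) - ev W'
      = emb (P ^ p - P + [:c ^ p:] * f) + w * emb ([:c ^ p:] - [:c:])"
      by (simp only: W' c ev_pCons ev_const ev_0 emb_simps) (simp add: algebra_simps)
    also have "\<dots> = ev [:P ^ p - P + smult (c ^ p) f, [:c ^ p - c:]:]"
      by (simp add: ev_pCons)
    finally show ?thesis .
  qed
  have deg_wp: "degree [:P ^ p - P + smult (c ^ p) f, [:c ^ p - c:]:] \<le> 1"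
    by (simp add: degree_pCons_le)
  \<comment> \<open>If \<open>w\<close> occurred in the image of \<open>x\<close>, then the image of
    \<open>f(x)\<close> would have degree \<open>?m * degree X'\<close> in \<open>w\<close>. This is
    below \<open>p\<close>, so it can be compared with the degree at most 1 found in
    \<open>wp\<close>.\<close>
  have "degree X' = 0"
  proof (rule ccontr)
    assume d: "degree X' \<noteq> 0"
    let ?F = "pcompose (map_poly (\<lambda>c. [:c:]) f) X'"
    have "?m * degree X' \<le> p" using Xj[of "degree X'"] X'0 by simp
    moreover have "?m * degree X' \<noteq> p" using nd' dvd_triv_left[of ?m "degree X'"] by metis
    moreover have dF: "degree ?F = ?m * degree X'"
      by (simp add: degree_pcompose degree_map_poly)
    ultimately have "degree ?F < p" by simp
    moreover have "ev ?F = ev [:P ^ p - P + smult (c ^ p) f, [:c ^ p - c:]:]"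
      using Stab_emb[OF \<sigma> X(1), of f] wp by simp
    ultimately have "?F = [:P ^ p - P + smult (c ^ p) f, [:c ^ p - c:]:]"
      using deg_wp p_gt_1 by (intro ev_inj) auto
    hence "?m * degree X' \<le> 1" using deg_wp dF by simp
    thus False using d deg_ge_2 mult_le_mono[of 2 ?m 1 "degree X'"] by simp
  qed
  then obtain q where q: "X' = [:q:]" by (auto elim: degree_eq_zeroE)
  have q0: "q \<noteq> 0" using X'0 q by auto
  have "degree q = 1"
    using pole_order_monom[OF q0, of 0] X(3) p_pos by (simp add: q monom_0)
  obtain b a where ab: "q = [:b, a:]" "a \<noteq> 0"
  proof -
    obtain b r where r: "q = pCons b r" by (cases q)
    with \<open>degree q = 1\<close> have "r \<noteq> 0" "degree r = 0" by (auto split: if_splits)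
    thus thesis using that r by (auto elim: degree_eq_zeroE)
  qed
  have sx: "\<sigma> x = emb [:b, a:]" using X(1) q ab by simp
  have "pcompose (map_poly (\<lambda>c. [:c:]) f) [:[:b, a:]:] = [:pcompose f [:b, a:]:]"
    by (induction f) (simp_all add: map_poly_pCons pcompose_pCons)
  hence "ev [:pcompose f [:b, a:]:] = ev [:P ^ p - P + smult (c ^ p) f, [:c ^ p - c:]:]"
    using Stab_emb[OF \<sigma> X(1), of f] wp by (simp add: q ab)
  hence "[:pcompose f [:b, a:]:] = [:P ^ p - P + smult (c ^ p) f, [:c ^ p - c:]:]"
    using deg_wp p_gt_1 by (intro ev_inj) auto
  hence cp: "c ^ p = c" and rel: "pcompose f [:b, a:] = P ^ p - P + smult c f" by auto
  have "coeff (pcompose f [:b, a:]) ?m = lead_coeff f * a ^ ?m"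
    using lead_coeff_comp[of "[:b, a:]" f] ab(2) by (simp add: degree_pcompose)
  moreover have "coeff (P ^ p) ?m = 0" "coeff P ?m = 0"
    using degP degree_power_le[of P p] p_pos
    by (auto intro!: coeff_eq_0 intro: le_less_trans[of _ "p * degree P"] simp: mult.commute)
  ultimately have "lead_coeff f * a ^ ?m = lead_coeff f * c" by (auto simp: rel)
  moreover have "lead_coeff f \<noteq> 0" using deg_ge_2 by auto
  ultimately have "a ^ ?m = c" by simp
  thus thesis using that ab(2) sx W(1) W' c cp rel by simp
qed

end

section \<open>The wild inertia group\<close>

lemma prime_power_if_unique_prime_factor:
  fixes n p :: nat
  assumes "n > 0" "Factorial_Ring.prime p" "\<And>q. Factorial_Ring.prime q \<Longrightarrow> q dvd n \<Longrightarrow> q = p"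
  obtains v where "n = p ^ v"
proof -
  have "p \<noteq> Suc 0" using prime_gt_1_nat[OF assms(2)] by simp
  then obtain m where m: "n = p ^ multiplicity p n * m" "\<not> p dvd m"
    using multiplicity_decompose'[of n p] assms(1) by auto
  have "m = 1"
  proof (rule ccontr)
    assume "m \<noteq> 1"
    then obtain q where "Factorial_Ring.prime q" "q dvd m" using prime_factor_nat by blast
    moreover from this have "q = p" using assms(3) m(1) by (metis dvd_mult)
    ultimately show False using m(2) by simp
  qed
  thus thesis using m(1) that by simp
qed

text \<open>For a prime \<open>q\<close> dividing the order, Sylow's theorem gives a subgroup of
  order \<open>q\<close>; a nonzero element \<open>h\<close> of it satisfies \<open>q h = 0\<close>,
  so \<open>q\<close> is the characteristic.\<close>

lemma card_additive_subgroup: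
  fixes V :: "'a::field set"
  assumes "CHAR('a) > 0" "finite V" "0 \<in> V" "\<And>a b. a \<in> V \<Longrightarrow> b \<in> V \<Longrightarrow> a + b \<in> V"
    "\<And>a. a \<in> V \<Longrightarrow> - a \<in> V"
  obtains v where "card V = CHAR('a) ^ v"
proof -
  define G :: "'a monoid" where "G = \<lparr>carrier = V, monoid.mult = (+), one = 0\<rparr>"
  have [simp]: "carrier G = V" "a \<otimes>\<^bsub>G\<^esub> b = a + b" "\<one>\<^bsub>G\<^esub> = 0" for a b :: 'a
    by (simp_all add: G_def)
  have p: "Factorial_Ring.prime CHAR('a)" using prime_CHAR_semidom assms(1) by blast
  interpret group G
    by (rule groupI) (use assms in \<open>auto simp: add.assoc intro: bexI[of _ "- _"]\<close>)
  have pow: "a [^]\<^bsub>G\<^esub> n = of_nat n * a" for a and n :: nat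
    by (induction n) (simp_all add: algebra_simps)
  have uniq: "q = CHAR('a)" if q: "Factorial_Ring.prime q" "q dvd card V" for q
  proof -
    obtain d where d: "Coset.order G = q ^ 1 * d" using q(2) by (auto simp: Coset.order_def elim: dvdE)
    then obtain H where H: "subgroup H G" "card H = q ^ 1"
      using sylow_thm[OF q(1) is_group d] assms(2) by (auto simp del: power_one_right)
    have "H \<noteq> {0}" using H(2) prime_gt_1_nat[OF q(1)] by auto
    moreover have "0 \<in> H" using subgroup.one_closed[OF H(1)] by simp
    ultimately obtain h where h: "h \<in> H" "h \<noteq> 0" by blast
    interpret H: group "G\<lparr>carrier := H\<rparr>" by (rule subgroup.subgroup_is_group[OF H(1) is_group])
    have "finite H" using H(2) prime_gt_1_nat[OF q(1)] by (intro card_ge_0_finite) simp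
    hence "h [^]\<^bsub>G\<lparr>carrier := H\<rparr>\<^esub> Coset.order (G\<lparr>carrier := H\<rparr>) = 0"
      using H.pow_order_eq_1[of h] h(1) by simp
    moreover have "h [^]\<^bsub>G\<lparr>carrier := H\<rparr>\<^esub> n = h [^]\<^bsub>G\<^esub> n" for n :: nat
      by (simp add: nat_pow_def)
    ultimately have "of_nat q * h = 0" using H(2) by (simp add: pow Coset.order_def)
    hence "CHAR('a) dvd q" using h(2) by (simp add: of_nat_eq_0_iff_char_dvd)
    thus ?thesis using p q(1) by (metis primes_dvd_imp_eq)
  qed
  show thesis
    by (rule prime_power_if_unique_prime_factor[OF _ p uniq that])
      (use assms in \<open>auto simp: card_gt_0_iff\<close>)
qed

context artin_schreier
begin

definition V :: "'k set" where "V = {y. \<exists>P. admissible y P}"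

definition N :: "('k closure_kX \<Rightarrow> 'k closure_kX) set" where
  "N = {\<sigma> \<in> Stab. \<exists>b. \<sigma> x = emb [:b, 1:]}"

lemma Aut_eqI:
  assumes "\<sigma> \<in> carrier (Aut_curve f)" "\<tau> \<in> carrier (Aut_curve f)" "\<sigma> x = \<tau> x" "\<sigma> w = \<tau> w"
  shows "\<sigma> = \<tau>"
proof -
  note s = Aut_curve_props[OF assms(1)]
  note t = Aut_curve_props[OF assms(2)]
  note c = infty.K_closed
  have e: "\<sigma> (emb a) = \<tau> (emb a)" for a
  proof (induction a)
    case (pCons k a)
    have "emb (pCons k a) = emb ([:k:] + [:0, 1:] * a)" by simp
    also have "\<dots> = emb [:k:] + x * emb a" by (simp only: emb_simps)
    finally show ?case using pCons.IH assms(3) by (simp add: s(2,3,4) t(2,3,4) c)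
  qed (simp add: s t)
  have ev: "\<sigma> (ev Q) = \<tau> (ev Q)" for Q
    by (induction Q) (simp_all add: ev_pCons s(2,3,5) t(2,3,5) e assms(4) c)
  have "\<sigma> z = \<tau> z" if z: "z \<in> K" for z
  proof -
    obtain A B where "z = ev A / ev B" by (rule K_E[OF z])
    thus ?thesis using ev by (simp add: s(12) t(12))
  qed
  thus ?thesis using assms(1,2) by (intro extensionalityI[of _ K]) (auto simp: Aut_curve_iff)
qed

lemma subst_aut_generators:
  assumes "admissible y P"
  shows "subst_aut y P x = emb [:y, 1:]" "subst_aut y P w = w + emb P"
  using subst_aut_ev[OF assms, of "[:[:0, 1:]:]"] subst_aut_ev[OF assms, of "[:0, 1:]"]
  by (simp_all add: subst_const subst_W pcompose_pCons ev_pCons add.commute)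

lemma subst_aut_in_N:
  assumes "admissible y P"
  shows "subst_aut y P \<in> N"
proof -
  let ?s = "subst_aut y P"
  have A: "?s \<in> carrier (Aut_curve f)" by (rule subst_aut_in_Aut[OF assms])
  note s = Aut_curve_props[OF A]
  let ?R = "{z \<in> K. ?s z \<in> point_infty f}"
  have "x \<notin> ?R"
  proof
    assume "x \<in> ?R"
    hence "emb [:y, 1:] \<in> point_infty f" using subst_aut_generators(1)[OF assms] by simp
    moreover have "emb [:y:] \<in> point_infty f" using point_infty(1) by (simp add: curve_points_iff)
    ultimately have "emb [:y, 1:] - emb [:y:] \<in> point_infty f" by (rule infty.R_closed(5))
    thus False using point_infty(2) by (simp flip: emb_simps(5))
  qed
  hence R: "?R = point_infty f"
    by (intro point_infty_eqI preimage_curve_point[OF A] point_infty(1))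
  have "?s ` ?R = point_infty f"
  proof (intro equalityI subsetI)
    fix u assume "u \<in> point_infty f"
    moreover from this obtain z where "z \<in> K" "u = ?s z" using s(11) point_infty_subset_K by blast
    ultimately show "u \<in> ?s ` ?R" by blast
  qed auto
  thus ?thesis using A subst_aut_generators(1)[OF assms] R by (auto simp: N_def Stab_iff)
qed

lemma N_cases:
  assumes "\<sigma> \<in> N"
  obtains y P where "admissible y P" "\<sigma> = subst_aut y P"
proof -
  have \<sigma>: "\<sigma> \<in> Stab" using assms by (simp add: N_def)
  obtain b' where b': "\<sigma> x = emb [:b', 1:]" using assms by (auto simp: N_def)
  obtain a b c P where F: "a \<noteq> 0" "\<sigma> x = emb [:b, a:]" "\<sigma> w = ev [:P, [:c:]:]"
    "c ^ p = c" "a ^ degree f = c" "P ^ p - P = pcompose f [:b, a:] - smult c f"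
    by (rule Stab_form[OF \<sigma>])
  have "a = 1" using b' F(2) by (simp only: emb_simps pCons_eq_iff)
  hence c: "c = 1" using F(5) by simp
  have adm: "admissible b P" using F(6) \<open>a = 1\<close> c by (simp add: admissible_def)
  have "\<sigma> = subst_aut b P"
  proof (rule Aut_eqI[OF Stab_Aut[OF \<sigma>] subst_aut_in_Aut[OF adm]])
    show "\<sigma> x = subst_aut b P x" using F(2) \<open>a = 1\<close> subst_aut_generators(1)[OF adm] by simp
    show "\<sigma> w = subst_aut b P w"
      using F(3) c subst_aut_generators(2)[OF adm] by (simp add: ev_pCons add.commute flip: one_pCons)
  qed
  thus thesis using that adm by blast
qed

text \<open>Two lifts of the same translation differ by a solution of \<open>Q^p = Q\<close>. In the
  domain \<open>k[X]\<close> there are at most \<open>p\<close> of these, and the prime field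
  already provides \<open>p\<close>.\<close>

lemma card_AS_fiber:
  assumes "admissible y P0"
  shows "card {P. admissible y P} = p" "finite {P. admissible y P}"
proof -
  let ?g = "monom 1 p - monom 1 1 :: 'k poly poly"
  let ?F = "{Q :: 'k poly. Q ^ p = Q}"
  have g: "degree ?g = p"
    using p_gt_1 by (subst diff_conv_add_uminus, subst degree_add_eq_left) (auto simp: degree_monom_eq)
  hence g0: "?g \<noteq> 0" using p_pos by auto
  have F: "?F = {Q. poly ?g Q = 0}" by (simp add: poly_monom)
  have fin: "finite ?F" unfolding F using poly_roots_finite[OF g0] .
  have le: "card ?F \<le> p" unfolding F using card_poly_roots_bound[OF g0] g by simp
  have sub: "of_nat ` {..<p} \<subseteq> ?F" by (auto simp: of_nat_power_p)
  have "inj_on (of_nat :: nat \<Rightarrow> 'k poly) {..<p}"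
  proof (rule inj_onI)
    have *: "i = j" if "i \<le> j" "j < p" "(of_nat i :: 'k poly) = of_nat j" for i j
    proof (rule ccontr)
      assume "i \<noteq> j"
      have "(of_nat (j - i) :: 'k poly) = 0" using that by (simp add: of_nat_diff)
      hence "p dvd j - i" by (simp add: of_nat_eq_0_iff_char_dvd p_eq)
      thus False using \<open>i \<noteq> j\<close> that dvd_imp_le[of p "j - i"] by simp
    qed
    fix i j assume "i \<in> {..<p}" "j \<in> {..<p}" "(of_nat i :: 'k poly) = of_nat j"
    thus "i = j" using *[of i j] *[of j i] by (cases "i \<le> j") auto
  qed
  hence "card ((of_nat :: nat \<Rightarrow> 'k poly) ` {..<p}) = p" by (simp add: card_image)
  hence cF: "card ?F = p" using card_mono[OF fin sub] le by simp
  have eq: "{P. admissible y P} = (\<lambda>Q. P0 + Q) ` ?F"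
  proof (intro equalityI subsetI)
    fix P assume "P \<in> {P. admissible y P}"
    hence "P ^ p - P = P0 ^ p - P0" using assms by (simp add: admissible_def)
    moreover have "(P - P0 + P0) ^ p = (P - P0) ^ p + P0 ^ p"
      by (rule freshmans_dream[OF prime_char_poly]) (simp add: p_eq)
    ultimately have "(P - P0) ^ p = P - P0" by (simp add: algebra_simps)
    thus "P \<in> (\<lambda>Q. P0 + Q) ` ?F" by (intro image_eqI[of _ _ "P - P0"]) auto
  next
    fix P assume "P \<in> (\<lambda>Q. P0 + Q) ` ?F"
    then obtain Q where Q: "P = P0 + Q" "Q ^ p = Q" by blast
    moreover have "(P0 + Q) ^ p = P0 ^ p + Q ^ p"
      by (rule freshmans_dream[OF prime_char_poly]) (simp add: p_eq)
    ultimately show "P \<in> {P. admissible y P}" using assms by (simp add: admissible_def)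
  qed
  show "card {P. admissible y P} = p" unfolding eq using cF by (simp add: card_image)
  show "finite {P. admissible y P}" unfolding eq using fin by simp
qed

lemma card_N:
  assumes "finite V"
  shows "card N = p * card V" "finite N"
proof -
  let ?S = "Sigma V (\<lambda>y. {P. admissible y P})"
  have fib: "card {P. admissible y P} = p" "finite {P. admissible y P}" if "y \<in> V" for y
    using that card_AS_fiber by (auto simp: V_def)
  have "bij_betw (\<lambda>(y, P). subst_aut y P) ?S N"
  proof (rule bij_betw_imageI)
    show "inj_on (\<lambda>(y, P). subst_aut y P) ?S"
    proof (rule inj_onI, clarify)
      fix y P z R assume "admissible y P" "admissible z R" "subst_aut y P = subst_aut z R"
      hence "emb [:y, 1:] = emb [:z, 1:]" "emb P = emb R"
        using subst_aut_generators[of y P] subst_aut_generators[of z R] by auto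
      thus "y = z \<and> P = R" by simp
    qed
    show "(\<lambda>(y, P). subst_aut y P) ` ?S = N"
      by (auto simp: V_def subst_aut_in_N image_iff elim!: N_cases)
  qed
  hence "card N = card ?S" "finite N \<longleftrightarrow> finite ?S"
    by (auto dest: bij_betw_same_card bij_betw_finite)
  moreover have "card ?S = p * card V" using assms fib by (simp add: card_SigmaI)
  moreover have "finite ?S" using assms fib by (intro finite_SigmaI) auto
  ultimately show "card N = p * card V" "finite N" by simp_all
qed

lemma V_closed: "0 \<in> V" "y \<in> V \<Longrightarrow> z \<in> V \<Longrightarrow> y + z \<in> V" "y \<in> V \<Longrightarrow> - y \<in> V"
proof -
  have "admissible 0 0" by (simp add: admissible_def zero_power p_pos)
  thus "0 \<in> V" by (auto simp: V_def)
qed (auto simp: V_def intro: admissible_compose admissible_inverse)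

lemma card_V: "finite V \<Longrightarrow> \<exists>v. card V = p ^ v"
  using card_additive_subgroup[of V] V_closed p_pos p_eq by metis

lemma compose_x:
  assumes "\<sigma> \<in> Stab" "\<tau> \<in> Stab" "\<sigma> x = emb [:b, a:]" "\<tau> x = emb [:b', a':]"
  shows "\<exists>b''. compose K \<sigma> \<tau> x = emb [:b'', a * a':]"
proof -
  note s = Aut_curve_props[OF Stab_Aut[OF assms(1)]]
  have "emb [:b', a':] = emb ([:b':] + [:a':] * [:0, 1:])" by simp
  hence "emb [:b', a':] = emb [:b':] + emb [:a':] * x" by (simp only: emb_simps)
  hence "compose K \<sigma> \<tau> x = emb [:b':] + emb [:a':] * emb [:b, a:]"
    by (simp add: compose_eq assms s infty.K_closed)
  also have "\<dots> = emb ([:b':] + [:a':] * [:b, a:])" by (simp only: emb_simps)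
  also have "[:b':] + [:a':] * [:b, a:] = [:b' + a' * b, a * a':]" by (simp add: mult.commute)
  finally show ?thesis by blast
qed

text \<open>Sylow's theorem asks for a finite group. The scaling factor \<open>a\<close> satisfies
  \<open>c = a^m\<close>, \<open>c^p = c\<close> with \<open>m = degree f\<close>, which leaves
  finitely many values; composing with the inverse of one element embeds each fibre into
  \<open>N\<close>.\<close>

lemma finite_Stab:
  assumes "finite V"
  shows "finite Stab"
proof -
  interpret G: group "stabilizer_infty f" by (rule group_stabilizer)
  define A where "A = {a :: 'k. a \<noteq> 0 \<and> a ^ (degree f * p) = a ^ degree f}"
  define fib where "fib a = {\<sigma> \<in> Stab. \<exists>b. \<sigma> x = emb [:b, a:]}" for a
  have "finite A"
  proof -
    let ?g = "monom 1 (degree f * p) - monom 1 (degree f) :: 'k poly"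
    have "coeff ?g (degree f * p) = 1" using p_gt_1 deg_ge_2 by simp
    hence "?g \<noteq> 0" by (metis coeff_0 zero_neq_one)
    hence "finite {a. poly ?g a = 0}" by (rule poly_roots_finite)
    thus ?thesis by (rule rev_finite_subset) (auto simp: A_def poly_monom)
  qed
  moreover have "Stab \<subseteq> (\<Union>a\<in>A. fib a)"
  proof
    fix \<sigma> assume \<sigma>: "\<sigma> \<in> Stab"
    obtain a b c P where F: "a \<noteq> 0" "\<sigma> x = emb [:b, a:]" "\<sigma> w = ev [:P, [:c:]:]"
      "c ^ p = c" "a ^ degree f = c" "P ^ p - P = pcompose f [:b, a:] - smult c f"
      by (rule Stab_form[OF \<sigma>])
    have "a \<in> A" using F(1,4,5) by (simp add: A_def power_mult)
    thus "\<sigma> \<in> (\<Union>a\<in>A. fib a)" using \<sigma> F(2) by (auto simp: fib_def)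
  qed
  moreover have "finite (fib a)" if "a \<in> A" for a
  proof (cases "fib a = {}")
    case False
    then obtain s0 b0 where s0: "s0 \<in> Stab" "s0 x = emb [:b0, a:]" by (auto simp: fib_def)
    let ?G = "stabilizer_infty f"
    let ?t = "inv\<^bsub>?G\<^esub> s0"
    have t: "?t \<in> Stab" using s0(1) by simp
    obtain a' b' c P where F: "a' \<noteq> 0" "?t x = emb [:b', a':]" "?t w = ev [:P, [:c:]:]"
      "c ^ p = c" "a' ^ degree f = c" "P ^ p - P = pcompose f [:b', a':] - smult c f"
      by (rule Stab_form[OF t])
    have "compose K ?t s0 x = x"
      using G.l_inv[OF s0(1)] by (simp add: mult_stabilizer t s0(1) one_stabilizer)
    moreover obtain b'' where "compose K ?t s0 x = emb [:b'', a' * a:]"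
      using compose_x[OF t s0(1) F(2) s0(2)] by blast
    ultimately have aa: "a' * a = 1" by (metis emb_simps(8) pCons_eq_iff)
    have "(\<lambda>\<sigma>. ?t \<otimes>\<^bsub>?G\<^esub> \<sigma>) ` fib a \<subseteq> N"
    proof safe
      fix \<sigma> assume "\<sigma> \<in> fib a"
      then obtain b where s: "\<sigma> \<in> Stab" "\<sigma> x = emb [:b, a:]" by (auto simp: fib_def)
      have "?t \<otimes>\<^bsub>?G\<^esub> \<sigma> \<in> Stab" using t s(1) by (rule G.m_closed)
      moreover have "\<exists>b''. (?t \<otimes>\<^bsub>?G\<^esub> \<sigma>) x = emb [:b'', 1:]"
        using compose_x[OF t s(1) F(2) s(2)] by (simp add: mult_stabilizer t s(1) aa)
      ultimately show "?t \<otimes>\<^bsub>?G\<^esub> \<sigma> \<in> N" by (simp add: N_def)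
    qed
    moreover have "inj_on (\<lambda>\<sigma>. ?t \<otimes>\<^bsub>?G\<^esub> \<sigma>) (fib a)"
      using t by (auto simp: inj_on_def fib_def)
    ultimately show ?thesis using card_N(2)[OF assms] inj_on_finite by blast
  qed simp
  ultimately show ?thesis by (meson finite_UN finite_subset)
qed

lemma pow_x:
  assumes "\<sigma> \<in> Stab" "\<sigma> x = emb [:b, a:]"
  shows "\<exists>b'. (\<sigma> [^]\<^bsub>stabilizer_infty f\<^esub> (n::nat)) x = emb [:b', a ^ n:]"
proof (induction n)
  interpret G: group "stabilizer_infty f" by (rule group_stabilizer)
  case 0
  show ?case by (intro exI[of _ 0]) (simp add: one_stabilizer)
next
  interpret G: group "stabilizer_infty f" by (rule group_stabilizer)
  case (Suc n)
  then obtain b' where b': "(\<sigma> [^]\<^bsub>stabilizer_infty f\<^esub> n) x = emb [:b', a ^ n:]" by blast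
  have s: "\<sigma> [^]\<^bsub>stabilizer_infty f\<^esub> n \<in> Stab" using assms(1) by simp
  show ?case
    using compose_x[OF s assms(1) b' assms(2)] by (simp add: mult_stabilizer s assms(1) mult.commute)
qed

lemma p_power_root_of_unity:
  assumes "(a::'k) ^ (p ^ k) = 1"
  shows "a = 1"
proof -
  have "(a - 1 + 1) ^ (p ^ k) = (a - 1) ^ (p ^ k) + 1 ^ (p ^ k)"
    by (rule freshmans_dream') (use p_prime p_eq in auto)
  hence "(a - 1) ^ (p ^ k) = 0" using assms by simp
  thus ?thesis by simp
qed

lemma subgroup_N: "subgroup N (stabilizer_infty f)"
proof -
  interpret G: group "stabilizer_infty f" by (rule group_stabilizer)
  show ?thesis
  proof (rule G.subgroupI)
    show "N \<subseteq> Stab" by (auto simp: N_def)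
    have "(\<lambda>z\<in>K. z) \<in> N" using one_in_Stab by (auto simp: N_def)
    thus "N \<noteq> {}" by blast
    fix \<sigma> assume "\<sigma> \<in> N"
    then obtain b where s: "\<sigma> \<in> Stab" "\<sigma> x = emb [:b, 1:]" by (auto simp: N_def)
    let ?t = "inv\<^bsub>stabilizer_infty f\<^esub> \<sigma>"
    have t: "?t \<in> Stab" using s(1) by simp
    obtain a' b' c P where F: "a' \<noteq> 0" "?t x = emb [:b', a':]" "?t w = ev [:P, [:c:]:]"
      "c ^ p = c" "a' ^ degree f = c" "P ^ p - P = pcompose f [:b', a':] - smult c f"
      by (rule Stab_form[OF t])
    have "compose K ?t \<sigma> x = x"
      using G.l_inv[OF s(1)] by (simp add: mult_stabilizer t s(1) one_stabilizer)
    moreover obtain b'' where "compose K ?t \<sigma> x = emb [:b'', a' * 1:]"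
      using compose_x[OF t s(1) F(2) s(2)] by blast
    ultimately have "a' = 1" by (metis emb_simps(8) pCons_eq_iff mult_1_right)
    thus "?t \<in> N" using t F(2) by (auto simp: N_def)
    fix \<tau> assume "\<tau> \<in> N"
    then obtain b' where t: "\<tau> \<in> Stab" "\<tau> x = emb [:b', 1:]" by (auto simp: N_def)
    show "\<sigma> \<otimes>\<^bsub>stabilizer_infty f\<^esub> \<tau> \<in> N"
      using compose_x[OF s(1) t(1) s(2) t(2)] compose_in_Stab[OF s(1) t(1)]
      by (simp add: N_def mult_stabilizer s t)
  qed
qed

text \<open>An element of \<open>p\<close>-power order has a scaling factor that is a
  \<open>p\<close>-power root of unity, hence 1. Every Sylow subgroup therefore lies in
  \<open>N\<close>, which itself has \<open>p\<close>-power order.\<close>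

theorem card_wild_inertia:
  assumes "finite V"
  shows "card (wild_inertia_infty f) = p * card V"
proof -
  let ?G = "stabilizer_infty f"
  interpret G: group ?G by (rule group_stabilizer)
  have fin: "finite Stab" by (rule finite_Stab[OF assms])
  define s where "s = multiplicity p (Coset.order ?G)"
  have order_pos: "Coset.order ?G > 0" using fin G.one_closed by (auto simp: Coset.order_def card_gt_0_iff)
  obtain v where v: "card V = p ^ v" using card_V[OF assms] by blast
  have cN: "card N = p ^ Suc v" using card_N(1)[OF assms] v by simp
  have "card N dvd Coset.order ?G" using G.lagrange[OF subgroup_N] by (metis dvd_triv_right)
  hence "Suc v \<le> s"
    unfolding s_def using cN order_pos p_prime by (metis power_dvd_iff_le_multiplicity not_prime_unit neq0_conv)
  have sub: "H \<subseteq> N" if H: "subgroup H ?G" "card H = p ^ s" for H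
  proof
    fix \<sigma> assume \<sigma>H: "\<sigma> \<in> H"
    have \<sigma>: "\<sigma> \<in> Stab" using subgroup.subset[OF H(1)] \<sigma>H by blast
    obtain a b c P where F: "a \<noteq> 0" "\<sigma> x = emb [:b, a:]" "\<sigma> w = ev [:P, [:c:]:]"
      "c ^ p = c" "a ^ degree f = c" "P ^ p - P = pcompose f [:b, a:] - smult c f"
      by (rule Stab_form[OF \<sigma>])
    interpret H: group "?G\<lparr>carrier := H\<rparr>" by (rule subgroup.subgroup_is_group[OF H(1) G.is_group])
    have "\<sigma> [^]\<^bsub>?G\<lparr>carrier := H\<rparr>\<^esub> Coset.order (?G\<lparr>carrier := H\<rparr>) = \<one>\<^bsub>?G\<lparr>carrier := H\<rparr>\<^esub>"
      using \<sigma>H by (intro H.pow_order_eq_1) simp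
    hence "\<sigma> [^]\<^bsub>?G\<^esub> (p ^ s) = \<one>\<^bsub>?G\<^esub>" using H(2) by (simp add: Coset.order_def nat_pow_def)
    hence "(\<sigma> [^]\<^bsub>?G\<^esub> (p ^ s)) x = x" by (simp add: one_stabilizer)
    then obtain b' where "emb [:b', a ^ (p ^ s):] = emb [:0, 1:]"
      using pow_x[OF \<sigma> F(2), of "p ^ s"] by metis
    hence "a ^ (p ^ s) = 1" by simp
    hence "a = 1" by (rule p_power_root_of_unity)
    thus "\<sigma> \<in> N" using \<sigma> F(2) by (auto simp: N_def)
  qed
  have eq: "H = N" if H: "subgroup H ?G" "card H = p ^ s" for H
  proof (rule card_subset_eq[OF card_N(2)[OF assms] sub[OF H]])
    have "p ^ s \<ge> p ^ Suc v" using \<open>Suc v \<le> s\<close> p_pos by (intro power_increasing) auto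
    thus "card H = card N"
      using card_mono[OF card_N(2)[OF assms] sub[OF H]] H(2) cN by simp
  qed
  obtain d where "Coset.order ?G = p ^ s * d" unfolding s_def by (metis multiplicity_dvd dvdE)
  then obtain H where "subgroup H ?G" "card H = p ^ s"
    using sylow_thm[OF p_prime G.is_group _ fin] by blast
  hence N: "subgroup N ?G" "card N = p ^ s" using eq by auto
  have "wild_inertia_infty f = N"
    unfolding wild_inertia_infty_def
  proof (rule the_equality)
    show "subgroup N ?G \<and> card N = CHAR('k) ^ multiplicity CHAR('k) (Coset.order ?G)"
      using N by (simp add: s_def p_eq)
    show "H = N" if "subgroup H ?G \<and> card H = CHAR('k) ^ multiplicity CHAR('k) (Coset.order ?G)" for H
      using that eq[of H] by (simp add: s_def p_eq)
  qed
  thus ?thesis using card_N(1)[OF assms] by simp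
qed

end

section \<open>The group of translations\<close>

lemma card_roots_separable:
  fixes q :: "'a::alg_closed_field poly"
  assumes "q \<noteq> 0" "\<And>a. poly q a = 0 \<Longrightarrow> poly (pderiv q) a \<noteq> 0"
  shows "card {a. poly q a = 0} = degree q"
  using assms
proof (induction "degree q" arbitrary: q)
  case 0
  then obtain c where "q = [:c:]" by (auto elim: degree_eq_zeroE)
  thus ?case using 0 by simp
next
  case (Suc d)
  then obtain \<alpha> where \<alpha>: "poly q \<alpha> = 0" using alg_closed_imp_poly_has_root[of q] by auto
  then obtain r where r: "q = [:- \<alpha>, 1:] * r" by (auto simp: poly_eq_0_iff_dvd elim: dvdE)
  have r0: "r \<noteq> 0" using Suc.prems(1) r by auto
  have d: "degree q = Suc (degree r)"
    unfolding r using r0 by (subst degree_mult_eq) auto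
  have pd: "poly (pderiv q) a = poly r a + (a - \<alpha>) * poly (pderiv r) a" for a
    unfolding r pderiv_mult by (simp add: pderiv_pCons algebra_simps)
  have r\<alpha>: "poly r \<alpha> \<noteq> 0" using Suc.prems(2)[OF \<alpha>] pd[of \<alpha>] by simp
  have "poly (pderiv r) a \<noteq> 0" if "poly r a = 0" for a
    using Suc.prems(2)[of a] that pd[of a] by (auto simp: r)
  hence "card {a. poly r a = 0} = degree r" using Suc.hyps d r0 by simp
  moreover have "{a. poly q a = 0} = insert \<alpha> {a. poly r a = 0}" unfolding r by auto
  ultimately show ?case using d r\<alpha> poly_roots_finite[OF r0] by simp
qed

lemma card_roots_double_zero:
  fixes q :: "'a::idom poly"
  assumes "q \<noteq> 0" "coeff q 0 = 0" "coeff q 1 = 0"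
  shows "card {a. poly q a = 0} < degree q"
proof -
  obtain c r where r: "q = pCons c r" by (cases q)
  obtain c' s where s: "r = pCons c' s" by (cases r)
  have q: "q = pCons 0 (pCons 0 s)" using assms(2,3) r s by simp
  have s0: "s \<noteq> 0" using assms(1) q by auto
  have "{a. poly q a = 0} = insert 0 {a. poly s a = 0}" by (auto simp: q)
  hence "card {a. poly q a = 0} \<le> Suc (card {a. poly s a = 0})"
    by (simp add: card_insert_le_m1 poly_roots_finite[OF s0] card_insert_if)
  also have "\<dots> \<le> Suc (degree s)" using card_poly_roots_bound[OF s0] by simp
  also have "\<dots> < degree q" using s0 by (simp add: q)
  finally show ?thesis .
qed

text \<open>In characteristic \<open>p\<close> the binomials are coefficients of
  \<open>(1 + X) (1 + X^q)^l\<close>, with \<open>l = 1\<close> in the second claim. For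
  \<open>q = 1\<close> the exponents \<open>q - 1\<close> and 0 coincide, whence the extra 1 in that
  case.\<close>

lemma of_nat_choose_prime_power_mult:
  fixes q :: nat
  assumes "Factorial_Ring.prime CHAR('a::idom)" "q = CHAR('a) ^ a" "l > 0"
  shows "(of_nat ((1 + l * q) choose q) :: 'a) = (if a = 0 then of_nat (1 + l) else of_nat l)"
    and "j \<notin> {0, 1, q, 1 + q} \<Longrightarrow> (of_nat ((1 + q) choose j) :: 'a) = 0"
proof -
  have q0: "q > 0" using assms(1,2) prime_gt_0_nat by auto
  have c: "(of_nat (n choose j) :: 'a) = coeff ([:1, 1:] ^ n) j" for n j
    by (simp add: coeff_shift_power)
  have "([:1, 1:] :: 'a poly) ^ q = (1 + monom 1 1) ^ q" by (simp add: monom_altdef one_pCons)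
  also have "\<dots> = 1 + monom 1 q"
    by (subst freshmans_dream') (use assms in \<open>simp_all add: monom_power\<close>)
  finally have X: "([:1, 1:] :: 'a poly) ^ q = 1 + monom 1 q" .
  have Y: "coeff ([:1, 1:] * A) k = coeff A k + (if k = 0 then 0 else coeff A (k - 1))" for A :: "'a poly" and k
    by (cases k) (simp_all add: coeff_pCons)
  show "(of_nat ((1 + q) choose j) :: 'a) = 0" if "j \<notin> {0, 1, q, 1 + q}"
  proof -
    have "coeff ([:1, 1:] * (1 + monom 1 q) :: 'a poly) j = 0"
      using that unfolding Y by (auto simp: coeff_1)
    thus ?thesis unfolding c power_add X by simp
  qed
  have "(monom 1 q + 1 :: 'a poly) ^ l = (\<Sum>t\<le>l. of_nat (l choose t) * monom 1 q ^ t * 1 ^ (l - t))"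
    by (rule binomial_ring)
  also have "\<dots> = (\<Sum>t\<le>l. monom (of_nat (l choose t)) (q * t))"
    by (intro sum.cong) (simp_all add: monom_power of_nat_poly smult_monom)
  finally have l: "(1 + monom 1 q :: 'a poly) ^ l = (\<Sum>t\<le>l. monom (of_nat (l choose t)) (q * t))"
    by (simp add: add.commute)
  have Z: "coeff ((1 + monom 1 q :: 'a poly) ^ l) (q * t) = of_nat (l choose t)" if "t \<le> l" for t
  proof -
    have "coeff ((1 + monom 1 q :: 'a poly) ^ l) (q * t)
        = (\<Sum>i\<le>l. if i = t then of_nat (l choose i) else 0)"
      unfolding l coeff_sum using q0 by (intro sum.cong) auto
    thus ?thesis using that by (simp add: sum.delta)
  qed
  have Z': "coeff ((1 + monom 1 q :: 'a poly) ^ l) k = 0" if "\<not> q dvd k" for k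
    unfolding l coeff_sum using that by (intro sum.neutral) auto
  have "(of_nat ((1 + l * q) choose q) :: 'a) = coeff ([:1, 1:] * (1 + monom 1 q) ^ l) q"
    unfolding c power_add by (simp add: power_mult mult.commute[of l q] X)
  also have "\<dots> = of_nat l + coeff ((1 + monom 1 q) ^ l) (q - 1)"
    unfolding Y using Z[of 1] q0 assms(3) by simp
  also have "coeff ((1 + monom 1 q :: 'a poly) ^ l) (q - 1) = (if a = 0 then 1 else 0)"
  proof (cases "a = 0")
    case True
    thus ?thesis using Z[of 0] assms(2) by simp
  next
    case False
    hence "q > 1" using assms(1,2) prime_gt_1_nat one_less_power by blast
    hence "\<not> q dvd q - 1" by (auto dest: dvd_imp_le)
    thus ?thesis using Z' False by simp
  qed
  finally show "(of_nat ((1 + l * q) choose q) :: 'a) = (if a = 0 then of_nat (1 + l) else of_nat l)"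
    by simp
qed

context artin_schreier
begin

section \<open>Polynomials of the form \<open>P^p - P\<close>\<close>

definition AS_image :: "'k poly set" where
  "AS_image = range (\<lambda>P. P ^ p - P)"

lemma V_iff: "y \<in> V \<longleftrightarrow> pcompose f [:y, 1:] - f \<in> AS_image"
  by (simp add: V_def admissible_def AS_image_def image_iff) metis

lemma AS_image_add: "A \<in> AS_image \<Longrightarrow> B \<in> AS_image \<Longrightarrow> A + B \<in> AS_image"
proof -
  assume "A \<in> AS_image" "B \<in> AS_image"
  then obtain P Q where "A = P ^ p - P" "B = Q ^ p - Q" by (auto simp: AS_image_def)
  moreover have "(P + Q) ^ p = P ^ p + Q ^ p"
    by (rule freshmans_dream[OF prime_char_poly]) (simp add: p_eq)
  ultimately have "A + B = (P + Q) ^ p - (P + Q)" by simp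
  thus ?thesis by (simp add: AS_image_def)
qed

lemma AS_image_uminus: "A \<in> AS_image \<Longrightarrow> - A \<in> AS_image"
proof -
  assume "A \<in> AS_image"
  then obtain P where "A = P ^ p - P" by (auto simp: AS_image_def)
  moreover have "(- P) ^ p = - (P ^ p)" by (rule minus_power_p) (simp add: p_eq)
  ultimately have "- A = (- P) ^ p - (- P)" by simp
  thus ?thesis unfolding AS_image_def by blast
qed

lemma AS_image_0: "0 \<in> AS_image"
proof -
  have "(0 :: 'k poly) = 0 ^ p - 0" using p_pos by (simp add: zero_power)
  thus ?thesis unfolding AS_image_def by blast
qed

lemma AS_image_sum: "(\<And>i. i \<in> I \<Longrightarrow> g i \<in> AS_image) \<Longrightarrow> sum g I \<in> AS_image"
  by (induction I rule: infinite_finite_induct) (auto intro: AS_image_0 AS_image_add)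

lemma AS_image_const: "[:c:] \<in> AS_image"
proof -
  have "coeff (monom 1 p - monom 1 1 - [:c:]) p = 1"
    using p_gt_1 by (simp add: coeff_pCons split: nat.split)
  hence "degree (monom 1 p - monom 1 1 - [:c:]) > 0"
    using p_gt_1 le_degree[of "monom 1 p - monom 1 1 - [:c:]" p] by simp
  then obtain d where "poly (monom 1 p - monom 1 1 - [:c:]) d = 0"
    using alg_closed_imp_poly_has_root by blast
  hence "[:c:] = [:d:] ^ p - [:d:]" by (simp add: poly_monom poly_const_pow algebra_simps)
  thus ?thesis unfolding AS_image_def by blast
qed

text \<open>A telescoping sum. Modulo \<open>AS_image\<close> a monomial of degree
  \<open>p^i\<close> may be replaced by a linear one, at the price of a \<open>p^i\<close>-th root
  of its coefficient.\<close>

lemma AS_image_monom: "monom (b ^ (p ^ i)) (p ^ i) - monom b 1 \<in> AS_image"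
proof (induction i)
  case (Suc i)
  have "monom (b ^ (p ^ Suc i)) (p ^ Suc i) - monom (b ^ (p ^ i)) (p ^ i)
      = monom (b ^ (p ^ i)) (p ^ i) ^ p - monom (b ^ (p ^ i)) (p ^ i)"
    by (simp add: monom_power mult.commute flip: power_mult)
  hence "monom (b ^ (p ^ Suc i)) (p ^ Suc i) - monom (b ^ (p ^ i)) (p ^ i) \<in> AS_image"
    unfolding AS_image_def by blast
  from AS_image_add[OF this Suc.IH] show ?case by simp
qed (simp add: AS_image_0)

lemma coeff_power_p:
  "coeff (P ^ p) i = (if p dvd i then coeff P (i div p) ^ p else 0)" for P :: "'k poly"
proof -
  have "P ^ p = (\<Sum>i\<le>degree P. monom (coeff P i) i) ^ p" by (simp only: poly_as_sum_of_monoms)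
  also have "\<dots> = (\<Sum>i\<le>degree P. monom (coeff P i) i ^ p)"
    by (rule freshmans_dream_sum[OF prime_char_poly]) (simp add: p_eq)
  finally have "coeff (P ^ p) i = (\<Sum>k\<le>degree P. if k * p = i then coeff P k ^ p else 0)"
    by (simp add: coeff_sum monom_power)
  also have "\<dots> = (if p dvd i then coeff P (i div p) ^ p else 0)"
  proof (cases "p dvd i")
    case True
    have "(\<Sum>k\<le>degree P. if k * p = i then coeff P k ^ p else 0)
        = (\<Sum>k\<le>degree P. if k = i div p then coeff P (i div p) ^ p else 0)"
      using True p_pos by (intro sum.cong) auto
    also have "\<dots> = coeff P (i div p) ^ p"
      using p_pos by (auto simp: coeff_eq_0 zero_power)
    finally show ?thesis using True by simp
  next
    case False
    have "(\<Sum>k\<le>degree P. if k * p = i then coeff P k ^ p else 0) = 0"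
      by (rule sum.neutral) (use False in auto)
    thus ?thesis using False by simp
  qed
  finally show ?thesis .
qed

text \<open>If \<open>D = P^p - P\<close> vanishes at \<open>j p, j p^2, ...\<close>, then the
  coefficients of \<open>P\<close> there are successive \<open>p\<close>-th powers of the one at
  \<open>j\<close>. Beyond the degree of \<open>P\<close> they are 0, so all of them are 0.\<close>

lemma AS_image_coeff:
  assumes "D \<in> AS_image" "\<not> p dvd j" "\<And>e. e > 0 \<Longrightarrow> coeff D (j * p ^ e) = 0"
  shows "coeff D j = 0"
proof -
  obtain P where P: "D = P ^ p - P" using assms(1) by (auto simp: AS_image_def)
  have c: "coeff P (j * p ^ e) = coeff P j ^ (p ^ e)" for e
  proof (induction e)
    case (Suc e)
    have "coeff (P ^ p) (j * p ^ Suc e) = coeff P (j * p ^ e) ^ p"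
      using p_pos by (simp add: coeff_power_p)
    moreover have "coeff (P ^ p) (j * p ^ Suc e) = coeff P (j * p ^ Suc e)"
      using assms(3)[of "Suc e"] by (simp add: P)
    ultimately show ?case using Suc.IH by (simp add: mult.commute flip: power_mult)
  qed simp
  have "j > 0" using assms(2) by (cases j) auto
  have "degree P < 2 ^ degree P" by (rule less_exp)
  also have "\<dots> \<le> p ^ degree P" using p_gt_1 by (intro power_mono) auto
  also have "\<dots> \<le> j * p ^ degree P" using \<open>j > 0\<close> by simp
  finally have "degree P < j * p ^ degree P" .
  hence "coeff P j ^ (p ^ degree P) = 0" using c[of "degree P"] by (simp add: coeff_eq_0)
  hence "coeff P j = 0" by simp
  thus ?thesis using assms(2) by (simp add: P coeff_power_p)
qed

end

section \<open>Counting translations for a reduced polynomial\<close>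

locale reduced_artin_schreier = artin_schreier f p
  for f :: "'k::alg_closed_field poly" and p +
  assumes reduced: "reduced_poly f"
begin

lemma coeff_f_0: "coeff f 0 = 0"
  using reduced unfolding reduced_poly_def by (metis not_one_le_zero)

lemma reducedD: "coeff f i \<noteq> 0 \<Longrightarrow> \<not> p dvd i"
  using reduced p_eq p_gt_1 unfolding reduced_poly_def
  by (metis coprime_common_divisor dvd_refl nat_dvd_1_iff_1 less_irrefl)

lemma coeff_diff_shift:
  assumes "degree f \<le> n"
  shows "coeff (pcompose f [:y, 1:] - f) s
    = (\<Sum>i\<in>{s<..n}. of_nat (i choose s) * y ^ (i - s) * coeff f i)"
proof (cases "s \<le> n")
  case True
  hence "{s..n} = insert s {s<..n}" by auto
  thus ?thesis by (simp add: coeff_pcompose_shift[OF assms])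
qed (use assms in \<open>simp add: coeff_pcompose_shift[OF assms] coeff_eq_0\<close>)

text \<open>The exponents of \<open>X R\<close> for additive \<open>R\<close>, together with 1:
  under a translation the linear term changes only by a constant, which lies in
  \<open>AS_image\<close>.\<close>

definition special :: "nat set" where
  "special = insert 1 (range (\<lambda>n. 1 + p ^ n))"

text \<open>The bound on \<open>V\<close> comes from the coefficient of \<open>X\<^sup>j\<close>, \<open>j = M - p\<^sup>a\<close>, in \<open>f(X + y) - f(X)\<close>,
  where \<open>M = 1 + l p\<^sup>a\<close> is the largest exponent not of the form \<open>1 + p\<^sup>n\<close>: the special exponents do
  not contribute to it, and it vanishes for \<open>y \<in> V\<close> since \<open>f(X + y) - f(X)\<close> has no monomials
  \<open>X\<^bsup>j p\<^sup>e\<^esup>\<close>, \<open>e > 0\<close>.\<close>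

lemma card_V_bound:
  assumes "coeff f i0 \<noteq> 0" "i0 \<notin> special"
  obtains l a where "2 \<le> l" "l * p ^ a < degree f" "finite V" "card V \<le> p ^ a"
    "p = 2 \<Longrightarrow> 3 \<le> l \<and> 2 * card V \<le> p ^ a"
proof -
  define B where "B = {i. coeff f i \<noteq> 0 \<and> i \<notin> special}"
  define M where "M = Max B"
  have "B \<subseteq> {..degree f}" by (auto simp: B_def intro: le_degree)
  hence finB: "finite B" by (rule finite_subset) simp
  have "M \<in> B" unfolding M_def using finB assms by (intro Max_in) (auto simp: B_def)
  hence fM: "coeff f M \<noteq> 0" and Ms: "M \<notin> special" by (auto simp: B_def)
  have Mmax: "i \<le> M" if "coeff f i \<noteq> 0" "i \<notin> special" for i
    unfolding M_def using finB that by (intro Max_ge) (auto simp: B_def)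
  have "M \<noteq> 0" using fM coeff_f_0 by metis
  moreover have "M \<noteq> 1" using Ms by (auto simp: special_def)
  ultimately have "M - 1 \<noteq> 0" by simp
  moreover have "\<not> is_unit p" using p_gt_1 by simp
  ultimately obtain l where l: "M - 1 = p ^ multiplicity p (M - 1) * l" "\<not> p dvd l"
    using multiplicity_decompose'[of "M - 1" p] by blast
  define a where "a = multiplicity p (M - 1)"
  have M: "M = 1 + l * p ^ a" using l(1) \<open>M - 1 \<noteq> 0\<close> by (simp add: a_def mult.commute)
  have "l \<noteq> 0" using l(2) by (intro notI) simp
  moreover have "l \<noteq> 1"
  proof
    assume "l = 1"
    hence "M = 1 + p ^ a" using M by simp
    hence "M \<in> special" unfolding special_def by blast
    thus False using Ms by simp
  qed
  ultimately have l2: "l \<ge> 2" by simp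
  have pM: "\<not> p dvd M" using fM by (rule reducedD)
  define j where "j = 1 + (l - 1) * p ^ a"
  have Mj: "M = j + p ^ a" using l2 by (simp add: M j_def diff_mult_distrib)
  have pa: "p ^ a > 0" using p_pos by simp
  have j2: "j \<ge> 2" using l2 pa by (simp add: j_def Suc_le_eq)
  have pj: "\<not> p dvd j"
  proof (cases "a = 0")
    case True
    thus ?thesis using l(2) l2 by (simp add: j_def)
  next
    case False
    hence "p dvd (l - 1) * p ^ a" by simp
    thus ?thesis using p_gt_1 unfolding j_def by (metis dvd_add_left_iff nat_dvd_1_iff_1 less_irrefl)
  qed
  \<comment> \<open>\<open>(1 + X) (1 + X^(p^n))\<close> has only the exponents 0, 1,
    \<open>p^n\<close> and \<open>1 + p^n\<close>. As \<open>j\<close> is at least 2 and prime to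
    \<open>p\<close>, the number \<open>j p^e\<close> is neither 0, 1 nor a power of
    \<open>p\<close>.\<close>
  have special0: "(of_nat (i choose (j * p ^ e)) :: 'k) = 0" if i: "i \<in> special" "j * p ^ e < i" for i e
  proof -
    define s where "s = j * p ^ e"
    have s2: "s \<ge> 2" using j2 p_pos mult_le_mono[of 2 j 1 "p ^ e"] by (simp add: s_def)
    then obtain n where n: "i = 1 + p ^ n" using i by (auto simp: special_def s_def)
    have "s \<noteq> p ^ n"
    proof
      assume "s = p ^ n"
      hence "j dvd p ^ n" unfolding s_def by (metis dvd_triv_left)
      then obtain k where "j = p ^ k" using p_prime by (auto simp: divides_primepow_nat)
      thus False using pj j2 by (cases k) auto
    qed
    hence s: "s \<notin> {0, 1, p ^ n, 1 + p ^ n}" using s2 i(2) n by (auto simp: s_def[symmetric])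
    have "Factorial_Ring.prime CHAR('k)" "p ^ n = CHAR('k) ^ n" using p_prime p_eq by simp_all
    from of_nat_choose_prime_power_mult(2)[OF this zero_less_one s]
    show ?thesis unfolding n s_def .
  qed
  \<comment> \<open>From \<open>l \<le> (l - 1) p\<close>. Non-special exponents of \<open>f\<close>
    thus cannot exceed \<open>j p^e\<close> for \<open>e > 0\<close>.\<close>
  have jpM: "M \<le> j * p ^ e" if "e > 0" for e
  proof -
    have "l \<le> (l - 1) * 2" using l2 by simp
    also have "\<dots> \<le> (l - 1) * p" using p_gt_1 by (intro mult_le_mono) auto
    finally have "l * p ^ a \<le> (l - 1) * p * p ^ a" by (rule mult_le_mono1)
    hence "M \<le> j * p" using p_gt_1 by (simp add: M j_def algebra_simps)
    also have "\<dots> \<le> j * p ^ e" using that p_pos by (intro mult_le_mono self_le_power) auto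
    finally show ?thesis .
  qed
  \<comment> \<open>The coefficient of \<open>X^j\<close> in \<open>f(X + y) - f(X)\<close>, with
    \<open>y\<close> as the variable. Its top coefficient involves \<open>M choose p^a\<close>,
    which in \<open>k\<close> is \<open>l\<close>, or \<open>1 + l = M\<close> when
    \<open>a = 0\<close>; neither is divisible by \<open>p\<close>.\<close>
  define E where "E = (\<Sum>k\<in>{1..p ^ a}. monom (of_nat ((j + k) choose j) * coeff f (j + k)) k)"
  have E: "coeff E k = (if k \<in> {1..p ^ a} then of_nat ((j + k) choose j) * coeff f (j + k) else 0)" for k
    unfolding E_def coeff_sum coeff_monom by (subst sum.delta) auto
  have root: "poly E y = 0" if "y \<in> V" for y
  proof -
    let ?D = "pcompose f [:y, 1:] - f"
    have "coeff ?D j = 0"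
    proof (rule AS_image_coeff)
      show "?D \<in> AS_image" using that V_iff by simp
      show "coeff ?D (j * p ^ e) = 0" if e: "e > 0" for e
        unfolding coeff_diff_shift[OF order.refl]
      proof (rule sum.neutral, intro ballI)
        fix i assume i: "i \<in> {j * p ^ e<..degree f}"
        show "of_nat (i choose (j * p ^ e)) * y ^ (i - j * p ^ e) * coeff f i = 0"
        proof (cases "i \<in> special")
          case True
          thus ?thesis using special0[of i e] i by simp
        next
          case False
          thus ?thesis using Mmax[of i] jpM[OF e] i by auto
        qed
      qed
    qed (rule pj)
    hence "0 = (\<Sum>i\<in>{j<..degree f}. of_nat (i choose j) * y ^ (i - j) * coeff f i)"
      by (simp only: coeff_diff_shift[OF order.refl])
    also have "\<dots> = (\<Sum>i\<in>{j<..M}. of_nat (i choose j) * y ^ (i - j) * coeff f i)"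
    proof (rule sum.mono_neutral_right)
      show "{j<..M} \<subseteq> {j<..degree f}" using le_degree[OF fM] by auto
      show "\<forall>i\<in>{j<..degree f} - {j<..M}. of_nat (i choose j) * y ^ (i - j) * coeff f i = 0"
      proof
        fix i assume i: "i \<in> {j<..degree f} - {j<..M}"
        show "of_nat (i choose j) * y ^ (i - j) * coeff f i = 0"
        proof (cases "i \<in> special")
          case True
          thus ?thesis using special0[of i 0] i by simp
        next
          case False
          thus ?thesis using Mmax[of i] i by auto
        qed
      qed
    qed simp
    also have "\<dots> = (\<Sum>k\<in>{1..p ^ a}. of_nat ((j + k) choose j) * y ^ k * coeff f (j + k))"
      by (rule sum.reindex_bij_witness[of _ "\<lambda>k. j + k" "\<lambda>i. i - j"]) (auto simp: Mj)
    also have "\<dots> = poly E y" by (simp add: E_def poly_sum poly_monom mult_ac)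
    finally show ?thesis by simp
  qed
  have "M choose j = M choose p ^ a" using binomial_symmetric[of j M] by (simp add: Mj)
  moreover have "(of_nat (M choose p ^ a) :: 'k) \<noteq> 0"
    using of_nat_choose_prime_power_mult(1)[where 'a = 'k, of "p ^ a" a l] p_prime p_eq l(2) pM l2
    unfolding M by (auto simp: of_nat_eq_0_iff_char_dvd simp del: of_nat_add of_nat_Suc split: if_splits)
  ultimately have "coeff E (p ^ a) \<noteq> 0" using fM pa by (simp add: E Suc_le_eq flip: Mj)
  hence E0: "E \<noteq> 0" by auto
  have dE: "degree E \<le> p ^ a" by (rule degree_le) (simp add: E)
  have sub: "V \<subseteq> {y. poly E y = 0}" using root by auto
  have fin: "finite {y. poly E y = 0}" by (rule poly_roots_finite[OF E0])
  have cV: "card V \<le> card {y. poly E y = 0}" by (rule card_mono[OF fin sub])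
  have finV: "finite V" by (rule finite_subset[OF sub fin])
  have bound: "card V \<le> p ^ a" using cV card_poly_roots_bound[OF E0] dE by simp
  \<comment> \<open>Here \<open>l\<close> and \<open>j\<close> are odd. So \<open>j + 1\<close> is
    even and is not an exponent of \<open>f\<close>, which removes the linear term of
    \<open>E\<close> and makes 0 a double zero. Being a power of 2 strictly below
    \<open>2^a\<close>, the order of \<open>V\<close> is at most half of it.\<close>
  have p2: "3 \<le> l \<and> 2 * card V \<le> p ^ a" if p2: "p = 2"
  proof
    show "3 \<le> l" using l(2) l2 p2 by (cases "l = 2") auto
    have "coeff f (j + 1) = 0"
      using reducedD[of "j + 1"] pj p2 by auto
    hence "card {y. poly E y = 0} < degree E"
      by (intro card_roots_double_zero E0) (simp_all add: E)
    hence "card V < p ^ a" using cV dE by simp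
    moreover obtain v where v: "card V = p ^ v" using card_V[OF finV] by blast
    ultimately have "v < a" using p_gt_1 power_strict_increasing_iff by metis
    hence "p ^ Suc v \<le> p ^ a" using p_gt_1 by (intro power_increasing) auto
    thus "2 * card V \<le> p ^ a" using v p2 by simp
  qed
  show thesis
    by (rule that[OF l2 _ finV bound p2]) (use le_degree[OF fM] M in auto)
qed

text \<open>Shifting \<open>X^(1 + p^i)\<close> produces terms in \<open>X^(p^i)\<close>, in
  \<open>X\<close>, and a constant. Modulo \<open>AS_image\<close> everything collapses to a linear
  monomial \<open>e X\<close>, so that \<open>y\<close> lies in \<open>V\<close> iff
  \<open>e = 0\<close>. Raising \<open>e\<close> to the power \<open>p^n\<close> removes the roots
  and leaves a polynomial in \<open>y\<close> with nonzero constant derivative.\<close>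

lemma card_V_special:
  assumes sp: "\<And>i. coeff f i \<noteq> 0 \<Longrightarrow> i \<in> special" and deg: "degree f = 1 + p ^ n"
  shows "finite V" "card V = p ^ (2 * n)"
proof -
  define a where "a i = coeff f (1 + p ^ i)" for i
  \<comment> \<open>\<open>E(y)\<close> is \<open>e^(p^n)\<close> for the \<open>e\<close> defined
    below: with \<open>b_i^(p^i) = a_i y\<close>, the summand \<open>b_i\<close> contributes
    \<open>(a_i y)^(p^(n-i))\<close>.\<close>
  define E where "E = (\<Sum>i\<le>n. monom (a i ^ (p ^ (n - i))) (p ^ (n - i)) + monom (a i ^ (p ^ n)) (p ^ (n + i)))"
  have inj: "p ^ i = p ^ i' \<longleftrightarrow> i = i'" for i i' using p_gt_1 by simp
  have f: "f = monom (coeff f 1) 1 + (\<Sum>i\<le>n. monom (a i) (1 + p ^ i))"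
  proof (rule poly_eqI)
    fix k
    have s: "coeff (\<Sum>i\<le>n. monom (a i) (1 + p ^ i)) k = (\<Sum>i\<le>n. if 1 + p ^ i = k then a i else 0)"
      by (simp add: coeff_sum)
    show "coeff f k = coeff (monom (coeff f 1) 1 + (\<Sum>i\<le>n. monom (a i) (1 + p ^ i))) k"
    proof (cases "\<exists>i\<le>n. k = 1 + p ^ i")
      case True
      then obtain i where i: "i \<le> n" "k = 1 + p ^ i" by blast
      have "(\<Sum>i'\<le>n. if 1 + p ^ i' = k then a i' else 0) = (\<Sum>i'\<le>n. if i' = i then a i else 0)"
        using inj i(2) by (intro sum.cong) auto
      thus ?thesis unfolding coeff_add s using i p_pos by (simp add: a_def)
    next
      case False
      hence z: "(\<Sum>i\<le>n. if 1 + p ^ i = k then a i else 0) = 0" by (intro sum.neutral) auto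
      have "coeff f k = 0" if k1: "k \<noteq> 1"
      proof (rule ccontr)
        assume k: "coeff f k \<noteq> 0"
        then obtain i where i: "k = 1 + p ^ i" using sp[OF k] k1 by (auto simp: special_def)
        have "p ^ i \<le> p ^ n" using le_degree[OF k] deg i by simp
        hence "i \<le> n" using p_gt_1 by simp
        thus False using False i by blast
      qed
      thus ?thesis unfolding coeff_add s z by simp
    qed
  qed
  have an: "a n \<noteq> 0" using deg unfolding a_def by (metis leading_coeff_0_iff degree_0 add_is_0 zero_neq_one)
  have mem: "y \<in> V \<longleftrightarrow> poly E y = 0" for y
  proof -
    have "\<exists>b. b ^ (p ^ i) = a i * y" for i
      using nth_root_exists[of "p ^ i" "a i * y"] p_pos by auto
    then obtain b where b: "b i ^ (p ^ i) = a i * y" for i by metis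
    define e where "e = (\<Sum>i\<le>n. b i + a i * y ^ (p ^ i))"
    let ?D = "pcompose f [:y, 1:] - f"
    have sp: "[:y, 1:] ^ (p ^ i) = [:y ^ (p ^ i):] + monom 1 (p ^ i)" for i
    proof -
      have "[:y, 1:] ^ (p ^ i) = ([:y:] + monom 1 1) ^ (p ^ i)" by (simp add: monom_altdef)
      also have "\<dots> = [:y:] ^ (p ^ i) + monom 1 1 ^ (p ^ i)"
        by (rule freshmans_dream'[OF prime_char_poly]) (simp add: p_eq)
      finally show ?thesis by (simp add: poly_const_pow monom_power)
    qed
    have t: "pcompose (monom c (1 + p ^ i)) [:y, 1:] - monom c (1 + p ^ i)
        = monom (c * y) (p ^ i) + monom (c * y ^ (p ^ i)) 1 + [:c * y ^ (p ^ i) * y:]" for c i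
    proof -
      have "[:y, 1:] ^ (1 + p ^ i) = ([:y:] + monom 1 1) * ([:y ^ (p ^ i):] + monom 1 (p ^ i))"
        unfolding power_add sp by (simp add: monom_altdef)
      also have "\<dots> = [:y * y ^ (p ^ i):] + monom y (p ^ i) + monom (y ^ (p ^ i)) 1 + monom 1 (1 + p ^ i)"
        by (simp add: distrib_left distrib_right smult_monom mult_monom mult.commute)
      finally show ?thesis unfolding pcompose_monom by (simp add: smult_add_right smult_monom mult_ac)
    qed
    have "?D = (pcompose (monom (coeff f 1) 1) [:y, 1:] - monom (coeff f 1) 1)
        + (\<Sum>i\<le>n. pcompose (monom (a i) (1 + p ^ i)) [:y, 1:] - monom (a i) (1 + p ^ i))"
      by (subst (1 2) f) (simp add: pcompose_add pcompose_sum sum_subtractf)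
    also have "pcompose (monom (coeff f 1) 1) [:y, 1:] - monom (coeff f 1) 1 = [:coeff f 1 * y:]"
      unfolding pcompose_monom by (simp add: monom_altdef)
    finally have D: "?D = [:coeff f 1 * y:] + (\<Sum>i\<le>n. monom (a i * y) (p ^ i) + monom (a i * y ^ (p ^ i)) 1
        + [:a i * y ^ (p ^ i) * y:])"
      unfolding t .
    have "(\<Sum>i\<le>n. monom (a i * y) (p ^ i) + monom (a i * y ^ (p ^ i)) 1 + [:a i * y ^ (p ^ i) * y:])
      = monom e 1 + (\<Sum>i\<le>n. (monom (b i ^ (p ^ i)) (p ^ i) - monom (b i) 1) + [:a i * y ^ (p ^ i) * y:])"
      unfolding e_def monom_sum sum.distrib[symmetric] b
      by (intro sum.cong) (simp_all flip: add_monom)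
    hence "?D - monom e 1 = [:coeff f 1 * y:] + (\<Sum>i\<le>n. (monom (b i ^ (p ^ i)) (p ^ i) - monom (b i) 1)
        + [:a i * y ^ (p ^ i) * y:])"
      unfolding D by simp
    also have "\<dots> \<in> AS_image"
      by (intro AS_image_add AS_image_sum AS_image_const AS_image_monom)
    finally have De: "?D - monom e 1 \<in> AS_image" .
    have "y \<in> V \<longleftrightarrow> monom e 1 \<in> AS_image"
      unfolding V_iff
      using AS_image_add[OF De, of "monom e 1"] AS_image_add[OF AS_image_uminus[OF De], of ?D] by auto
    also have "\<dots> \<longleftrightarrow> e = 0"
    proof
      assume "monom e 1 \<in> AS_image"
      hence "coeff (monom e 1) 1 = 0"
      proof (rule AS_image_coeff)
        show "coeff (monom e 1) (1 * p ^ i) = 0" if "i > 0" for i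
          using one_less_power[OF p_gt_1 that] by simp
      qed (use p_gt_1 in simp)
      thus "e = 0" by simp
    qed (simp add: AS_image_0)
    also have "\<dots> \<longleftrightarrow> e ^ (p ^ n) = 0" using p_pos by simp
    also have "e ^ (p ^ n) = (\<Sum>i\<le>n. (b i + a i * y ^ (p ^ i)) ^ (p ^ n))"
      unfolding e_def by (rule freshmans_dream_sum') (use p_prime p_eq in auto)
    also have "\<dots> = poly E y"
      unfolding E_def poly_sum
    proof (rule sum.cong)
      fix i assume i: "i \<in> {..n}"
      have "p ^ n = p ^ i * p ^ (n - i)" using i by (simp flip: power_add)
      hence "b i ^ (p ^ n) = (a i * y) ^ (p ^ (n - i))" by (simp add: power_mult b)
      moreover have "(b i + a i * y ^ (p ^ i)) ^ (p ^ n) = b i ^ (p ^ n) + (a i * y ^ (p ^ i)) ^ (p ^ n)"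
        by (rule freshmans_dream') (use p_prime p_eq in auto)
      moreover have "p ^ i * p ^ n = p ^ (n + i)" by (simp add: power_add mult.commute)
      ultimately show "(b i + a i * y ^ (p ^ i)) ^ (p ^ n)
        = poly (monom (a i ^ (p ^ (n - i))) (p ^ (n - i)) + monom (a i ^ (p ^ n)) (p ^ (n + i))) y"
        by (simp add: poly_monom power_mult_distrib flip: power_mult)
    qed simp
    finally show ?thesis .
  qed
  have cp: "(of_nat (p ^ k) :: 'k) = (if k = 0 then 1 else 0)" for k
    using p_eq by simp
  \<comment> \<open>The derivative of \<open>E\<close>: only exponents equal to \<open>p^0\<close>
    survive, that is \<open>i = n\<close> in the first family and \<open>i = n = 0\<close> in the
    second. For \<open>n = 0\<close> both coincide, and 2 is nonzero because
    \<open>degree f = 2\<close> is prime to \<open>p\<close>.\<close>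
  define s where "s = (if n = 0 then 2 * a 0 else a n)"
  have "s \<noteq> 0"
  proof (cases "n = 0")
    case True
    have "p \<noteq> 2" using coprime_deg deg True by auto
    hence "\<not> p dvd 2" using p_gt_1 by (auto dest: dvd_imp_le)
    hence "(of_nat 2 :: 'k) \<noteq> 0" unfolding of_nat_eq_0_iff_char_dvd p_eq .
    thus ?thesis using True an by (simp add: s_def)
  qed (use an in \<open>simp add: s_def\<close>)
  have "pderiv E = [:s:]"
  proof -
    have ps: "pderiv (sum g I) = (\<Sum>i\<in>I. pderiv (g i))" for g :: "nat \<Rightarrow> 'k poly" and I
      by (induction I rule: infinite_finite_induct) (simp_all add: pderiv_add)
    have "pderiv E = (\<Sum>i\<le>n. (if i = n then [:a n:] else 0) + (if n = 0 then [:a 0:] else 0))"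
      unfolding E_def ps
      by (intro sum.cong) (auto simp: pderiv_add pderiv_monom cp monom_0 simp del: of_nat_power)
    thus ?thesis by (auto simp: sum.distrib s_def)
  qed
  hence sep: "poly (pderiv E) y \<noteq> 0" for y using \<open>s \<noteq> 0\<close> by simp
  have "coeff E (p ^ (n + n)) \<noteq> 0"
  proof (cases "n = 0")
    case True
    hence "coeff E (p ^ (n + n)) = s"
      unfolding E_def coeff_sum coeff_add coeff_monom s_def by simp
    thus ?thesis using \<open>s \<noteq> 0\<close> by simp
  next
    case False
    have "coeff E (p ^ (n + n)) = (\<Sum>i\<le>n. if i = n then a n ^ (p ^ n) else 0)"
      unfolding E_def coeff_sum coeff_add coeff_monom inj using False by (intro sum.cong) auto
    thus ?thesis using an by simp
  qed
  moreover have "degree E \<le> p ^ (n + n)"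
    unfolding E_def using p_pos
    by (intro degree_sum_le degree_add_le order.trans[OF degree_monom_le] power_increasing) auto
  ultimately have "degree E = p ^ (2 * n)" "E \<noteq> 0"
    using le_degree[of E "p ^ (n + n)"] by (auto simp: mult_2)
  moreover have "V = {y. poly E y = 0}" using mem by auto
  ultimately show "finite V" "card V = p ^ (2 * n)"
    using poly_roots_finite[of E] card_roots_separable[of E] sep by auto
qed

lemma special_form:
  assumes sp: "\<And>i. coeff f i \<noteq> 0 \<Longrightarrow> i \<in> special"
  obtains R where "additive_poly R" "f = [:0, 1:] * R + monom (coeff f 1) 1"
proof -
  \<comment> \<open>The summation bound is generous: \<open>i < p^i\<close> ensures that every
    exponent \<open>1 + p^i\<close> occurring in \<open>f\<close> has
    \<open>i \<le> degree f\<close>.\<close>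
  define R where "R = (\<Sum>i\<le>degree f. monom (coeff f (1 + p ^ i)) (p ^ i))"
  have "additive_poly R" 
    unfolding additive_poly_def R_def p_eq
    by (intro exI[of _ "\<lambda>i. coeff f (1 + CHAR('k) ^ i)"] exI[of _ "degree f"]) (rule refl)
  moreover have "f = [:0, 1:] * R + monom (coeff f 1) 1"
  proof (rule poly_eqI)
    fix k
    have R: "coeff R t = (\<Sum>i\<le>degree f. if p ^ i = t then coeff f (1 + p ^ i) else 0)" for t
      unfolding R_def coeff_sum coeff_monom by (rule refl)
    have inj: "p ^ i = p ^ i' \<longleftrightarrow> i = i'" for i i' using p_gt_1 by simp
    show "coeff f k = coeff ([:0, 1:] * R + monom (coeff f 1) 1) k"
    proof (cases k)
      case 0
      thus ?thesis using coeff_f_0 by simp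
    next
      case (Suc t)
      have eq: "coeff ([:0, 1:] * R + monom (coeff f 1) 1) k = coeff R t + (if t = 0 then coeff f 1 else 0)"
        using Suc by (simp add: coeff_pCons)
      show ?thesis
      proof (cases "\<exists>i\<le>degree f. t = p ^ i")
        case True
        then obtain i where i: "i \<le> degree f" "t = p ^ i" by blast
        have "coeff R t = (\<Sum>i'\<le>degree f. if i' = i then coeff f (1 + p ^ i) else 0)"
          unfolding R i(2) inj by (intro sum.cong) auto
        thus ?thesis unfolding eq using i p_pos Suc by simp
      next
        case False
        hence R0: "coeff R t = 0" unfolding R by (intro sum.neutral) auto
        have "coeff f k = 0" if t0: "t \<noteq> 0"
        proof (rule ccontr)
          assume k: "coeff f k \<noteq> 0"
          then obtain i where i: "k = 1 + p ^ i" using sp[OF k] t0 Suc by (auto simp: special_def)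
          have "i < 2 ^ i" by (rule less_exp)
          also have "\<dots> \<le> p ^ i" using p_gt_1 by (intro power_mono) auto
          finally have "i < p ^ i" .
          hence "i \<le> degree f" using le_degree[OF k] i by simp
          thus False using False i Suc by auto
        qed
        thus ?thesis unfolding eq R0 using Suc by auto
      qed
    qed
  qed
  ultimately show thesis by (rule that)
qed

text \<open>With \<open>m = degree f\<close> the ratio is
  \<open>2 p |V| / ((p - 1) (m - 1))\<close>. A non-special exponent gives
  \<open>|V| \<le> p^a\<close> and \<open>l p^a \<le> m - 1\<close>, hence a ratio of at most
  \<open>(2 / l) p / (p - 1)\<close>, where \<open>l \<ge> 2\<close>. For \<open>p = 2\<close> the
  sharper \<open>l \<ge> 3\<close> and \<open>|V| \<le> 2^a / 2\<close> give
  \<open>2 / 3\<close>.\<close>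

lemma special_of_large_wild_inertia:
  assumes large: "real (card (wild_inertia_infty f)) / genus_f f
    > (if p = 2 then 2 / 3 else real p / (real p - 1))"
  shows "coeff f i \<noteq> 0 \<Longrightarrow> i \<in> special"
proof (rule ccontr)
  assume "coeff f i \<noteq> 0" "i \<notin> special"
  then obtain l a where la: "2 \<le> l" "l * p ^ a < degree f" "finite V" "card V \<le> p ^ a"
    "p = 2 \<Longrightarrow> 3 \<le> l \<and> 2 * card V \<le> p ^ a"
    by (rule card_V_bound) blast
  let ?q = "real p ^ a" and ?d = "real (degree f) - 1"
  have "l * p ^ a + 1 \<le> degree f" using la(2) by simp
  hence "real (l * p ^ a + 1) \<le> real (degree f)" by (simp only: of_nat_le_iff)
  hence d: "real l * ?q \<le> ?d" by simp
  have p1: "real p > 1" using p_gt_1 by simp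
  have q0: "?q > 0" using p_pos by simp
  have d0: "?d > 0" using deg_ge_2 by simp
  have ratio: "real (card (wild_inertia_infty f)) / genus_f f
      = 2 * real p * real (card V) / (?d * (real p - 1))"
    using card_wild_inertia[OF la(3)] p_eq by (simp add: genus_f_def)
  show False
  proof (cases "p = 2")
    case True
    have "2 * card V \<le> p ^ a" "3 \<le> l" using la(5) True by auto
    hence "real (2 * card V) \<le> real (p ^ a)" by (simp only: of_nat_le_iff)
    hence "2 * real (card V) \<le> ?q" by simp
    moreover have "3 * ?q \<le> real l * ?q" using q0 \<open>3 \<le> l\<close> by (intro mult_right_mono) auto
    ultimately have "6 * real (card V) \<le> ?d" using d by linarith
    hence "2 * real p * real (card V) / (?d * (real p - 1)) \<le> 2 / 3"
      using True d0 by (simp add: field_simps)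
    thus False using large ratio True by simp
  next
    case False
    have "real (card V) \<le> real (p ^ a)" using la(4) by (simp only: of_nat_le_iff)
    hence "real (card V) \<le> ?q" by simp
    moreover have "2 * ?q \<le> real l * ?q" using q0 la(1) by (intro mult_right_mono) auto
    ultimately have "2 * real (card V) \<le> ?d" using d by linarith
    hence "2 * real (card V) / ?d \<le> 1" using d0 by (simp add: field_simps)
    hence "(2 * real (card V) / ?d) * (real p / (real p - 1)) \<le> 1 * (real p / (real p - 1))"
      using p1 by (intro mult_right_mono) auto
    hence "2 * real p * real (card V) / (?d * (real p - 1)) \<le> real p / (real p - 1)"
      by (simp add: mult_ac)
    thus False using large ratio False by simp
  qed
qed

end

theorem proposition4p16:
  fixes f :: "'k::alg_closed_field poly" and p :: nat
  assumes "p = CHAR('k)" and "p > 0"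
    and "coeff f 0 = 0"
    and "coprime (degree f) p"
    and "reduced_poly f"
    and "real (card (wild_inertia_infty f)) / genus_f f
           > (if p = 2 then 2 / 3 else real p / (real p - 1))"
  shows "(\<exists>R. additive_poly R \<and> f = [:0, 1:] * R + monom (coeff f 1) 1) \<and>
         (\<forall>n. degree f = 1 + p ^ n \<longrightarrow>
            real (card (wild_inertia_infty f)) / genus_f f
              = 2 * real p ^ n * (real p / (real p - 1)))"
proof -
  have "Factorial_Ring.prime p" using assms(1,2) prime_CHAR_semidom[where 'a = 'k] by simp
  hence p: "p > 1" by (rule prime_gt_1_nat)
  have "degree f \<noteq> 0"
  proof
    assume "degree f = 0"
    thus False using assms(4) p by simp
  qed
  moreover have "degree f \<noteq> 1"
  proof
    assume "degree f = 1"
    \<comment> \<open>Division by zero yields 0, so in genus 0 the ratio cannot exceed the positive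
      threshold.\<close>
    hence "genus_f f = 0" by (simp add: genus_f_def)
    moreover have "real p / (real p - 1) > 0" using p by simp
    ultimately show False using assms(6) by (simp split: if_splits)
  qed
  ultimately have "degree f \<ge> 2" by simp
  then interpret reduced_artin_schreier f p using assms by unfold_locales
  note sp = special_of_large_wild_inertia[OF assms(6)]
  have "real (card (wild_inertia_infty f)) / genus_f f = 2 * real p ^ n * (real p / (real p - 1))"
    if n: "degree f = 1 + p ^ n" for n
  proof -
    have "card (wild_inertia_infty f) = p * p ^ (2 * n)"
      using card_wild_inertia[OF card_V_special(1)] card_V_special(2) sp n by metis
    hence c: "real (card (wild_inertia_infty f)) = real p * (real p ^ n * real p ^ n)"
      by (simp add: mult_2 power_add)
    have g: "genus_f f = real p ^ n * (real p - 1) / 2"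
      using n assms(1) by (simp add: genus_f_def)
    have "P * (q * q) / (q * (P - 1) / 2) = 2 * q * (P / (P - 1))" if "q > 0" for P q :: real
      using that by simp
    from this[of "real p ^ n" "real p"] show ?thesis unfolding c g using p by simp
  qed
  moreover obtain R where "additive_poly R" "f = [:0, 1:] * R + monom (coeff f 1) 1"
    by (rule special_form[OF sp])
  ultimately show ?thesis by blast
qed

end
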